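(* Let $n\geq 2$. A continuous, translation invariant Minkowski valuation $\Phi:\mathcal{K}^n\to\mathcal{K}^n$ satisfies (VC) and $\dim(\Phi(\{0\}))=n-1$ if and only if there exist $L\in\mathcal{K}^n$ with $\dim L=n-1$ and a segment $S$ with $\dim(L+S)=n$ such that $$\Phi(K)=L+p_1(K)+\dots+p_{n-1}(K)+V_n(K)S\quad\text{for all }K\in\mathcal{K}^n,$$ where each $p_j:\mathcal{K}^n\to\mathbb{R}^n$ ($1\leq j\leq n-1$) is a continuous, translation invariant valuation, homogeneous of degree $j$.
   Context: $\mathcal{K}^n$ is the space of convex bodies in $\mathbb{R}^n$ with Hausdorff metric and Minkowski addition; adding a point means translating. A (Minkowski / vector-valued) valuation $Z$ satisfies $Z(K)+Z(L)=Z(K\cup L)+Z(K\cap L)$ whenever $K,L,K\cup L\in\mathcal{K}^n$; translation invariant means $Z(K+t)=Z(K)$; homogeneous of degree $j$ means $Z(\lambda K)=\lambda^jZ(K)$ for $\lambda>0$. (VC): there are $c,C>0$ with $cV_n(K)\le V_n(\Phi(K))\le CV_n(K)$ for all $K$. $\dim$ is the dimension of the affine hull. *)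

theory Defs
  imports "HOL-Analysis.Analysis"
begin

definition convex_body :: "'a::euclidean_space set \<Rightarrow> bool" where
  "convex_body K \<longleftrightarrow> K \<noteq> {} \<and> compact K \<and> convex K"

definition msum :: "'a::euclidean_space set \<Rightarrow> 'a set \<Rightarrow> 'a set" where
  "msum A B = {x + y | x y. x \<in> A \<and> y \<in> B}"

definition translate :: "'a::euclidean_space set \<Rightarrow> 'a \<Rightarrow> 'a set" where
  "translate A t = (\<lambda>x. x + t) ` A"

definition vol :: "'a::euclidean_space set \<Rightarrow> real" where
  "vol K = measure lebesgue K"

text \<open>Hausdorff distance (used for nonempty compact sets).\<close>
definition hausdist :: "'a::euclidean_space set \<Rightarrow> 'a set \<Rightarrow> real" where
  "hausdist A B = max (SUP x\<in>A. infdist x B) (SUP y\<in>B. infdist y A)"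

definition mink_valuation :: "('a::euclidean_space set \<Rightarrow> 'a set) \<Rightarrow> bool" where
  "mink_valuation Z \<longleftrightarrow> (\<forall>K L. convex_body K \<and> convex_body L \<and> convex_body (K \<union> L) \<longrightarrow>
      msum (Z K) (Z L) = msum (Z (K \<union> L)) (Z (K \<inter> L)))"

definition maps_bodies :: "('a::euclidean_space set \<Rightarrow> 'a set) \<Rightarrow> bool" where
  "maps_bodies Z \<longleftrightarrow> (\<forall>K. convex_body K \<longrightarrow> convex_body (Z K))"

definition mink_continuous :: "('a::euclidean_space set \<Rightarrow> 'a set) \<Rightarrow> bool" where
  "mink_continuous Z \<longleftrightarrow> (\<forall>K e. convex_body K \<and> e > 0 \<longrightarrow> (\<exists>d>0. \<forall>K'. convex_body K' \<and>
      hausdist K K' < d \<longrightarrow> hausdist (Z K) (Z K') < e))"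

definition mink_trans_inv :: "('a::euclidean_space set \<Rightarrow> 'a set) \<Rightarrow> bool" where
  "mink_trans_inv Z \<longleftrightarrow> (\<forall>K t. convex_body K \<longrightarrow> Z (translate K t) = Z K)"

definition VC :: "('a::euclidean_space set \<Rightarrow> 'a set) \<Rightarrow> bool" where
  "VC Z \<longleftrightarrow> (\<exists>c C. c > 0 \<and> C > 0 \<and> (\<forall>K. convex_body K \<longrightarrow>
      c * vol K \<le> vol (Z K) \<and> vol (Z K) \<le> C * vol K))"

definition vec_valuation :: "('a::euclidean_space set \<Rightarrow> 'a) \<Rightarrow> bool" where
  "vec_valuation p \<longleftrightarrow> (\<forall>K L. convex_body K \<and> convex_body L \<and> convex_body (K \<union> L) \<longrightarrow>
      p K + p L = p (K \<union> L) + p (K \<inter> L))"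

definition vec_continuous :: "('a::euclidean_space set \<Rightarrow> 'a) \<Rightarrow> bool" where
  "vec_continuous p \<longleftrightarrow> (\<forall>K e. convex_body K \<and> e > 0 \<longrightarrow> (\<exists>d>0. \<forall>K'. convex_body K' \<and>
      hausdist K K' < d \<longrightarrow> dist (p K) (p K') < e))"

definition vec_trans_inv :: "('a::euclidean_space set \<Rightarrow> 'a) \<Rightarrow> bool" where
  "vec_trans_inv p \<longleftrightarrow> (\<forall>K t. convex_body K \<longrightarrow> p (translate K t) = p K)"

definition vec_homogeneous :: "nat \<Rightarrow> ('a::euclidean_space set \<Rightarrow> 'a) \<Rightarrow> bool" where
  "vec_homogeneous j p \<longleftrightarrow> (\<forall>K (r::real). convex_body K \<and> r > 0 \<longrightarrow>
      p ((\<lambda>x. r *\<^sub>R x) ` K) = r ^ j *\<^sub>R p K)"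

end

theory Submission
  imports Defs
begin

text \<open>
  For fixed \<open>u\<close> the support function \<open>h u K\<close> of \<open>\<Phi> K\<close> is a real-valued continuous translation invariant
  valuation, so it decomposes into homogeneous parts. Polynomiality of \<open>m \<mapsto> f (m P)\<close> for a polytope \<open>P\<close> comes
  from viewing \<open>m P\<close> as the image of a dilated simplex and applying inclusion-exclusion to the translates of
  \<open>(m - 1) P\<close> by the vertices of \<open>P\<close>; that the degree is at most \<open>n\<close> and that the part of degree \<open>n\<close> is
  a multiple of volume both follow from dissecting \<open>m K\<close> into unit cubes.

  Instead of a classification of the parts of intermediate degree, positivity is used: a nonnegative
  valuation that vanishes on parallelepipeds vanishes. It is applied to
  \<open>om u v = h u + h v - h (u + v)\<close>, which is nonnegative because support functions are subadditive.
  On parallelepipeds \<open>\<Phi>\<close> is Minkowski affine in each edge, and the volume bounds force the increments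
  to be points in dimensions below \<open>n\<close> and segments with a common direction in dimension \<open>n\<close>.
  Hence \<open>om u v\<close> is constant for \<open>u\<close>, \<open>v\<close> orthogonal to that direction, which gives an upper bound
  \<open>L + p(K) + V(K) S\<close> for \<open>\<Phi> K\<close>, and the difference of the two support functions is again a nonnegative
  valuation that vanishes on parallelepipeds.
\<close>

text \<open>Polynomiality yields the parts of degree 1 to n-1 without describing them, and only for
  one direction \<open>u\<close> at a time; this is the obstacle. Positivity replaces a description
  because a nonnegative valuation can be localized: if it vanishes on a body and in all lower
  dimensions, it vanishes on every polytope cut out of that body. On parallelepipeds it makes the
  value nondecreasing in each edge and the rate of growth nondecreasing in the other edges, so that
  dimension n controls all lower dimensions. The assumption on dim \<Phi>({0}) enters through a
  normal \<open>w\<close> of the hyperplane carrying \<Phi>({0}): this body is a Minkowski summand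
  of every value on a parallelepiped, so extent in direction \<open>w\<close> creates volume. The
  constant \<open>\<tau>\<close> is the ratio of the width of \<Phi>(K) in direction
  \<open>w\<close> to the volume of K. The segment S is the body whose support function is the
  coefficient of m^n in the support function of \<Phi>(m K). Since support functions are not linear
  in \<open>u\<close>, p is read off from \<open>q\<close>, which uses an oblique splitting of
  \<open>u\<close> into a vector orthogonal to S and a multiple of \<open>w\<close>.\<close>

lemma convex_body_msum:
  assumes "convex_body A" "convex_body B"
  shows "convex_body (msum A B)"
proof -
  have "compact (msum A B)" unfolding msum_def using assms by (intro compact_sums) (auto simp: convex_body_def)
  moreover have "msum A B = (\<Union>x\<in>A. \<Union>y\<in>B. {x + y})" unfolding msum_def by blast
  then have "convex (msum A B)" using convex_sums[of A B] assms by (simp add: convex_body_def)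
  moreover have "msum A B \<noteq> {}" using assms unfolding msum_def convex_body_def by blast
  ultimately show ?thesis by (simp add: convex_body_def)
qed

lemma convex_body_translate: "convex_body K \<Longrightarrow> convex_body (translate K t)"
  unfolding convex_body_def translate_def
  using compact_translation[of K t] convex_translation[of K t] by (auto simp: add.commute)

lemma convex_body_scale: "convex_body K \<Longrightarrow> convex_body ((*\<^sub>R) r ` K)"
  unfolding convex_body_def using compact_scaling[of K r] convex_scaling[of K r] by auto

lemma convex_body_singleton [simp]: "convex_body {x}"
  by (simp add: convex_body_def)

lemma convex_body_segment [simp]: "convex_body (closed_segment a b)"
  by (simp add: convex_body_def)

lemma convex_body_hull: "finite V \<Longrightarrow> V \<noteq> {} \<Longrightarrow> convex_body (convex hull V)"
  by (simp add: convex_body_def finite_imp_compact_convex_hull)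

lemma convex_body_Int: "convex_body K \<Longrightarrow> closed C \<Longrightarrow> convex C \<Longrightarrow> K \<inter> C \<noteq> {} \<Longrightarrow> convex_body (K \<inter> C)"
  by (simp add: convex_body_def convex_Int compact_Int_closed)

lemma convex_body_lmeasurable: "convex_body K \<Longrightarrow> K \<in> lmeasurable"
  by (simp add: convex_body_def compact_imp_bounded measurable_convex)

text \<open>A convex union is connected, so two nonempty closed sets covering it must meet. This
  makes the intersection term of a valuation identity a convex body.\<close>

lemma convex_body_Int_of_Un:
  assumes "convex_body K" "convex_body L" "convex_body (K \<union> L)"
  shows "convex_body (K \<inter> L)"
proof -
  have c: "closed K" "closed L" "K \<noteq> {}" "L \<noteq> {}" "connected (K \<union> L)"
    using assms by (auto simp: convex_body_def compact_imp_closed convex_connected)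
  have "K \<inter> L \<noteq> {}"
    using c unfolding connected_closed_set[OF closed_Un[OF c(1,2)]] by blast
  then show ?thesis
    using assms c by (intro convex_body_Int) (auto simp: convex_body_def)
qed

lemma msum_commute: "msum A B = msum B A"
  unfolding msum_def by (metis add.commute)

lemma msum_assoc: "msum (msum A B) C = msum A (msum B C)"
proof -
  have "x \<in> msum A (msum B C)" if "x \<in> msum (msum A B) C" for x
  proof -
    from that obtain a b c where "x = (a + b) + c" "a \<in> A" "b \<in> B" "c \<in> C"
      unfolding msum_def by blast
    moreover have "(a + b) + c = a + (b + c)" by (simp add: add.assoc)
    ultimately show ?thesis unfolding msum_def by blast
  qed
  moreover have "x \<in> msum (msum A B) C" if "x \<in> msum A (msum B C)" for x
  proof -
    from that obtain a b c where "x = a + (b + c)" "a \<in> A" "b \<in> B" "c \<in> C"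
      unfolding msum_def by blast
    moreover have "a + (b + c) = (a + b) + c" by (simp add: add.assoc)
    ultimately show ?thesis unfolding msum_def by blast
  qed
  ultimately show ?thesis by blast
qed

lemma msum_singleton: "msum A {t} = translate A t"
  unfolding msum_def translate_def by auto

lemma scale_msum: "(*\<^sub>R) r ` msum A B = msum ((*\<^sub>R) r ` A) ((*\<^sub>R) r ` B)"
proof -
  have "r *\<^sub>R (x + y) \<in> msum ((*\<^sub>R) r ` A) ((*\<^sub>R) r ` B)" if "x \<in> A" "y \<in> B" for x y
    using that unfolding msum_def by (auto simp: scaleR_add_right)
  moreover have "r *\<^sub>R x + r *\<^sub>R y \<in> (*\<^sub>R) r ` msum A B" if "x \<in> A" "y \<in> B" for x y
    using that unfolding msum_def by (force simp: scaleR_add_right)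
  ultimately show ?thesis unfolding msum_def by blast
qed

subsection \<open>Support functions\<close>

definition supp :: "'a::euclidean_space set \<Rightarrow> 'a \<Rightarrow> real" where
  "supp K u = (SUP x\<in>K. x \<bullet> u)"

lemma supp_attained:
  assumes "convex_body K"
  obtains x where "x \<in> K" "x \<bullet> u = supp K u" "\<And>y. y \<in> K \<Longrightarrow> y \<bullet> u \<le> supp K u"
proof -
  have "compact K" "K \<noteq> {}" "continuous_on K (\<lambda>x. x \<bullet> u)"
    using assms by (auto simp: convex_body_def intro!: continuous_intros)
  then obtain x where x: "x \<in> K" "\<And>y. y \<in> K \<Longrightarrow> y \<bullet> u \<le> x \<bullet> u"
    using continuous_attains_sup[of K "\<lambda>x. x \<bullet> u"] by auto
  have "supp K u = x \<bullet> u"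
    unfolding supp_def by (rule cSup_eq_maximum) (use x in auto)
  then show ?thesis using x that by metis
qed

lemma supp_ge: "convex_body K \<Longrightarrow> x \<in> K \<Longrightarrow> x \<bullet> u \<le> supp K u"
  using supp_attained by metis

lemma supp_eqI: "convex_body K \<Longrightarrow> x \<in> K \<Longrightarrow> (\<And>y. y \<in> K \<Longrightarrow> y \<bullet> u \<le> x \<bullet> u) \<Longrightarrow> supp K u = x \<bullet> u"
  by (metis supp_attained antisym)

lemma supp_msum:
  assumes "convex_body A" "convex_body B"
  shows "supp (msum A B) u = supp A u + supp B u"
proof -
  obtain a where a: "a \<in> A" "a \<bullet> u = supp A u" using supp_attained[OF assms(1)] by metis
  obtain b where b: "b \<in> B" "b \<bullet> u = supp B u" using supp_attained[OF assms(2)] by metis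
  have "supp (msum A B) u = (a + b) \<bullet> u"
  proof (rule supp_eqI[OF convex_body_msum[OF assms]])
    show "a + b \<in> msum A B" using a b by (auto simp: msum_def)
    fix y assume "y \<in> msum A B"
    then obtain p q where "y = p + q" "p \<in> A" "q \<in> B" by (auto simp: msum_def)
    then show "y \<bullet> u \<le> (a + b) \<bullet> u"
      using supp_ge[OF assms(1), of p u] supp_ge[OF assms(2), of q u] a b by (simp add: inner_add_left)
  qed
  then show ?thesis using a b by (simp add: inner_add_left)
qed

lemma supp_singleton [simp]: "supp {x} u = x \<bullet> u"
  by (simp add: supp_def)

lemma supp_translate: "convex_body A \<Longrightarrow> supp (translate A t) u = supp A u + t \<bullet> u"
  by (metis msum_singleton supp_msum convex_body_singleton supp_singleton)

lemma supp_segment: "supp (closed_segment a b) u = max (a \<bullet> u) (b \<bullet> u)"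
proof -
  have *: "y \<bullet> u \<le> max (a \<bullet> u) (b \<bullet> u)" if "y \<in> closed_segment a b" for y
  proof -
    obtain t where t: "0 \<le> t" "t \<le> 1" "y = (1 - t) *\<^sub>R a + t *\<^sub>R b"
      using \<open>y \<in> closed_segment a b\<close> by (auto simp: in_segment)
    have "y \<bullet> u = (1 - t) * (a \<bullet> u) + t * (b \<bullet> u)" using t by (simp add: inner_add_left)
    also have "\<dots> \<le> max (a \<bullet> u) (b \<bullet> u)"
      using t by (intro convex_bound_le) auto
    finally show ?thesis .
  qed
  have "supp (closed_segment a b) u = (if a \<bullet> u \<le> b \<bullet> u then b else a) \<bullet> u"
  proof (rule supp_eqI)
    fix y assume y: "y \<in> closed_segment a b"
    show "y \<bullet> u \<le> (if a \<bullet> u \<le> b \<bullet> u then b else a) \<bullet> u"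
      using *[OF y] by (auto simp: max_def split: if_splits)
  qed auto
  then show ?thesis by auto
qed

lemma supp_scale_body:
  assumes "convex_body K" "r \<ge> 0"
  shows "supp ((*\<^sub>R) r ` K) u = r * supp K u"
proof -
  obtain x where x: "x \<in> K" "x \<bullet> u = supp K u" using supp_attained[OF assms(1)] by metis
  have "supp ((*\<^sub>R) r ` K) u = (r *\<^sub>R x) \<bullet> u"
    by (rule supp_eqI[OF convex_body_scale[OF assms(1)]])
      (use x supp_ge[OF assms(1)] assms(2) in \<open>auto intro!: mult_left_mono\<close>)
  then show ?thesis using x by simp
qed

lemma supp_scale_arg:
  assumes "convex_body K" "r \<ge> 0"
  shows "supp K (r *\<^sub>R u) = r * supp K u"
proof -
  obtain x where x: "x \<in> K" "x \<bullet> u = supp K u" using supp_attained[OF assms(1)] by metis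
  have "supp K (r *\<^sub>R u) = x \<bullet> (r *\<^sub>R u)"
    by (rule supp_eqI[OF assms(1)])
      (use x supp_ge[OF assms(1)] assms(2) in \<open>auto intro!: mult_left_mono\<close>)
  then show ?thesis using x by simp
qed

lemma supp_0_arg: "convex_body K \<Longrightarrow> supp K 0 = 0"
  using supp_scale_arg[of K 0 0] by simp

lemma supp_subadd:
  assumes "convex_body K"
  shows "supp K (u + v) \<le> supp K u + supp K v"
  by (metis supp_attained[OF assms] add_mono inner_add_right)

lemma body_subset_iff_supp:
  assumes A: "convex_body A" and B: "convex_body B" and le: "\<And>u. supp A u \<le> supp B u"
  shows "A \<subseteq> B"
proof
  fix x assume x: "x \<in> A"
  show "x \<in> B"
  proof (rule ccontr)
    assume "x \<notin> B"
    then obtain a b where ab: "a \<bullet> x < b" "\<And>y. y \<in> B \<Longrightarrow> a \<bullet> y > b"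
      using separating_hyperplane_closed_point[of B x] B
      by (auto simp: convex_body_def compact_imp_closed)
    obtain y where y: "y \<in> B" "y \<bullet> (-a) = supp B (-a)" using supp_attained[OF B] by metis
    have "x \<bullet> (-a) \<le> supp B (-a)" using le supp_ge[OF A x] order_trans by metis
    then show False using ab(1) ab(2)[OF y(1)] y(2) by (simp add: inner_commute)
  qed
qed

lemma body_eq_supp: "convex_body A \<Longrightarrow> convex_body B \<Longrightarrow> (\<And>u. supp A u = supp B u) \<Longrightarrow> A = B"
  by (metis body_subset_iff_supp antisym order_refl)

text \<open>Separate \<^term>\<open>(u0, g u0)\<close> from the open epigraph of \<open>g\<close>.\<close>
lemma sublinear_support:
  fixes g :: "'a::euclidean_space \<Rightarrow> real"
  assumes sub: "\<And>u v. g (u + v) \<le> g u + g v" and hom: "\<And>r u. r \<ge> 0 \<Longrightarrow> g (r *\<^sub>R u) = r * g u"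
  obtains x where "x \<bullet> u0 = g u0" "\<And>u. x \<bullet> u \<le> g u"
proof -
  let ?C = "{(u, r). g u < r}"
  have g0: "g 0 = 0" using hom[of 0 0] by simp
  have cv: "convex ?C"
  proof (rule convexI)
    fix x y and \<mu> \<nu> :: real
    assume xy: "x \<in> ?C" "y \<in> ?C" and mn: "0 \<le> \<mu>" "0 \<le> \<nu>" "\<mu> + \<nu> = 1"
    obtain a r b s where x: "x = (a, r)" and y: "y = (b, s)" by fastforce
    have 1: "g a < r" "g b < s" "0 \<le> \<mu>" "0 \<le> \<nu>" "\<mu> + \<nu> = 1" using xy mn x y by auto
    have "g (\<mu> *\<^sub>R a + \<nu> *\<^sub>R b) \<le> \<mu> * g a + \<nu> * g b" using sub[of "\<mu> *\<^sub>R a" "\<nu> *\<^sub>R b"] hom 1 by simp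
    also have "\<dots> < \<mu> * r + \<nu> * s"
    proof (cases "\<mu> = 0")
      case True then show ?thesis using 1 by simp
    next
      case False then have "\<mu> * g a < \<mu> * r" using 1 by simp
      moreover have "\<nu> * g b \<le> \<nu> * s" using 1 by (simp add: mult_left_mono)
      ultimately show ?thesis by simp
    qed
    finally show "\<mu> *\<^sub>R x + \<nu> *\<^sub>R y \<in> ?C" by (simp add: x y)
  qed
  have "(0, 1) \<in> ?C" by (simp add: g0)
  then have "{(u0, g u0)} \<inter> ?C = {}" "?C \<noteq> {}" by auto
  then have "\<exists>p b. p \<noteq> 0 \<and> (\<forall>x\<in>{(u0, g u0)}. p \<bullet> x \<le> b) \<and> (\<forall>x\<in>?C. p \<bullet> x \<ge> b)"
    by (intro separating_hyperplane_sets[OF convex_singleton cv]) simp_all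
  then obtain p b where p: "p \<noteq> 0" "\<forall>x\<in>{(u0, g u0)}. p \<bullet> x \<le> b" "\<forall>x\<in>?C. p \<bullet> x \<ge> b"
    by (elim exE conjE)
  obtain a c where pa: "p = (a, c)" by (cases p)
  have le: "a \<bullet> u0 + c * g u0 \<le> a \<bullet> u + c * r" if "g u < r" for u r
    using bspec[OF p(2), of "(u0, g u0)"] bspec[OF p(3), of "(u, r)"] that by (simp add: pa)
  have c0: "c \<ge> 0"
  proof (rule ccontr)
    assume "\<not> c \<ge> 0"
    then have "c < 0" by simp
    have "c * (\<bar>g u0\<bar> + 1 - g u0) \<ge> 0" using le[of u0 "\<bar>g u0\<bar> + 1"] by (simp add: algebra_simps)
    then show False using \<open>c < 0\<close> by (simp add: zero_le_mult_iff)
  qed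
  \<comment> \<open>The separating hyperplane cannot be vertical: \<open>g\<close> is finite
    everywhere, so the base point can be moved in direction \<open>-a\<close>.\<close>
  have "c \<noteq> 0"
  proof
    assume "c = 0"
    have "a \<bullet> u0 \<le> a \<bullet> (u0 - a)" using le[of "u0 - a" "g (u0 - a) + 1"] \<open>c = 0\<close> by simp
    then have "a \<bullet> a \<le> 0" by (simp add: inner_diff_right)
    then have "a = 0" by (metis antisym inner_eq_zero_iff inner_ge_zero)
    then show False using p(1) \<open>c = 0\<close> pa by (simp add: zero_prod_def)
  qed
  then have c: "c > 0" using c0 by simp
  define x where "x = (- 1 / c) *\<^sub>R a"
  have main: "g u0 - x \<bullet> u0 \<le> g u - x \<bullet> u" for u
  proof (rule field_le_epsilon)
    fix e :: real assume "e > 0"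
    have "a \<bullet> u0 + c * g u0 \<le> a \<bullet> u + c * (g u + e)" using le[of u "g u + e"] \<open>e > 0\<close> by simp
    then have "(a \<bullet> u0 + c * g u0) / c \<le> (a \<bullet> u + c * (g u + e)) / c" using c by (simp add: divide_right_mono)
    then show "g u0 - x \<bullet> u0 \<le> g u - x \<bullet> u + e" using c by (simp add: x_def add_divide_distrib)
  qed
  \<comment> \<open>Testing \<open>main\<close> with 0 and with twice \<open>u0\<close> gives both
    signs of g u0 - x \<bullet> u0.\<close>
  have 1: "g u0 - x \<bullet> u0 \<le> 0" using main[of 0] g0 by simp
  have "g u0 - x \<bullet> u0 \<le> 2 * (g u0 - x \<bullet> u0)" using main[of "2 *\<^sub>R u0"] hom[of 2 u0] by simp
  then have 2: "x \<bullet> u0 = g u0" using 1 by simp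
  have "x \<bullet> u \<le> g u" for u using main[of u] 2 by simp
  with 2 show ?thesis by (rule that)
qed

text \<open>Converse of \<open>supp_subadd\<close> and \<open>supp_scale_arg\<close>: intersect the
  halfspaces given by \<open>g\<close>; by \<open>sublinear_support\<close> each of them is touched.
  This turns increments of support functions, and later the leading coefficient \<open>s\<close>,
  back into bodies.\<close>

lemma sublinear_body:
  fixes g :: "'a::euclidean_space \<Rightarrow> real"
  assumes sub: "\<And>u v. g (u + v) \<le> g u + g v" and hom: "\<And>r u. r \<ge> 0 \<Longrightarrow> g (r *\<^sub>R u) = r * g u"
  obtains E where "convex_body E" "\<And>u. supp E u = g u"
proof -
  let ?E = "{x. \<forall>u. x \<bullet> u \<le> g u}"
  have E: "?E = (\<Inter>u. {x. u \<bullet> x \<le> g u})" by (auto simp: inner_commute)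
  have cl: "closed ?E" and cv: "convex ?E" unfolding E
    by (auto intro: closed_INT convex_INT closed_halfspace_le convex_halfspace_le)
  have ex: "\<exists>x\<in>?E. x \<bullet> u = g u" for u
  proof (rule sublinear_support[of g u, OF sub hom])
    fix x assume "x \<bullet> u = g u" "\<And>u. x \<bullet> u \<le> g u"
    then show "\<exists>x\<in>?E. x \<bullet> u = g u" by auto
  qed
  have "bounded ?E"
  proof (rule boundedI)
    fix x assume x: "x \<in> ?E"
    have "norm x \<le> (\<Sum>b\<in>Basis. \<bar>x \<bullet> b\<bar>)" by (rule norm_le_l1)
    also have "\<dots> \<le> (\<Sum>b\<in>Basis. \<bar>g b\<bar> + \<bar>g (-b)\<bar>)"
    proof (rule sum_mono)
      fix b :: 'a
      have "x \<bullet> b \<le> g b" "x \<bullet> (-b) \<le> g (-b)" using x by blast+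
      then show "\<bar>x \<bullet> b\<bar> \<le> \<bar>g b\<bar> + \<bar>g (-b)\<bar>" by simp
    qed
    finally show "norm x \<le> (\<Sum>b\<in>Basis. \<bar>g b\<bar> + \<bar>g (-b)\<bar>)" .
  qed
  then have body: "convex_body ?E"
    using cl cv ex[of 0] by (auto simp: convex_body_def compact_eq_bounded_closed)
  have "supp ?E u = g u" for u
  proof -
    obtain x where x: "x \<in> ?E" "x \<bullet> u = g u" using ex by blast
    have "supp ?E u = x \<bullet> u" by (rule supp_eqI[OF body x(1)]) (use x in auto)
    then show ?thesis using x by simp
  qed
  with body show ?thesis by (rule that)
qed

subsection \<open>Hausdorff distance\<close>

lemma hausdist_le:
  assumes "A \<noteq> {}" "B \<noteq> {}"
    "\<And>x. x \<in> A \<Longrightarrow> \<exists>y\<in>B. dist x y \<le> e" "\<And>y. y \<in> B \<Longrightarrow> \<exists>x\<in>A. dist x y \<le> e"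
  shows "hausdist A B \<le> e"
proof -
  have "infdist x B \<le> e" if "x \<in> A" for x using assms(3)[OF that] infdist_le2 by blast
  moreover have "infdist y A \<le> e" if "y \<in> B" for y
    using assms(4)[OF that] infdist_le2 by (metis dist_commute)
  ultimately show ?thesis unfolding hausdist_def using assms(1,2)
    by (auto intro!: cSUP_least)
qed

lemma hausdist_commute: "hausdist A B = hausdist B A"
  unfolding hausdist_def by (simp add: max.commute)

lemma infdist_le_hausdist:
  assumes "convex_body A" "convex_body B" "x \<in> A"
  shows "infdist x B \<le> hausdist A B"
proof -
  have "compact ((\<lambda>x. infdist x B) ` A)"
    using assms by (intro compact_continuous_image) (auto simp: convex_body_def intro!: continuous_intros)
  then have "bdd_above ((\<lambda>x. infdist x B) ` A)" by (simp add: bounded_imp_bdd_above compact_imp_bounded)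
  then have "infdist x B \<le> (SUP x\<in>A. infdist x B)" using assms(3) by (rule cSUP_upper[rotated])
  then show ?thesis unfolding hausdist_def by simp
qed

lemma hausdist_near:
  assumes "convex_body A" "convex_body B" "x \<in> A"
  obtains y where "y \<in> B" "dist x y \<le> hausdist A B"
proof -
  obtain y where "y \<in> B" "infdist x B = dist x y"
    using infdist_attains_inf[of B x] assms by (auto simp: convex_body_def compact_imp_closed)
  then show ?thesis using that infdist_le_hausdist[OF assms] by simp
qed

lemma hausdist_nonneg: "convex_body A \<Longrightarrow> convex_body B \<Longrightarrow> hausdist A B \<ge> 0"
  by (metis all_not_in_conv convex_body_def infdist_le_hausdist infdist_nonneg order_trans)

lemma supp_hausdist:
  assumes A: "convex_body A" and B: "convex_body B"
  shows "\<bar>supp A u - supp B u\<bar> \<le> norm u * hausdist A B"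
proof -
  have *: "supp A u - supp B u \<le> norm u * hausdist A B" if A: "convex_body A" and B: "convex_body B" for A B
  proof -
    obtain x where x: "x \<in> A" "x \<bullet> u = supp A u" using supp_attained[OF A] by metis
    obtain y where y: "y \<in> B" "dist x y \<le> hausdist A B" using hausdist_near[OF A B x(1)] by metis
    have "supp A u - supp B u \<le> (x - y) \<bullet> u" using x supp_ge[OF B y(1)] by (simp add: inner_diff_left)
    also have "\<dots> \<le> norm (x - y) * norm u" by (rule norm_cauchy_schwarz)
    also have "\<dots> \<le> norm u * hausdist A B" using y(2) by (simp add: dist_norm mult.commute mult_left_mono)
    finally show ?thesis .
  qed
  from *[OF A B] *[OF B A] show ?thesis by (simp add: hausdist_commute abs_le_iff)
qed

subsection \<open>Continuous translation invariant valuations\<close>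

definition real_val :: "('a::euclidean_space set \<Rightarrow> real) \<Rightarrow> bool" where
  "real_val f \<longleftrightarrow>
    (\<forall>K L. convex_body K \<and> convex_body L \<and> convex_body (K \<union> L) \<longrightarrow> f K + f L = f (K \<union> L) + f (K \<inter> L)) \<and>
    (\<forall>K e. convex_body K \<and> e > 0 \<longrightarrow> (\<exists>d>0. \<forall>K'. convex_body K' \<and> hausdist K K' < d \<longrightarrow> \<bar>f K - f K'\<bar> < e)) \<and>
    (\<forall>K t. convex_body K \<longrightarrow> f (translate K t) = f K)"

lemma real_valD:
  assumes "real_val f"
  shows "\<And>K L. convex_body K \<Longrightarrow> convex_body L \<Longrightarrow> convex_body (K \<union> L) \<Longrightarrow> f K + f L = f (K \<union> L) + f (K \<inter> L)"
    and "\<And>K t. convex_body K \<Longrightarrow> f (translate K t) = f K"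
  using assms unfolding real_val_def by blast+

lemma real_val_cont:
  assumes "real_val f" "convex_body K" "e > 0"
  obtains d where "d > 0" "\<And>K'. convex_body K' \<Longrightarrow> hausdist K K' < d \<Longrightarrow> \<bar>f K - f K'\<bar> < e"
proof -
  have "\<exists>d>0. \<forall>K'. convex_body K' \<and> hausdist K K' < d \<longrightarrow> \<bar>f K - f K'\<bar> < e"
    using assms unfolding real_val_def by simp
  then show ?thesis using that by blast
qed

lemma real_val_tendsto:
  assumes f: "real_val f" and K: "convex_body K" and X: "\<forall>\<^sub>F i in F. convex_body (X i)"
    and lim: "((\<lambda>i. hausdist K (X i)) \<longlongrightarrow> 0) F"
  shows "((\<lambda>i. f (X i)) \<longlongrightarrow> f K) F"
proof (rule tendstoI)
  fix e :: real assume "e > 0"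
  then obtain d where d: "d > 0" "\<And>K'. convex_body K' \<Longrightarrow> hausdist K K' < d \<Longrightarrow> \<bar>f K - f K'\<bar> < e"
    using real_val_cont[OF f K] by metis
  have "\<forall>\<^sub>F i in F. hausdist K (X i) < d" using lim d(1) by (rule order_tendstoD(2))
  with X show "\<forall>\<^sub>F i in F. dist (f (X i)) (f K) < e"
    by eventually_elim (use d(2) in \<open>simp add: dist_real_def abs_minus_commute[of _ "f K"]\<close>)
qed

lemma real_val_add:
  assumes f: "real_val f" and g: "real_val g"
  shows "real_val (\<lambda>K. f K + g K)"
  unfolding real_val_def
proof (intro conjI allI impI)
  fix K L :: "'a set" assume "convex_body K \<and> convex_body L \<and> convex_body (K \<union> L)"
  then show "f K + g K + (f L + g L) = f (K \<union> L) + g (K \<union> L) + (f (K \<inter> L) + g (K \<inter> L))"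
    using real_valD(1)[OF f, of K L] real_valD(1)[OF g, of K L] by simp
next
  fix K :: "'a set" and t assume "convex_body K"
  then show "f (translate K t) + g (translate K t) = f K + g K"
    using real_valD(2)[OF f] real_valD(2)[OF g] by simp
next
  fix K :: "'a set" and e :: real assume *: "convex_body K \<and> 0 < e"
  obtain d1 where d1: "d1 > 0" "\<And>K'. convex_body K' \<Longrightarrow> hausdist K K' < d1 \<Longrightarrow> \<bar>f K - f K'\<bar> < e/2"
    using real_val_cont[OF f, of K "e/2"] * by auto
  obtain d2 where d2: "d2 > 0" "\<And>K'. convex_body K' \<Longrightarrow> hausdist K K' < d2 \<Longrightarrow> \<bar>g K - g K'\<bar> < e/2"
    using real_val_cont[OF g, of K "e/2"] * by auto
  show "\<exists>d>0. \<forall>K'. convex_body K' \<and> hausdist K K' < d \<longrightarrow> \<bar>f K + g K - (f K' + g K')\<bar> < e"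
  proof (intro exI[of _ "min d1 d2"] conjI allI impI)
    fix K' assume "convex_body K' \<and> hausdist K K' < min d1 d2"
    then have "\<bar>f K - f K'\<bar> < e/2" "\<bar>g K - g K'\<bar> < e/2" using d1 d2 by auto
    then show "\<bar>f K + g K - (f K' + g K')\<bar> < e" by linarith
  qed (use d1 d2 in auto)
qed

lemma real_val_cmult:
  assumes f: "real_val f"
  shows "real_val (\<lambda>K. c * f K)"
  unfolding real_val_def
proof (intro conjI allI impI)
  fix K L :: "'a set" assume "convex_body K \<and> convex_body L \<and> convex_body (K \<union> L)"
  then show "c * f K + c * f L = c * f (K \<union> L) + c * f (K \<inter> L)"
    using real_valD(1)[OF f, of K L] by (metis distrib_left)
next
  fix K :: "'a set" and t assume "convex_body K"
  then show "c * f (translate K t) = c * f K" using real_valD(2)[OF f] by simp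
next
  fix K :: "'a set" and e :: real assume *: "convex_body K \<and> 0 < e"
  obtain d where d: "d > 0" "\<And>K'. convex_body K' \<Longrightarrow> hausdist K K' < d \<Longrightarrow> \<bar>f K - f K'\<bar> < e/(\<bar>c\<bar> + 1)"
    using real_val_cont[OF f, of K "e/(\<bar>c\<bar> + 1)"] * by auto
  show "\<exists>d>0. \<forall>K'. convex_body K' \<and> hausdist K K' < d \<longrightarrow> \<bar>c * f K - c * f K'\<bar> < e"
  proof (intro exI[of _ d] conjI allI impI)
    fix K' assume "convex_body K' \<and> hausdist K K' < d"
    then have "\<bar>f K - f K'\<bar> < e/(\<bar>c\<bar> + 1)" using d by blast
    then have "(\<bar>c\<bar> + 1) * \<bar>f K - f K'\<bar> < e" by (simp add: pos_less_divide_eq mult.commute add_pos_nonneg)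
    moreover have "\<bar>c * f K - c * f K'\<bar> = \<bar>c\<bar> * \<bar>f K - f K'\<bar>" by (metis abs_mult right_diff_distrib)
    ultimately show "\<bar>c * f K - c * f K'\<bar> < e" by (simp add: distrib_right)
  qed (use d in auto)
qed

lemma real_val_const [simp]: "real_val (\<lambda>K. c)"
  unfolding real_val_def by (auto intro: exI[of _ 1])

lemma real_val_diff: "real_val f \<Longrightarrow> real_val g \<Longrightarrow> real_val (\<lambda>K. f K - g K)"
  using real_val_add[of f "\<lambda>K. (-1) * g K"] real_val_cmult[of g "-1"] by simp

lemma real_val_divide: "real_val f \<Longrightarrow> real_val (\<lambda>K. f K / c)"
  using real_val_cmult[of f "1 / c"] by simp

lemma real_val_sum: "(\<And>i. i \<in> I \<Longrightarrow> real_val (f i)) \<Longrightarrow> real_val (\<lambda>K. \<Sum>i\<in>I. f i K)"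
  by (induction I rule: infinite_finite_induct) (auto intro: real_val_add)

lemma dist_scale: "dist (r *\<^sub>R x) (r *\<^sub>R y) = \<bar>r\<bar> * dist x (y::'a::real_normed_vector)"
  by (metis dist_norm norm_scaleR scaleR_diff_right)

lemma hausdist_scale_same:
  assumes K: "convex_body K" and K': "convex_body K'" and "r > 0"
  shows "hausdist ((*\<^sub>R) r ` K) ((*\<^sub>R) r ` K') \<le> r * hausdist K K'"
proof (rule hausdist_le)
  show "(*\<^sub>R) r ` K \<noteq> {}" "(*\<^sub>R) r ` K' \<noteq> {}" using K K' by (auto simp: convex_body_def)
next
  fix x assume "x \<in> (*\<^sub>R) r ` K"
  then obtain a where a: "a \<in> K" "x = r *\<^sub>R a" by auto
  obtain b where "b \<in> K'" "dist a b \<le> hausdist K K'" using hausdist_near[OF K K' a(1)] by metis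
  then show "\<exists>y\<in>(*\<^sub>R) r ` K'. dist x y \<le> r * hausdist K K'"
    using a \<open>r > 0\<close> by (intro bexI[of _ "r *\<^sub>R b"]) (auto simp: dist_scale)
next
  fix x assume "x \<in> (*\<^sub>R) r ` K'"
  then obtain a where a: "a \<in> K'" "x = r *\<^sub>R a" by auto
  obtain b where "b \<in> K" "dist a b \<le> hausdist K' K" using hausdist_near[OF K' K a(1)] by metis
  then show "\<exists>y\<in>(*\<^sub>R) r ` K. dist y x \<le> r * hausdist K K'"
    using a \<open>r > 0\<close> by (intro bexI[of _ "r *\<^sub>R b"]) (auto simp: dist_scale dist_commute[of b] hausdist_commute[of K])
qed

lemma translate_scale: "(*\<^sub>R) r ` translate K t = translate ((*\<^sub>R) r ` K) (r *\<^sub>R t)"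
  unfolding translate_def by (auto simp: image_image scaleR_add_right)

text \<open>Used twice: for the doubling step that separates homogeneous parts, and to adapt the
  mesh of the cube dissection.\<close>

lemma real_val_scale:
  fixes f :: "'a::euclidean_space set \<Rightarrow> real"
  assumes f: "real_val f" and r: "r > 0"
  shows "real_val (\<lambda>K. f ((*\<^sub>R) r ` K))"
  unfolding real_val_def
proof (intro conjI allI impI)
  fix K L :: "'a set" assume *: "convex_body K \<and> convex_body L \<and> convex_body (K \<union> L)"
  have "inj ((*\<^sub>R) r :: 'a \<Rightarrow> 'a)" using r by (simp add: inj_on_def)
  moreover have "f ((*\<^sub>R) r ` K) + f ((*\<^sub>R) r ` L)
      = f ((*\<^sub>R) r ` K \<union> (*\<^sub>R) r ` L) + f ((*\<^sub>R) r ` K \<inter> (*\<^sub>R) r ` L)"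
    using * by (intro real_valD(1)[OF f]) (auto simp: convex_body_scale image_Un[symmetric])
  ultimately show "f ((*\<^sub>R) r ` K) + f ((*\<^sub>R) r ` L) = f ((*\<^sub>R) r ` (K \<union> L)) + f ((*\<^sub>R) r ` (K \<inter> L))"
    by (simp add: image_Un image_Int)
next
  fix K :: "'a set" and t assume "convex_body K"
  then show "f ((*\<^sub>R) r ` translate K t) = f ((*\<^sub>R) r ` K)"
    using real_valD(2)[OF f] by (simp add: translate_scale convex_body_scale)
next
  fix K :: "'a set" and e :: real assume *: "convex_body K \<and> 0 < e"
  obtain d where d: "d > 0" "\<And>K'. convex_body K' \<Longrightarrow> hausdist ((*\<^sub>R) r ` K) K' < d \<Longrightarrow> \<bar>f ((*\<^sub>R) r ` K) - f K'\<bar> < e"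
    using real_val_cont[OF f, of "(*\<^sub>R) r ` K" e] * convex_body_scale by auto
  show "\<exists>d>0. \<forall>K'. convex_body K' \<and> hausdist K K' < d \<longrightarrow> \<bar>f ((*\<^sub>R) r ` K) - f ((*\<^sub>R) r ` K')\<bar> < e"
  proof (intro exI[of _ "d/r"] conjI allI impI)
    fix K' assume K': "convex_body K' \<and> hausdist K K' < d/r"
    then have "r * hausdist K K' < d" using r by (simp add: pos_less_divide_eq mult.commute)
    then have "hausdist ((*\<^sub>R) r ` K) ((*\<^sub>R) r ` K') < d"
      using hausdist_scale_same[of K K' r] K' * r by linarith
    then show "\<bar>f ((*\<^sub>R) r ` K) - f ((*\<^sub>R) r ` K')\<bar> < e" using d(2)[OF convex_body_scale[of K' r]] K' by simp
  qed (use d r in auto)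
qed

lemma convex_body_norm_bound:
  assumes "convex_body K"
  obtains R where "R > 0" "\<And>x. x \<in> K \<Longrightarrow> norm x \<le> R"
proof -
  have "bounded K" using assms by (simp add: convex_body_def compact_imp_bounded)
  then show ?thesis using that by (metis bounded_pos)
qed

lemma hausdist_scale_tendsto:
  assumes K: "convex_body K"
  shows "((\<lambda>r. hausdist ((*\<^sub>R) r0 ` K) ((*\<^sub>R) r ` K)) \<longlongrightarrow> 0) (at r0 within T)"
proof -
  obtain R where R: "R > 0" "\<And>x. x \<in> K \<Longrightarrow> norm x \<le> R" using convex_body_norm_bound[OF K] by blast
  have le: "hausdist ((*\<^sub>R) r0 ` K) ((*\<^sub>R) r ` K) \<le> \<bar>r - r0\<bar> * R" for r
  proof (rule hausdist_le)
    show "(*\<^sub>R) r0 ` K \<noteq> {}" "(*\<^sub>R) r ` K \<noteq> {}" using K by (auto simp: convex_body_def)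
    have *: "dist (r0 *\<^sub>R x) (r *\<^sub>R x) \<le> \<bar>r - r0\<bar> * R" if "x \<in> K" for x
    proof -
      show ?thesis using R(2)[OF that] by (simp add: dist_scaleR abs_minus_commute mult_left_mono)
    qed
    show "\<exists>y\<in>(*\<^sub>R) r ` K. dist x y \<le> \<bar>r - r0\<bar> * R" if "x \<in> (*\<^sub>R) r0 ` K" for x using * that by blast
    show "\<exists>x\<in>(*\<^sub>R) r0 ` K. dist x y \<le> \<bar>r - r0\<bar> * R" if "y \<in> (*\<^sub>R) r ` K" for y using * that by blast
  qed
  show ?thesis
  proof (rule tendsto_sandwich[OF _ _ tendsto_const])
    show "\<forall>\<^sub>F r in at r0 within T. 0 \<le> hausdist ((*\<^sub>R) r0 ` K) ((*\<^sub>R) r ` K)"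
      using hausdist_nonneg convex_body_scale K by (intro always_eventually) blast
    show "\<forall>\<^sub>F r in at r0 within T. hausdist ((*\<^sub>R) r0 ` K) ((*\<^sub>R) r ` K) \<le> \<bar>r - r0\<bar> * R"
      using le by simp
    show "((\<lambda>r. \<bar>r - r0\<bar> * R) \<longlongrightarrow> 0) (at r0 within T)"
      by (auto intro!: tendsto_eq_intros)
  qed
qed

lemma real_val_scale_tendsto:
  assumes "real_val f" "convex_body K"
  shows "((\<lambda>r. f ((*\<^sub>R) r ` K)) \<longlongrightarrow> f ((*\<^sub>R) r0 ` K)) (at r0 within T)"
  using assms by (intro real_val_tendsto hausdist_scale_tendsto) (auto simp: convex_body_scale)

lemma hull_dense:
  assumes K: "convex_body K" and "e > 0"
  obtains V where "finite V" "V \<noteq> {}" "V \<subseteq> K" "hausdist K (convex hull V) \<le> e"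
proof -
  have "compact K" "K \<noteq> {}" "convex K" using K by (auto simp: convex_body_def)
  have *: "K \<subseteq> (\<Union>x\<in>K. ball x e)" using \<open>e > 0\<close> by auto
  obtain V where V: "V \<subseteq> K" "finite V" "K \<subseteq> (\<Union>x\<in>V. ball x e)"
    using compactE_image[OF \<open>compact K\<close> open_ball *] by metis
  have ne: "V \<noteq> {}" using V \<open>K \<noteq> {}\<close> by auto
  have sub: "convex hull V \<subseteq> K" using V(1) \<open>convex K\<close> by (simp add: hull_minimal)
  have "hausdist K (convex hull V) \<le> e"
  proof (rule hausdist_le)
    fix x assume "x \<in> K"
    then obtain v where "v \<in> V" "dist v x < e" using V(3) by auto
    then show "\<exists>y\<in>convex hull V. dist x y \<le> e"
      by (intro bexI[of _ v]) (auto simp: dist_commute hull_inc)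
  next
    fix y assume "y \<in> convex hull V"
    then show "\<exists>x\<in>K. dist x y \<le> e" using sub \<open>e > 0\<close> by (intro bexI[of _ y]) auto
  qed (use \<open>K \<noteq> {}\<close> ne in auto)
  from V(2) ne V(1) this show ?thesis by (rule that)
qed

lemma hull_sequence:
  assumes K: "convex_body K"
  obtains V where "\<And>i. finite (V i)" "\<And>i. V i \<noteq> {}" "\<And>i. V i \<subseteq> K"
    "(\<lambda>i::nat. hausdist K (convex hull V i)) \<longlonglongrightarrow> 0"
proof -
  have "\<forall>i::nat. \<exists>V. finite V \<and> V \<noteq> {} \<and> V \<subseteq> K \<and> hausdist K (convex hull V) \<le> 1 / real (Suc i)"
  proof
    fix i :: nat
    have "1 / real (Suc i) > 0" by simp
    from hull_dense[OF K this]
    show "\<exists>V. finite V \<and> V \<noteq> {} \<and> V \<subseteq> K \<and> hausdist K (convex hull V) \<le> 1 / real (Suc i)" by metis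
  qed
  then have "\<exists>V. \<forall>i::nat. finite (V i) \<and> V i \<noteq> {} \<and> V i \<subseteq> K \<and> hausdist K (convex hull (V i)) \<le> 1 / real (Suc i)"
    by (rule choice)
  then obtain V where V: "\<And>i::nat. finite (V i)" "\<And>i. V i \<noteq> {}" "\<And>i. V i \<subseteq> K"
    "\<And>i. hausdist K (convex hull (V i)) \<le> 1 / real (Suc i)" by blast
  have "(\<lambda>i. hausdist K (convex hull V i)) \<longlonglongrightarrow> 0"
  proof (rule tendsto_sandwich[OF _ _ tendsto_const])
    show "\<forall>\<^sub>F i in sequentially. 0 \<le> hausdist K (convex hull V i)"
      using V K by (auto intro!: always_eventually hausdist_nonneg convex_body_hull)
    show "\<forall>\<^sub>F i in sequentially. hausdist K (convex hull V i) \<le> 1 / real (Suc i)"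
      using V(4) by (auto intro!: always_eventually)
    show "(\<lambda>i. 1 / real (Suc i)) \<longlonglongrightarrow> 0"
      using LIMSEQ_Suc[OF lim_1_over_n] by simp
  qed
  from V(1-3) this show ?thesis by (rule that)
qed

subsection \<open>Polynomiality on polytopes\<close>

text \<open>Extension by 0 to the empty set, so that cutting identities also hold when a piece is
  empty.\<close>

definition ext0 :: "('a set \<Rightarrow> real) \<Rightarrow> 'a set \<Rightarrow> real" where
  "ext0 f K = (if K = {} then 0 else f K)"

lemma ext0_empty [simp]: "ext0 f {} = 0"
  by (simp add: ext0_def)

text \<open>Compact convex sets of coefficient functions. Compactness refers to the product
  topology, and convexity is spelled out pointwise.\<close>

definition cconv :: "('v \<Rightarrow> real) set \<Rightarrow> bool" where
  "cconv A \<longleftrightarrow> compact A \<and> (\<forall>\<alpha>\<in>A. \<forall>\<beta>\<in>A. \<forall>t\<in>{0..1}. (\<lambda>v. (1 - t) * \<alpha> v + t * \<beta> v) \<in> A)"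

definition vcomb :: "'a::euclidean_space set \<Rightarrow> ('a \<Rightarrow> real) \<Rightarrow> 'a" where
  "vcomb V \<alpha> = (\<Sum>v\<in>V. \<alpha> v *\<^sub>R v)"

lemma continuous_on_coord: "continuous_on A (\<lambda>\<alpha>::'v \<Rightarrow> real. \<alpha> i)"
  by (rule continuous_on_subset[OF continuous_on_product_coordinates]) simp

lemma cconv_le: 
  assumes A: "cconv A" shows "cconv (A \<inter> {\<alpha>. \<alpha> i \<le> 1})"
proof -
  have "closed {\<alpha>::'a \<Rightarrow> real. \<alpha> i \<le> 1}"
    by (intro closed_Collect_le continuous_on_coord continuous_on_const)
  then have "compact (A \<inter> {\<alpha>. \<alpha> i \<le> 1})" using A by (simp add: cconv_def compact_Int_closed)
  moreover have "(1 - t) * \<alpha> i + t * \<beta> i \<le> 1" if "\<alpha> i \<le> 1" "\<beta> i \<le> 1" "t \<in> {0..1}" for \<alpha> \<beta> :: "'a \<Rightarrow> real" and t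
    using that by (intro convex_bound_le) auto
  ultimately show ?thesis using A unfolding cconv_def by simp
qed

lemma cconv_ge: 
  assumes A: "cconv A" shows "cconv (A \<inter> {\<alpha>. 1 \<le> \<alpha> i})"
proof -
  have "closed {\<alpha>::'a \<Rightarrow> real. 1 \<le> \<alpha> i}"
    by (intro closed_Collect_le continuous_on_coord continuous_on_const)
  then have "compact (A \<inter> {\<alpha>. 1 \<le> \<alpha> i})" using A by (simp add: cconv_def compact_Int_closed)
  moreover have "1 \<le> (1 - t) * \<alpha> i + t * \<beta> i" if "1 \<le> \<alpha> i" "1 \<le> \<beta> i" "t \<in> {0..1}" for \<alpha> \<beta> :: "'a \<Rightarrow> real" and t
    using convex_bound_le[of "- \<alpha> i" "-1" "- \<beta> i" "1 - t" t] that by simp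
  ultimately show ?thesis using A unfolding cconv_def by simp
qed

lemma vcomb_convex_combination:
  "vcomb V (\<lambda>v. (1 - t) * \<alpha> v + t * \<beta> v) = (1 - t) *\<^sub>R vcomb V \<alpha> + t *\<^sub>R vcomb V \<beta>"
  by (simp add: vcomb_def scaleR_add_left sum.distrib scaleR_sum_right)

lemma vcomb_body:
  assumes A: "cconv A" and "A \<noteq> {}"
  shows "convex_body (vcomb V ` A)"
proof -
  have "compact (vcomb V ` A)"
    using A unfolding cconv_def vcomb_def
    by (intro compact_continuous_image continuous_on_sum continuous_on_scaleR continuous_on_coord continuous_on_const) auto
  moreover have "convex (vcomb V ` A)"
    unfolding convex_alt
  proof (intro ballI allI impI)
    fix x y t assume "x \<in> vcomb V ` A" "y \<in> vcomb V ` A" and t: "0 \<le> (t::real) \<and> t \<le> 1"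
    then obtain \<alpha> \<beta> where *: "\<alpha> \<in> A" "x = vcomb V \<alpha>" "\<beta> \<in> A" "y = vcomb V \<beta>" by blast
    then have "(\<lambda>v. (1 - t) * \<alpha> v + t * \<beta> v) \<in> A" using A t unfolding cconv_def by simp
    then show "(1 - t) *\<^sub>R x + t *\<^sub>R y \<in> vcomb V ` A"
      unfolding * vcomb_convex_combination[symmetric] by (rule imageI)
  qed
  ultimately show ?thesis using assms(2) by (simp add: convex_body_def)
qed

text \<open>A point with preimages on both sides of the cut also has a preimage on the cut.\<close>
lemma vcomb_split:
  fixes f :: "'a::euclidean_space set \<Rightarrow> real"
  assumes f: "real_val f" and A: "cconv A"
  shows "ext0 f (vcomb V ` A) = ext0 f (vcomb V ` (A \<inter> {\<alpha>. \<alpha> i \<le> 1})) + ext0 f (vcomb V ` (A \<inter> {\<alpha>. 1 \<le> \<alpha> i}))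
     - ext0 f (vcomb V ` (A \<inter> {\<alpha>. \<alpha> i \<le> 1} \<inter> {\<alpha>. 1 \<le> \<alpha> i}))"
proof -
  let ?A1 = "A \<inter> {\<alpha>. \<alpha> i \<le> 1}" and ?A2 = "A \<inter> {\<alpha>. 1 \<le> \<alpha> i}"
  have un: "A = ?A1 \<union> ?A2" by auto
  consider "?A1 = {}" | "?A2 = {}" | "?A1 \<noteq> {}" "?A2 \<noteq> {}" by blast
  then show ?thesis
  proof cases
    case 1
    then have "?A2 = A" "?A1 \<inter> {\<alpha>. 1 \<le> \<alpha> i} = {}" using un by auto
    then show ?thesis using 1 by simp
  next
    case 2
    then have "?A1 = A" "?A1 \<inter> {\<alpha>. 1 \<le> \<alpha> i} = {}" using un by auto
    then show ?thesis using 2 by simp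
  next
    case 3
    have int: "vcomb V ` ?A1 \<inter> vcomb V ` ?A2 = vcomb V ` (?A1 \<inter> {\<alpha>. 1 \<le> \<alpha> i})"
    proof (intro equalityI subsetI)
      fix y assume y: "y \<in> vcomb V ` ?A1 \<inter> vcomb V ` ?A2"
      from y obtain \<alpha> where a: "\<alpha> \<in> A" "\<alpha> i \<le> 1" "y = vcomb V \<alpha>" by blast
      from y obtain \<beta> where b: "\<beta> \<in> A" "1 \<le> \<beta> i" "y = vcomb V \<beta>" by blast
      have "\<exists>t\<in>{0..1}. (1 - t) * \<alpha> i + t * \<beta> i = 1"
      proof (cases "\<alpha> i = \<beta> i")
        case True
        then show ?thesis using a b by (intro bexI[of _ 0]) auto
      next
        case False
        then have pos: "\<beta> i - \<alpha> i > 0" using a b by simp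
        define s where "s = (1 - \<alpha> i) / (\<beta> i - \<alpha> i)"
        have "s * (\<beta> i - \<alpha> i) = 1 - \<alpha> i" using pos by (simp add: s_def)
        then have "(1 - s) * \<alpha> i + s * \<beta> i = 1" by (simp add: algebra_simps)
        moreover have "s \<in> {0..1}" using pos a b by (simp add: s_def)
        ultimately show ?thesis by blast
      qed
      then obtain t where t: "t \<in> {0..1}" "(1 - t) * \<alpha> i + t * \<beta> i = 1" by blast
      define \<gamma> where "\<gamma> = (\<lambda>v. (1 - t) * \<alpha> v + t * \<beta> v)"
      have "\<gamma> \<in> A" using A a(1) b(1) t(1) unfolding cconv_def \<gamma>_def by blast
      moreover have "\<gamma> i = 1" using t(2) by (simp add: \<gamma>_def)
      moreover have "vcomb V \<gamma> = y"
        unfolding \<gamma>_def vcomb_convex_combination a(3)[symmetric] b(3)[symmetric]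
        by (simp add: scaleR_left_diff_distrib)
      ultimately show "y \<in> vcomb V ` (?A1 \<inter> {\<alpha>. 1 \<le> \<alpha> i})" by (intro image_eqI[of _ _ \<gamma>]) auto
    qed blast
    have b: "convex_body (vcomb V ` ?A1)" "convex_body (vcomb V ` ?A2)"
      using 3 A by (auto intro!: vcomb_body cconv_le cconv_ge)
    have eq: "vcomb V ` ?A1 \<union> vcomb V ` ?A2 = vcomb V ` A" using un by blast
    have bA: "convex_body (vcomb V ` A)" using 3 A by (intro vcomb_body) auto
    have "f (vcomb V ` ?A1) + f (vcomb V ` ?A2) = f (vcomb V ` A) + f (vcomb V ` (?A1 \<inter> {\<alpha>. 1 \<le> \<alpha> i}))"
      using real_valD(1)[OF f b] bA by (simp add: eq int)
    moreover have "vcomb V ` (?A1 \<inter> {\<alpha>. 1 \<le> \<alpha> i}) \<noteq> {}"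
      using convex_body_Int_of_Un[OF b] bA eq int by (simp add: convex_body_def)
    moreover have "vcomb V ` ?A1 \<noteq> {}" "vcomb V ` ?A2 \<noteq> {}" "vcomb V ` A \<noteq> {}" using b bA by (auto simp: convex_body_def)
    ultimately show ?thesis by (simp add: ext0_def del: image_is_empty)
  qed
qed

text \<open>Inclusion-exclusion: the sum over all sublists J of the given indices of (-1)^(length J)
  times \<open>g\<close> of the part of \<open>A\<close> on which every coordinate in J is at least
  1.\<close>

fun altsum :: "(('v \<Rightarrow> real) set \<Rightarrow> real) \<Rightarrow> 'v list \<Rightarrow> ('v \<Rightarrow> real) set \<Rightarrow> real" where
  "altsum g [] A = g A"
| "altsum g (i # is) A = altsum g is A - altsum g is (A \<inter> {\<alpha>. 1 \<le> \<alpha> i})"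

lemma altsum_split:
  assumes g: "\<And>A i. cconv A \<Longrightarrow>
    g A = g (A \<inter> {\<alpha>. \<alpha> i \<le> 1}) + g (A \<inter> {\<alpha>. 1 \<le> \<alpha> i}) - g (A \<inter> {\<alpha>. \<alpha> i \<le> 1} \<inter> {\<alpha>. 1 \<le> \<alpha> i})"
  assumes A: "cconv A"
  shows "altsum g is A = altsum g is (A \<inter> {\<alpha>. \<alpha> i \<le> 1}) + altsum g is (A \<inter> {\<alpha>. 1 \<le> \<alpha> i})
     - altsum g is (A \<inter> {\<alpha>. \<alpha> i \<le> 1} \<inter> {\<alpha>. 1 \<le> \<alpha> i})"
  using A
proof (induction "is" arbitrary: A)
  case Nil
  then show ?case using g by simp
next
  case (Cons j "is")
  show ?case
    using Cons.IH[OF Cons.prems] Cons.IH[OF cconv_ge[OF Cons.prems, of j]] by (simp add: Int_ac)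
qed

text \<open>Every point of \<open>A\<close> has a listed coordinate above 1, so the sets with
  \<alpha> i at least 1 cover \<open>A\<close> and inclusion-exclusion gives 0. In the induction the
  part with \<alpha> j at least 1 cancels; the part with \<alpha> j at most 1 and the common face
  satisfy the hypothesis for the shorter list.\<close>

lemma altsum_zero:
  assumes g: "\<And>A i. cconv A \<Longrightarrow>
    g A = g (A \<inter> {\<alpha>. \<alpha> i \<le> 1}) + g (A \<inter> {\<alpha>. 1 \<le> \<alpha> i}) - g (A \<inter> {\<alpha>. \<alpha> i \<le> 1} \<inter> {\<alpha>. 1 \<le> \<alpha> i})"
  assumes g0: "g {} = 0"
  assumes "cconv A" "A \<inter> {\<alpha>. \<forall>i\<in>set is. \<alpha> i \<le> 1} = {}"
  shows "altsum g is A = 0"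
  using assms(3,4)
proof (induction "is" arbitrary: A)
  case Nil
  then show ?case using g0 by simp
next
  case (Cons j "is")
  have "altsum g is (A \<inter> {\<alpha>. \<alpha> j \<le> 1}) = 0" "altsum g is (A \<inter> {\<alpha>. \<alpha> j \<le> 1} \<inter> {\<alpha>. 1 \<le> \<alpha> j}) = 0"
    using Cons.prems by (auto intro!: Cons.IH cconv_le cconv_ge)
  then show ?case using altsum_split[of g A "is" j, OF g Cons.prems(1)] by simp
qed

text \<open>The \<open>m\<close>-fold dilate of the standard simplex on \<open>V\<close>.
  Coordinates outside \<open>V\<close> are pinned to 0 to keep it compact in the full function
  space.\<close>

definition simplex_coords :: "'v set \<Rightarrow> nat \<Rightarrow> ('v \<Rightarrow> real) set" where
  "simplex_coords V m = {\<alpha>. (\<forall>v\<in>V. 0 \<le> \<alpha> v) \<and> (\<forall>v. v \<notin> V \<longrightarrow> \<alpha> v = 0) \<and> sum \<alpha> V = real m}"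

lemma cconv_simplex_coords:
  assumes V: "finite V" shows "cconv (simplex_coords V m)"
proof -
  let ?B = "PiE UNIV (\<lambda>v. if v \<in> V then {0..real m} else {0})"
  have "compactin (product_topology (\<lambda>i. euclidean) UNIV) ?B"
    by (subst compactin_PiE) auto
  then have "compact ?B" by (simp add: euclidean_product_topology)
  moreover have "closed {\<alpha>. sum \<alpha> V = real m}"
    by (intro closed_Collect_eq continuous_on_sum continuous_on_coord continuous_on_const)
  moreover have "simplex_coords V m = ?B \<inter> {\<alpha>. sum \<alpha> V = real m}"
  proof (intro equalityI subsetI)
    fix \<alpha> assume a: "\<alpha> \<in> simplex_coords V m"
    have "\<alpha> v \<le> real m" if "v \<in> V" for v
      using member_le_sum[OF that, of \<alpha>] a V by (auto simp: simplex_coords_def)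
    then show "\<alpha> \<in> ?B \<inter> {\<alpha>. sum \<alpha> V = real m}" using a by (auto simp: simplex_coords_def PiE_def)
  next
    fix \<alpha> assume a: "\<alpha> \<in> ?B \<inter> {\<alpha>. sum \<alpha> V = real m}"
    have "\<alpha> v \<in> (if v \<in> V then {0..real m} else {0})" for v using a by (auto simp: PiE_def Pi_def)
    then show "\<alpha> \<in> simplex_coords V m" using a unfolding simplex_coords_def
      by (smt (verit) IntD2 atLeastAtMost_iff mem_Collect_eq singletonD)
  qed
  ultimately have "compact (simplex_coords V m)" by (simp add: compact_Int_closed)
  moreover have "(\<lambda>v. (1 - t) * \<alpha> v + t * \<beta> v) \<in> simplex_coords V m"
    if "\<alpha> \<in> simplex_coords V m" "\<beta> \<in> simplex_coords V m" "t \<in> {0..1}" for \<alpha> \<beta> t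
  proof -
    have "sum (\<lambda>v. (1 - t) * \<alpha> v + t * \<beta> v) V = (1 - t) * sum \<alpha> V + t * sum \<beta> V"
      by (simp add: sum.distrib sum_distrib_left)
    then show ?thesis using that by (auto simp: simplex_coords_def algebra_simps add_nonneg_nonneg)
      (auto simp: mult_left_le_one_le add_increasing2)
  qed
  ultimately show ?thesis unfolding cconv_def by blast
qed

text \<open>Lowering each coordinate in \<open>J\<close> by 1 turns the constrained simplex of size
  \<open>card J + r\<close> into the full simplex of size \<open>r\<close>; under
  \<open>vcomb\<close> this is a translation by the sum of \<open>J\<close>.\<close>

lemma vcomb_simplex_coords:
  assumes V: "finite V" and J: "J \<subseteq> V" and r: "r \<ge> 1"
  shows "vcomb V ` (simplex_coords V (card J + r) \<inter> {\<alpha>. \<forall>i\<in>J. 1 \<le> \<alpha> i})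
     = translate ((*\<^sub>R) (real r) ` (convex hull V)) (\<Sum>J)"
proof -
  define e :: "'a \<Rightarrow> real" where "e v = (if v \<in> J then 1 else 0)" for v
  have sJ: "vcomb V e = (\<Sum>J)" "sum e V = real (card J)"
    unfolding vcomb_def e_def using V J
    by (simp_all add: sum.If_cases Int_absorb1 if_distrib[of "\<lambda>c. c *\<^sub>R _"] cong: if_cong)
  have r0: "real r > 0" using r by simp
  show ?thesis
  proof (intro equalityI subsetI)
    fix y assume "y \<in> vcomb V ` (simplex_coords V (card J + r) \<inter> {\<alpha>. \<forall>i\<in>J. 1 \<le> \<alpha> i})"
    then obtain \<alpha> where a: "\<alpha> \<in> simplex_coords V (card J + r)" "\<forall>i\<in>J. 1 \<le> \<alpha> i" "y = vcomb V \<alpha>" by blast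
    define u where "u v = (\<alpha> v - e v) / real r" for v
    have "\<forall>v\<in>V. 0 \<le> u v" using a r0 by (auto simp: u_def e_def simplex_coords_def)
    moreover have "sum u V = 1"
    proof -
      have "sum u V = (sum \<alpha> V - sum e V) / real r"
        unfolding u_def by (simp add: sum_divide_distrib[symmetric] sum_subtractf)
      then show ?thesis using a(1) sJ r0 by (simp add: simplex_coords_def)
    qed
    ultimately have "vcomb V u \<in> convex hull V"
      unfolding convex_hull_finite[OF V] vcomb_def by blast
    moreover have "y = real r *\<^sub>R vcomb V u + (\<Sum>J)"
    proof -
      have "real r *\<^sub>R vcomb V u = vcomb V \<alpha> - vcomb V e"
        using r0 unfolding vcomb_def u_def
        by (simp add: scaleR_sum_right scaleR_left_diff_distrib sum_subtractf)
      then show ?thesis using a(3) sJ by simp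
    qed
    ultimately show "y \<in> translate ((*\<^sub>R) (real r) ` (convex hull V)) (\<Sum>J)"
      unfolding translate_def by blast
  next
    fix y assume "y \<in> translate ((*\<^sub>R) (real r) ` (convex hull V)) (\<Sum>J)"
    then obtain x where x: "x \<in> convex hull V" "y = real r *\<^sub>R x + (\<Sum>J)" unfolding translate_def by blast
    then obtain u where u: "\<forall>v\<in>V. 0 \<le> u v" "sum u V = 1" "x = vcomb V u"
      unfolding convex_hull_finite[OF V] vcomb_def by blast
    define \<alpha> where "\<alpha> v = (if v \<in> V then real r * u v + e v else 0)" for v
    have "sum \<alpha> V = (\<Sum>v\<in>V. real r * u v + e v)" by (rule sum.cong) (auto simp: \<alpha>_def)
    also have "\<dots> = real r * sum u V + sum e V" by (simp add: sum.distrib sum_distrib_left)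
    finally have s: "sum \<alpha> V = real (card J + r)" using u sJ by simp
    have "vcomb V \<alpha> = (\<Sum>v\<in>V. (real r * u v + e v) *\<^sub>R v)" unfolding vcomb_def by (rule sum.cong) (auto simp: \<alpha>_def)
    also have "\<dots> = y" using x(2) u(3) sJ(1) unfolding vcomb_def
      by (simp add: scaleR_add_left sum.distrib scaleR_sum_right)
    finally have "vcomb V \<alpha> = y" .
    moreover have "\<alpha> \<in> simplex_coords V (card J + r)" using s u(1) r0
      by (auto simp: simplex_coords_def \<alpha>_def e_def)
    moreover have "\<forall>i\<in>J. 1 \<le> \<alpha> i" using u(1) J r0 by (auto simp: \<alpha>_def e_def)
    ultimately show "y \<in> vcomb V ` (simplex_coords V (card J + r) \<inter> {\<alpha>. \<forall>i\<in>J. 1 \<le> \<alpha> i})" by blast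
  qed
qed

text \<open>Iterated forward difference. The recursion takes the difference last, which matches the
  recursion of \<open>altsum\<close>; \<open>fdiff_shift\<close> gives the form that takes it
  first.\<close>

fun fdiff :: "nat \<Rightarrow> (nat \<Rightarrow> real) \<Rightarrow> nat \<Rightarrow> real" where
  "fdiff 0 F r = F r"
| "fdiff (Suc k) F r = fdiff k F (Suc r) - fdiff k F r"

text \<open>By translation invariance a term depends only on how many constraints are imposed, so
  the alternating sum collapses to a finite difference of r -> f(r P). \<open>J\<close> collects the
  constraints already imposed, \<open>is\<close> those still to be processed.\<close>

lemma altsum_simplex_coords:
  fixes f :: "'a::euclidean_space set \<Rightarrow> real"
  assumes f: "real_val f" and V: "finite V" "V \<noteq> {}"
  assumes "distinct is" "set is \<inter> J = {}" "set is \<subseteq> V" "J \<subseteq> V" "r \<ge> 1" "m = card J + length is + r"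
  shows "altsum (\<lambda>A. ext0 f (vcomb V ` A)) is (simplex_coords V m \<inter> {\<alpha>. \<forall>i\<in>J. 1 \<le> \<alpha> i})
    = fdiff (length is) (\<lambda>r. f ((*\<^sub>R) (real r) ` (convex hull V))) r"
  using assms(4-)
proof (induction "is" arbitrary: J r)
  case Nil
  have "convex_body (convex hull V)" using V convex_body_hull by blast
  moreover from this have "translate ((*\<^sub>R) (real r) ` (convex hull V)) (\<Sum>J) \<noteq> {}"
    by (auto simp: translate_def convex_body_def)
  ultimately show ?case
    using Nil real_valD(2)[OF f, of "(*\<^sub>R) (real r) ` (convex hull V)" "\<Sum>J"]
    by (simp add: vcomb_simplex_coords[OF V(1)] ext0_def convex_body_scale del: image_is_empty)
next
  case (Cons i "is")
  have i: "i \<notin> J" "i \<in> V" "finite J" using Cons.prems V finite_subset by auto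
  have eq: "simplex_coords V m \<inter> {\<alpha>. \<forall>i\<in>J. 1 \<le> \<alpha> i} \<inter> {\<alpha>. 1 \<le> \<alpha> i}
     = simplex_coords V m \<inter> {\<alpha>. \<forall>i\<in>insert i J. 1 \<le> \<alpha> i}" by auto
  have "altsum (\<lambda>A. ext0 f (vcomb V ` A)) is (simplex_coords V m \<inter> {\<alpha>. \<forall>i\<in>J. 1 \<le> \<alpha> i})
     = fdiff (length is) (\<lambda>r. f ((*\<^sub>R) (real r) ` (convex hull V))) (Suc r)"
    using Cons.prems by (intro Cons.IH) auto
  moreover have "altsum (\<lambda>A. ext0 f (vcomb V ` A)) is (simplex_coords V m \<inter> {\<alpha>. \<forall>j\<in>insert i J. 1 \<le> \<alpha> j})
     = fdiff (length is) (\<lambda>r. f ((*\<^sub>R) (real r) ` (convex hull V))) r"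
    using Cons.prems i by (intro Cons.IH) auto
  ultimately show ?case by (simp only: altsum.simps eq) simp
qed

lemma polytope_fdiff:
  fixes f :: "'a::euclidean_space set \<Rightarrow> real"
  assumes f: "real_val f" and V: "finite V" "V \<noteq> {}" and r: "r \<ge> 1"
  shows "fdiff (card V) (\<lambda>r. f ((*\<^sub>R) (real r) ` (convex hull V))) r = 0"
proof -
  obtain xs where xs: "set xs = V" "distinct xs" using finite_distinct_list[OF V(1)] by blast
  have len: "length xs = card V" using xs distinct_card by fastforce
  \<comment> \<open>The size \<open>card V + r\<close> with r at least 1 exceeds
    \<open>card V\<close>, so the coordinates cannot all be at most 1 and \<open>altsum_zero\<close>
    applies.\<close>
  let ?g = "\<lambda>A. ext0 f (vcomb V ` A)" and ?X = "simplex_coords V (card V + r)"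
  have "altsum ?g xs ?X = 0"
  proof (rule altsum_zero)
    show "?X \<inter> {\<alpha>. \<forall>i\<in>set xs. \<alpha> i \<le> 1} = {}"
    proof (rule ccontr)
      assume "?X \<inter> {\<alpha>. \<forall>i\<in>set xs. \<alpha> i \<le> 1} \<noteq> {}"
      then obtain \<alpha> where a: "sum \<alpha> V = real (card V + r)" "\<forall>i\<in>V. \<alpha> i \<le> 1"
        using xs by (auto simp: simplex_coords_def)
      have "sum \<alpha> V \<le> real (card V) * 1" by (rule sum_bounded_above) (use a in auto)
      then show False using a r by simp
    qed
  qed (use cconv_simplex_coords[OF V(1)] vcomb_split[OF f] in auto)
  moreover have "altsum ?g xs (?X \<inter> {\<alpha>. \<forall>i\<in>{}. 1 \<le> \<alpha> i})
     = fdiff (length xs) (\<lambda>r. f ((*\<^sub>R) (real r) ` (convex hull V))) r"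
    by (rule altsum_simplex_coords[OF f V]) (use xs len r in auto)
  ultimately show ?thesis using len by simp
qed

section \<open>Polynomials from vanishing finite differences\<close>

lemma fdiff_shift: "fdiff (Suc k) F r = fdiff k (\<lambda>r. F (Suc r) - F r) r"
  by (induction k arbitrary: r) auto

text \<open>Telescoping s^(j+1) and expanding (s+1)^(j+1) expresses the sum of j-th powers through
  sums of lower powers.\<close>

lemma power_sum_poly: "\<exists>q. \<forall>r::nat. (\<Sum>s<r. real s ^ j) = poly q (real r)"
proof (induction j rule: less_induct)
  case (less j)
  then have "\<forall>i\<in>{..<j}. \<exists>q. \<forall>r::nat. (\<Sum>s<r. real s ^ i) = poly q (real r)" by blast
  then obtain q where q: "\<And>i r. i < j \<Longrightarrow> (\<Sum>s<r. real s ^ i) = poly (q i) (real r)"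
    using bchoice[of "{..<j}" "\<lambda>i q. \<forall>r::nat. (\<Sum>s<r. real s ^ i) = poly q (real r)"] by blast
  have *: "real (Suc j) * (\<Sum>s<r. real s ^ j) = real r ^ Suc j - (\<Sum>i<j. real (Suc j choose i) * poly (q i) (real r))" for r
  proof -
    have "real r ^ Suc j = (\<Sum>s<r. real (Suc s) ^ Suc j - real s ^ Suc j)"
      using sum_lessThan_telescope[of "\<lambda>s. real s ^ Suc j" r] by simp
    also have "\<dots> = (\<Sum>s<r. \<Sum>i\<le>j. real (Suc j choose i) * real s ^ i)"
    proof (rule sum.cong)
      fix s
      have "real (Suc s) ^ Suc j = (real s + 1) ^ Suc j" by (simp add: add.commute)
      also have "\<dots> = (\<Sum>i\<le>Suc j. real (Suc j choose i) * real s ^ i)"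
        by (subst binomial_ring) simp
      finally show "real (Suc s) ^ Suc j - real s ^ Suc j = (\<Sum>i\<le>j. real (Suc j choose i) * real s ^ i)"
        by simp
    qed simp
    also have "\<dots> = (\<Sum>i\<le>j. real (Suc j choose i) * (\<Sum>s<r. real s ^ i))"
      by (subst sum.swap) (simp add: sum_distrib_left)
    also have "\<dots> = (\<Sum>i<j. real (Suc j choose i) * (\<Sum>s<r. real s ^ i)) + real (Suc j) * (\<Sum>s<r. real s ^ j)"
      by (simp add: lessThan_Suc_atMost[symmetric] binomial_Suc_n)
    also have "(\<Sum>i<j. real (Suc j choose i) * (\<Sum>s<r. real s ^ i)) = (\<Sum>i<j. real (Suc j choose i) * poly (q i) (real r))"
      by (rule sum.cong) (use q in auto)
    finally show ?thesis by simp
  qed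
  let ?Q = "smult (1 / real (Suc j)) (monom 1 (Suc j) - (\<Sum>i<j. smult (real (Suc j choose i)) (q i)))"
  have "(\<Sum>s<r. real s ^ j) = poly ?Q (real r)" for r
  proof -
    have "(\<Sum>s<r. real s ^ j) = (real (Suc j) * (\<Sum>s<r. real s ^ j)) / real (Suc j)" by simp
    then show ?thesis unfolding * by (simp add: poly_sum poly_monom)
  qed
  then show ?case by blast
qed

lemma poly_sum_poly: "\<exists>q. \<forall>r::nat. (\<Sum>s<r. poly p (real s)) = poly q (real r)"
proof -
  obtain q where q: "\<And>j r. (\<Sum>s<r. real s ^ j) = poly (q j) (real r)"
    using power_sum_poly by metis
  have "(\<Sum>s<r. poly p (real s)) = poly (\<Sum>i\<le>degree p. smult (coeff p i) (q i)) (real r)" for r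
  proof -
    have "(\<Sum>s<r. poly p (real s)) = (\<Sum>i\<le>degree p. coeff p i * (\<Sum>s<r. real s ^ i))"
      unfolding poly_altdef by (subst sum.swap) (simp add: sum_distrib_left)
    then show ?thesis by (simp add: q poly_sum)
  qed
  then show ?thesis by blast
qed

text \<open>By induction the first difference of \<open>F\<close> is polynomial; summing it up
  recovers \<open>F\<close> up to the constant \<open>F 0\<close>.\<close>

lemma fdiff_zero_imp_poly:
  assumes "\<And>r. fdiff k F r = 0"
  shows "\<exists>p. \<forall>r. F r = poly p (real r)"
  using assms
proof (induction k arbitrary: F)
  case 0
  then show ?case by (intro exI[of _ 0]) simp
next
  case (Suc k)
  have "\<exists>p. \<forall>r. F (Suc r) - F r = poly p (real r)"
    by (rule Suc.IH) (use Suc.prems fdiff_shift in metis)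
  then obtain p where p: "\<And>r. F (Suc r) - F r = poly p (real r)" by blast
  obtain q where q: "\<And>r::nat. (\<Sum>s<r. poly p (real s)) = poly q (real r)" using poly_sum_poly by blast
  have "F r = poly ([:F 0:] + q) (real r)" for r
    using sum_lessThan_telescope[of F r] q[of r] by (simp add: p)
  then show ?case by blast
qed

lemma fdiff_Suc_arg: "fdiff k (\<lambda>r. F (Suc r)) r = fdiff k F (Suc r)"
  by (induction k arbitrary: r) auto

lemma polytope_poly:
  fixes f :: "'a::euclidean_space set \<Rightarrow> real"
  assumes f: "real_val f" and V: "finite V" "V \<noteq> {}"
  obtains p where "\<And>m. m \<ge> 1 \<Longrightarrow> f ((*\<^sub>R) (real m) ` (convex hull V)) = poly p (real m)"
proof -
  have "\<exists>p. \<forall>r. f ((*\<^sub>R) (real (Suc r)) ` (convex hull V)) = poly p (real r)"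
    by (rule fdiff_zero_imp_poly[of "card V"]) (use polytope_fdiff[OF f V] fdiff_Suc_arg[of "card V" "\<lambda>r. f ((*\<^sub>R) (real r) ` (convex hull V))"] in simp)
  then obtain p where p: "\<And>r. f ((*\<^sub>R) (real (Suc r)) ` (convex hull V)) = poly p (real r)" by blast
  \<comment> \<open>The differences are known to vanish only from r = 1 on, so the polynomial was
    found for the shifted argument; composing with x - 1 undoes the shift.\<close>
  have "f ((*\<^sub>R) (real m) ` (convex hull V)) = poly (pcompose p [:-1, 1:]) (real m)" if "m \<ge> 1" for m
    using p[of "m - 1"] that by (simp add: poly_pcompose of_nat_diff)
  then show ?thesis by (rule that)
qed

subsection \<open>Dissection into unit cubes\<close>

text \<open>Convex bodies together with the empty set: a class closed under the cuts below.\<close>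

definition ccset :: "'a::euclidean_space set \<Rightarrow> bool" where
  "ccset K \<longleftrightarrow> compact K \<and> convex K"

lemma ccset_Int: "ccset K \<Longrightarrow> closed C \<Longrightarrow> convex C \<Longrightarrow> ccset (K \<inter> C)"
  by (simp add: ccset_def compact_Int_closed convex_Int)

lemma ccset_body_iff: "convex_body K \<longleftrightarrow> ccset K \<and> K \<noteq> {}"
  by (auto simp: ccset_def convex_body_def)

lemma closed_coord_le: "closed {x::'a::euclidean_space. x \<bullet> b \<le> a}" "convex {x::'a. x \<bullet> b \<le> a}"
  using closed_halfspace_le[of b a] convex_halfspace_le[of b a] by (simp_all add: inner_commute)

lemma closed_coord_ge: "closed {x::'a::euclidean_space. a \<le> x \<bullet> b}" "convex {x::'a. a \<le> x \<bullet> b}"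
  using closed_halfspace_ge[where a=b and b=a] convex_halfspace_ge[where a=b and b=a] by (simp_all add: inner_commute)

lemma closed_coord_eq: "closed {x::'a::euclidean_space. x \<bullet> b = a}" "convex {x::'a. x \<bullet> b = a}"
  using closed_hyperplane[of b a] convex_hyperplane[of b a] by (simp_all add: inner_commute)

lemma closed_slab: "closed {x::'a::euclidean_space. a \<le> x \<bullet> b \<and> x \<bullet> b \<le> c}" "convex {x::'a. a \<le> x \<bullet> b \<and> x \<bullet> b \<le> c}"
proof -
  have "{x::'a. a \<le> x \<bullet> b \<and> x \<bullet> b \<le> c} = {x. a \<le> x \<bullet> b} \<inter> {x. x \<bullet> b \<le> c}" by auto
  then show "closed {x::'a::euclidean_space. a \<le> x \<bullet> b \<and> x \<bullet> b \<le> c}" "convex {x::'a. a \<le> x \<bullet> b \<and> x \<bullet> b \<le> c}"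
    by (simp_all add: closed_Int convex_Int closed_coord_le closed_coord_ge)
qed

definition splits :: "('a::euclidean_space set \<Rightarrow> real) \<Rightarrow> bool" where
  "splits g \<longleftrightarrow> (\<forall>K b a. ccset K \<longrightarrow>
     g K = g (K \<inter> {x. x \<bullet> b \<le> a}) + g (K \<inter> {x. a \<le> x \<bullet> b}) - g (K \<inter> {x. x \<bullet> b = a}))"

lemma splits_ext0:
  fixes f :: "'a::euclidean_space set \<Rightarrow> real"
  assumes f: "real_val f"
  shows "splits (ext0 f)"
  unfolding splits_def
proof (intro allI impI)
  fix K :: "'a set" and b a assume K: "ccset K"
  let ?A1 = "K \<inter> {x. x \<bullet> b \<le> a}" and ?A2 = "K \<inter> {x. a \<le> x \<bullet> b}" and ?A3 = "K \<inter> {x. x \<bullet> b = a}"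
  have un: "K = ?A1 \<union> ?A2" and int: "?A1 \<inter> ?A2 = ?A3" by auto
  consider "?A1 = {}" | "?A2 = {}" | "?A1 \<noteq> {}" "?A2 \<noteq> {}" by blast
  then show "ext0 f K = ext0 f ?A1 + ext0 f ?A2 - ext0 f ?A3"
  proof cases
    case 1
    then have "?A2 = K" "?A3 = {}" using un by auto
    then show ?thesis using 1 by simp
  next
    case 2
    then have "?A1 = K" "?A3 = {}" using un by auto
    then show ?thesis using 2 by simp
  next
    case 3
    have b: "convex_body ?A1" "convex_body ?A2" "convex_body K"
      using 3 K unfolding ccset_body_iff by (auto simp: ccset_Int closed_coord_le closed_coord_ge)
    then have "convex_body (?A1 \<union> ?A2)" using un by simp
    then have "?A3 \<noteq> {}" "f ?A1 + f ?A2 = f K + f ?A3"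
      using convex_body_Int_of_Un[OF b(1,2)] real_valD(1)[OF f b(1,2)] un unfolding int by (auto simp: convex_body_def)
    then show ?thesis using 3 un by (auto simp: ext0_def)
  qed
qed

definition slab :: "'a::euclidean_space \<Rightarrow> int \<Rightarrow> 'a set" where
  "slab b k = {x. real_of_int k \<le> x \<bullet> b \<and> x \<bullet> b \<le> real_of_int (k + 1)}"

definition top_face :: "'a::euclidean_space \<Rightarrow> int \<Rightarrow> 'a set" where
  "top_face b k = {x. x \<bullet> b = real_of_int (k + 1)}"

lemma ccset_slab: "ccset K \<Longrightarrow> ccset (K \<inter> slab b k)" "ccset K \<Longrightarrow> ccset (K \<inter> top_face b k)"
  unfolding slab_def top_face_def by (auto intro!: ccset_Int closed_slab closed_coord_eq)

text \<open>The contribution of the half-open cube with lowest corner \<open>z\<close>.\<close>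
fun cellval :: "('a::euclidean_space set \<Rightarrow> real) \<Rightarrow> 'a list \<Rightarrow> ('a \<Rightarrow> int) \<Rightarrow> 'a set \<Rightarrow> real" where
  "cellval g [] z K = g K"
| "cellval g (b # bs) z K = cellval g bs z (K \<inter> slab b (z b)) - cellval g bs z (K \<inter> top_face b (z b))"

lemma splits_slab_telescope:
  assumes g: "splits g" "g {} = 0" and K: "ccset K" and sub: "K \<subseteq> {x. - real_of_int M \<le> x \<bullet> b \<and> x \<bullet> b < real_of_int M}"
    and M: "M \<ge> 0"
  shows "g K = (\<Sum>k\<in>{-M..<M}. g (K \<inter> slab b k) - g (K \<inter> top_face b k))"
proof -
  \<comment> \<open>The value of the part of \<open>K\<close> above level \<open>k\<close>. A
    half-open layer is a difference of two consecutive such values, and the strict upper bound on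
    \<open>K\<close> empties the part above \<open>M\<close>.\<close>
  define h where "h k = g (K \<inter> {x. real_of_int k \<le> x \<bullet> b})" for k
  have step: "g (K \<inter> slab b k) - g (K \<inter> top_face b k) = h k - h (k + 1)" for k
  proof -
    let ?L = "K \<inter> {x. real_of_int k \<le> x \<bullet> b}"
    have "ccset ?L" using K by (intro ccset_Int closed_coord_ge)
    then have "g ?L = g (?L \<inter> {x. x \<bullet> b \<le> real_of_int (k + 1)}) + g (?L \<inter> {x. real_of_int (k + 1) \<le> x \<bullet> b})
       - g (?L \<inter> {x. x \<bullet> b = real_of_int (k + 1)})"
      using g(1) unfolding splits_def by blast
    moreover have "?L \<inter> {x. x \<bullet> b \<le> real_of_int (k + 1)} = K \<inter> slab b k"
      "?L \<inter> {x. real_of_int (k + 1) \<le> x \<bullet> b} = K \<inter> {x. real_of_int (k + 1) \<le> x \<bullet> b}"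
      "?L \<inter> {x. x \<bullet> b = real_of_int (k + 1)} = K \<inter> top_face b k"
      unfolding slab_def top_face_def by auto
    ultimately show ?thesis unfolding h_def by simp
  qed
  have tel: "(\<Sum>k\<in>{-M..<-M + int n}. h k - h (k + 1)) = h (-M) - h (-M + int n)" for n
  proof (induction n)
    case (Suc n)
    have "{-M..<-M + int (Suc n)} = insert (-M + int n) {-M..<-M + int n}" by auto
    then have "(\<Sum>k\<in>{-M..<-M + int (Suc n)}. h k - h (k + 1))
        = (h (-M + int n) - h (-M + int n + 1)) + (\<Sum>k\<in>{-M..<-M + int n}. h k - h (k + 1))"
      by simp
    also have "\<dots> = h (-M) - h (-M + int n + 1)" unfolding Suc by simp
    also have "-M + int n + 1 = -M + int (Suc n)" by simp
    finally show ?case .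
  qed simp
  have "(\<Sum>k\<in>{-M..<M}. h k - h (k + 1)) = h (-M) - h M"
    using tel[of "nat (2 * M)"] M by simp
  moreover have "K \<inter> {x. real_of_int (-M) \<le> x \<bullet> b} = K" "K \<inter> {x. real_of_int M \<le> x \<bullet> b} = {}"
    using sub by auto
  then have "h (-M) = g K" "h M = 0" unfolding h_def using g(2) by simp_all
  ultimately show ?thesis by (simp add: step)
qed

lemma cellval_cong: "(\<And>b. b \<in> set bs \<Longrightarrow> z b = z' b) \<Longrightarrow> cellval g bs z K = cellval g bs z' K"
  by (induction bs arbitrary: K) auto

text \<open>Applies \<open>splits_slab_telescope\<close> to one coordinate direction after the
  other; each direction contributes one factor to the product of index ranges.\<close>

lemma cellval_sum:
  assumes g: "splits g" "g {} = 0" and "distinct bs" and "ccset K" and M: "M \<ge> 0"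
    and "\<And>b. b \<in> set bs \<Longrightarrow> K \<subseteq> {x. - real_of_int M \<le> x \<bullet> b \<and> x \<bullet> b < real_of_int M}"
  shows "g K = (\<Sum>z\<in>PiE (set bs) (\<lambda>_. {-M..<M}). cellval g bs z K)"
  using assms(3,4,6)
proof (induction bs arbitrary: K)
  case Nil
  then show ?case by simp
next
  case (Cons b bs)
  have nb: "b \<notin> set bs" using Cons.prems by simp
  have IH: "g L = (\<Sum>z\<in>PiE (set bs) (\<lambda>_. {-M..<M}). cellval g bs z L)" if "ccset L" "L \<subseteq> K" for L
  proof (rule Cons.IH)
    show "distinct bs" "ccset L" using Cons.prems that by auto
    show "L \<subseteq> {x. - real_of_int M \<le> x \<bullet> c \<and> x \<bullet> c < real_of_int M}" if "c \<in> set bs" for c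
      using Cons.prems(3)[of c] that \<open>L \<subseteq> K\<close> by auto
  qed
  have "(\<Sum>z\<in>PiE (set (b # bs)) (\<lambda>_. {-M..<M}). cellval g (b # bs) z K)
     = (\<Sum>(k, z)\<in>{-M..<M} \<times> PiE (set bs) (\<lambda>_. {-M..<M}). cellval g (b # bs) (z(b := k)) K)"
    using inj_combinator[OF nb, of "\<lambda>_. {-M..<M}"]
    by (simp add: PiE_insert_eq sum.reindex case_prod_unfold del: cellval.simps)
  also have "\<dots> = (\<Sum>k\<in>{-M..<M}. \<Sum>z\<in>PiE (set bs) (\<lambda>_. {-M..<M}). cellval g (b # bs) (z(b := k)) K)"
    by (simp add: sum.cartesian_product del: cellval.simps)
  also have "\<dots> = (\<Sum>k\<in>{-M..<M}. \<Sum>z\<in>PiE (set bs) (\<lambda>_. {-M..<M}).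
      cellval g bs z (K \<inter> slab b k) - cellval g bs z (K \<inter> top_face b k))"
  proof (intro sum.cong refl)
    fix k z
    have "cellval g bs (z(b := k)) L = cellval g bs z L" for L
      using nb by (intro cellval_cong) auto
    then show "cellval g (b # bs) (z(b := k)) K = cellval g bs z (K \<inter> slab b k) - cellval g bs z (K \<inter> top_face b k)"
      by simp
  qed
  also have "\<dots> = (\<Sum>k\<in>{-M..<M}. g (K \<inter> slab b k) - g (K \<inter> top_face b k))"
    using Cons.prems(2) by (simp add: sum_subtractf IH[symmetric] ccset_slab)
  also have "\<dots> = g K"
    using splits_slab_telescope[OF g Cons.prems(2) _ M, of b] Cons.prems(3)[of b] by simp
  finally show ?case by simp
qed

definition cellset :: "'a::euclidean_space set \<Rightarrow> ('a \<Rightarrow> int) \<Rightarrow> 'a set" where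
  "cellset S z = {x. \<forall>b\<in>S. real_of_int (z b) \<le> x \<bullet> b \<and> x \<bullet> b \<le> real_of_int (z b + 1)}"

text \<open>The recursion unfolds into 2^(length bs) signed values of \<open>g\<close>, each on a
  subset of the closed cube.\<close>

lemma cellval_bound:
  assumes "\<And>K'. ccset K' \<Longrightarrow> K' \<subseteq> K \<inter> cellset (set bs) z \<Longrightarrow> \<bar>g K'\<bar> \<le> B" and "ccset K"
  shows "\<bar>cellval g bs z K\<bar> \<le> 2 ^ length bs * B"
  using assms
proof (induction bs arbitrary: K)
  case Nil
  then show ?case by (simp add: cellset_def)
next
  case (Cons b bs)
  have 1: "\<bar>cellval g bs z (K \<inter> slab b (z b))\<bar> \<le> 2 ^ length bs * B"
    using Cons.prems(2)
    by (intro Cons.IH ccset_slab Cons.prems(1)) (auto simp: cellset_def slab_def)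
  have 2: "\<bar>cellval g bs z (K \<inter> top_face b (z b))\<bar> \<le> 2 ^ length bs * B"
    using Cons.prems(2)
    by (intro Cons.IH ccset_slab Cons.prems(1)) (auto simp: cellset_def top_face_def)
  show ?case using 1 2 by simp
qed

lemma cellval_local:
  assumes "K \<inter> cellset (set bs) z = K' \<inter> cellset (set bs) z"
  shows "cellval g bs z K = cellval g bs z K'"
  using assms
proof (induction bs arbitrary: K K')
  case Nil
  then show ?case by (simp add: cellset_def)
next
  case (Cons b bs)
  have c: "cellset (set (b # bs)) z = cellset (set bs) z \<inter> slab b (z b)"
    by (auto simp: cellset_def slab_def)
  have "cellval g bs z (K \<inter> slab b (z b)) = cellval g bs z (K' \<inter> slab b (z b))"
    by (rule Cons.IH) (use Cons.prems c in blast)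
  moreover have "top_face b (z b) \<subseteq> slab b (z b)" by (auto simp: top_face_def slab_def)
  then have "cellval g bs z (K \<inter> top_face b (z b)) = cellval g bs z (K' \<inter> top_face b (z b))"
    by (intro Cons.IH) (use Cons.prems c in blast)
  ultimately show ?case by simp
qed

lemma cellval_translate:
  assumes g: "\<And>K. ccset K \<Longrightarrow> g (translate K t) = g K" and "ccset K" and "\<And>b. b \<in> set bs \<Longrightarrow> t \<bullet> b = real_of_int (w b)"
  shows "cellval g bs (\<lambda>b. z b + w b) (translate K t) = cellval g bs z K"
  using assms(2,3)
proof (induction bs arbitrary: K)
  case Nil
  then show ?case using g by simp
next
  case (Cons b bs)
  have tb: "t \<bullet> b = real_of_int (w b)" using Cons.prems by simp
  have 1: "translate K t \<inter> slab b (z b + w b) = translate (K \<inter> slab b (z b)) t"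
    unfolding translate_def slab_def by (auto simp: inner_add_left tb)
  have 2: "translate K t \<inter> top_face b (z b + w b) = translate (K \<inter> top_face b (z b)) t"
    unfolding translate_def top_face_def by (auto simp: inner_add_left tb)
  show ?case using Cons.prems
    by (simp add: 1 2 Cons.IH ccset_slab)
qed

section \<open>Counting unit cubes\<close>

abbreviation cell :: "('a::euclidean_space \<Rightarrow> int) \<Rightarrow> 'a set" where
  "cell \<equiv> cellset Basis"

definition corner :: "('a::euclidean_space \<Rightarrow> int) \<Rightarrow> 'a" where
  "corner z = (\<Sum>b\<in>Basis. real_of_int (z b) *\<^sub>R b)"

lemma corner_inner [simp]: "b \<in> Basis \<Longrightarrow> corner z \<bullet> b = real_of_int (z b)"
  by (simp add: corner_def)

lemma cell_cbox: "cell z = cbox (corner z) (corner (\<lambda>b. z b + 1))"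
  by (auto simp: cellset_def mem_box)

lemma cell_translate: "cell z = translate (cell (\<lambda>_. 0)) (corner z)"
proof (intro equalityI subsetI)
  fix x assume "x \<in> cell z"
  then have "x - corner z \<in> cell (\<lambda>_. 0)" by (auto simp: cellset_def inner_diff_left)
  then show "x \<in> translate (cell (\<lambda>_. 0)) (corner z)" unfolding translate_def by force
next
  fix x assume "x \<in> translate (cell (\<lambda>_. 0)) (corner z)"
  then show "x \<in> cell z" unfolding translate_def by (auto simp: cellset_def inner_add_left)
qed

lemma convex_body_cell: "convex_body (cell z)"
proof -
  have "corner z \<in> cell z" by (simp add: cellset_def)
  then show ?thesis unfolding convex_body_def cell_cbox by (auto simp: convex_box)
qed

text \<open>Corners are restricted to extensional functions on \<open>Basis\<close>, so that
  distinct indices are distinct cubes and cardinalities count cubes.\<close>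

definition cells_in :: "'a::euclidean_space set \<Rightarrow> ('a \<Rightarrow> int) set" where
  "cells_in K = {z \<in> PiE Basis (\<lambda>_. UNIV). cell z \<subseteq> K}"

definition cells_out :: "'a::euclidean_space set \<Rightarrow> ('a \<Rightarrow> int) set" where
  "cells_out K = {z \<in> PiE Basis (\<lambda>_. UNIV). cell z \<inter> K \<noteq> {}}"

lemma cells_in_out: "cells_in K \<subseteq> cells_out K"
  using convex_body_cell unfolding cells_in_def cells_out_def convex_body_def by blast

lemma cells_out_bounded:
  assumes "bounded K"
  obtains M where "M \<ge> 0" "cells_out K \<subseteq> PiE Basis (\<lambda>_. {-M..<M})"
    "\<And>b. b \<in> Basis \<Longrightarrow> K \<subseteq> {x. - real_of_int M \<le> x \<bullet> b \<and> x \<bullet> b < real_of_int M}"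
proof -
  obtain R where R: "R > 0" "\<And>x. x \<in> K \<Longrightarrow> norm x \<le> R" using assms by (metis bounded_pos)
  \<comment> \<open>The margin covers the unit side of a cube touching \<open>K\<close> from below
    and the strictness of the upper bounds.\<close>
  define M where "M = \<lceil>R\<rceil> + 2"
  have MR: "real_of_int M \<ge> R + 2" unfolding M_def by (simp add: le_of_int_ceiling)
  have x: "\<bar>x \<bullet> b\<bar> \<le> R" if "x \<in> K" "b \<in> Basis" for x b
    using Basis_le_norm[OF that(2), of x] R(2)[OF that(1)] by simp
  show ?thesis
  proof (rule that[of M])
    show "M \<ge> 0" using R MR by linarith
    show "K \<subseteq> {x. - real_of_int M \<le> x \<bullet> b \<and> x \<bullet> b < real_of_int M}" if "b \<in> Basis" for b
      using x[OF _ that] MR by force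
    show "cells_out K \<subseteq> PiE Basis (\<lambda>_. {-M..<M})"
    proof
      fix z assume "z \<in> cells_out K"
      then obtain y where z: "z \<in> PiE Basis (\<lambda>_. UNIV)" and y: "y \<in> cell z" "y \<in> K" unfolding cells_out_def by blast
      have "z b \<in> {-M..<M}" if "b \<in> Basis" for b
      proof -
        have "real_of_int (z b) \<le> y \<bullet> b" "y \<bullet> b \<le> real_of_int (z b) + 1" using y(1) that by (auto simp: cellset_def)
        then have "real_of_int (z b) < real_of_int M" "real_of_int (z b) \<ge> real_of_int (- M)"
          using x[OF y(2) that] MR by auto
        then show ?thesis by (simp only: of_int_less_iff of_int_le_iff) simp
      qed
      then show "z \<in> PiE Basis (\<lambda>_. {-M..<M})" using z by (auto simp: PiE_iff)
    qed
  qed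
qed

lemma finite_cells_out:
  fixes K :: "'a::euclidean_space set"
  assumes "bounded K"
  shows "finite (cells_out K)"
proof (rule cells_out_bounded[OF assms])
  fix M :: int
  assume "cells_out K \<subseteq> PiE Basis (\<lambda>_. {-M..<M})"
  moreover have "finite (PiE (Basis :: 'a set) (\<lambda>_. {-M..<M}))" by (intro finite_PiE) auto
  ultimately show ?thesis by (rule finite_subset)
qed

text \<open>A cube inside \<open>K\<close> contributes the same constant \<open>c\<close> by
  translation invariance, a cube missing \<open>K\<close> contributes 0, and each of the remaining
  cubes contributes at most 2^n times \<open>B\<close>.\<close>

lemma cell_estimate:
  fixes f :: "'a::euclidean_space set \<Rightarrow> real"
  assumes f: "real_val f" and B: "\<And>K. convex_body K \<Longrightarrow> K \<subseteq> cell (\<lambda>_. 0) \<Longrightarrow> \<bar>f K\<bar> \<le> B"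
  obtains c where "\<bar>c\<bar> \<le> 2 ^ DIM('a) * B"
    "\<And>K. convex_body K \<Longrightarrow> \<bar>f K - c * real (card (cells_in K))\<bar> \<le> 2 ^ DIM('a) * B * real (card (cells_out K - cells_in K))"
proof -
  obtain bs :: "'a list" where bs: "set bs = Basis" "distinct bs" using finite_distinct_list[OF finite_Basis] by blast
  have len: "length bs = DIM('a)" using bs distinct_card by fastforce
  have B0: "B \<ge> 0" using B[OF convex_body_cell] by fastforce
  have tr: "ext0 f (translate K t) = ext0 f K" if "ccset K" for K t
    using that real_valD(2)[OF f, of K t] by (auto simp: ext0_def ccset_body_iff translate_def)
  have bound: "\<bar>ext0 f K'\<bar> \<le> B" if "ccset K'" "K' \<subseteq> cell z" for K' z
  proof (cases "K' = {}")
    case False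
    have "translate K' (- corner z) \<subseteq> cell (\<lambda>_. 0)"
      using that(2) unfolding cell_translate[of z] translate_def by auto
    moreover have "convex_body K'" using that False by (simp add: ccset_body_iff)
    ultimately have "\<bar>f (translate K' (- corner z))\<bar> \<le> B" by (intro B convex_body_translate)
    then show ?thesis using real_valD(2)[OF f \<open>convex_body K'\<close>] False by (simp add: ext0_def)
  qed (use B0 in simp)
  define c where "c = cellval (ext0 f) bs (\<lambda>_. 0) (cell (\<lambda>_. 0))"
  let ?h = "\<lambda>z K. cellval (ext0 f) bs z K"
  have hb: "\<bar>?h z K\<bar> \<le> 2 ^ DIM('a) * B" if "ccset K" for z K
    using cellval_bound[of K bs z "ext0 f" B] bound bs len that by auto
  have h0: "?h z K = 0" if "ccset K" "cell z \<inter> K = {}" for z K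
  proof -
    have "\<bar>?h z K\<bar> \<le> 2 ^ length bs * 0"
    proof (rule cellval_bound[OF _ that(1)])
      fix K' assume "K' \<subseteq> K \<inter> cellset (set bs) z"
      then have "K' = {}" using that(2) bs by auto
      then show "\<bar>ext0 f K'\<bar> \<le> 0" by simp
    qed
    then show ?thesis by simp
  qed
  have ccell: "ccset (cell z)" for z :: "'a \<Rightarrow> int" using convex_body_cell ccset_body_iff by blast
  have hc: "?h z K = c" if "cell z \<subseteq> K" for z K
  proof -
    have "?h z K = ?h z (cell z)" by (rule cellval_local) (use bs that in auto)
    also have "\<dots> = ?h (\<lambda>b. 0 + z b) (translate (cell (\<lambda>_. 0)) (corner z))" by (simp add: cell_translate[of z])
    also have "\<dots> = c" unfolding c_def
      using cellval_translate[of "ext0 f" "corner z" "cell (\<lambda>_. 0)" bs z "\<lambda>_. 0"] tr ccell bs by simp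
    finally show ?thesis .
  qed
  show ?thesis
  proof (rule that[of c])
    show "\<bar>c\<bar> \<le> 2 ^ DIM('a) * B" unfolding c_def by (rule hb[OF ccell])
    fix K :: "'a set" assume K: "convex_body K"
    have cc: "ccset K" "bounded K" using K by (auto simp: ccset_body_iff ccset_def compact_imp_bounded)
    obtain M where M: "M \<ge> 0" "cells_out K \<subseteq> PiE Basis (\<lambda>_. {-M..<M})"
      "\<And>b. b \<in> Basis \<Longrightarrow> K \<subseteq> {x. - real_of_int M \<le> x \<bullet> b \<and> x \<bullet> b < real_of_int M}"
      using cells_out_bounded[OF cc(2)] by metis
    let ?Z = "PiE Basis (\<lambda>_::'a. {-M..<M})"
    have finZ: "finite ?Z" by (intro finite_PiE) auto
    have fin: "finite (cells_out K)" using M(2) finZ finite_subset by blast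
    have "f K = ext0 f K" using K by (simp add: ext0_def convex_body_def)
    also have "\<dots> = (\<Sum>z\<in>?Z. ?h z K)"
      using cellval_sum[OF splits_ext0[OF f] ext0_empty bs(2) cc(1) M(1)] M(3) bs by simp
    also have "\<dots> = (\<Sum>z\<in>cells_out K. ?h z K)"
    proof (rule sum.mono_neutral_right[OF finZ M(2)], rule ballI)
      fix z assume z: "z \<in> ?Z - cells_out K"
      then have "cell z \<inter> K = {}" by (auto simp: cells_out_def PiE_iff)
      then show "?h z K = 0" by (rule h0[OF cc(1)])
    qed
    also have "\<dots> = (\<Sum>z\<in>cells_out K - cells_in K. ?h z K) + (\<Sum>z\<in>cells_in K. ?h z K)"
      using cells_in_out fin by (rule sum.subset_diff)
    also have "(\<Sum>z\<in>cells_in K. ?h z K) = c * real (card (cells_in K))"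
      by (simp add: hc cells_in_def)
    finally have "f K - c * real (card (cells_in K)) = (\<Sum>z\<in>cells_out K - cells_in K. ?h z K)" by simp
    also have "\<bar>\<dots>\<bar> \<le> (\<Sum>z\<in>cells_out K - cells_in K. \<bar>?h z K\<bar>)" by (rule sum_abs)
    also have "\<dots> \<le> (\<Sum>z\<in>cells_out K - cells_in K. 2 ^ DIM('a) * B)"
      by (intro sum_mono hb cc)
    finally show "\<bar>f K - c * real (card (cells_in K))\<bar> \<le> 2 ^ DIM('a) * B * real (card (cells_out K - cells_in K))"
      by (simp add: mult.commute)
  qed
qed

lemma measure_cell: "measure lebesgue (cell z) = 1" "measure lebesgue (box (corner z) (corner (\<lambda>b. z b + 1))) = 1"
  by (simp_all add: cell_cbox measure_lborel_cbox_eq measure_lborel_box_eq inner_diff_left)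

text \<open>The open cubes are pairwise disjoint and have measure 1.\<close>

lemma card_cells_le_measure:
  fixes T :: "'a::euclidean_space set"
  assumes S: "finite S" "S \<subseteq> PiE Basis (\<lambda>_. UNIV)" and T: "T \<in> lmeasurable" and sub: "\<And>z. z \<in> S \<Longrightarrow> cell z \<subseteq> T"
  shows "real (card S) \<le> measure lebesgue T"
proof -
  let ?b = "\<lambda>z. box (corner z) (corner (\<lambda>b. z b + 1)) :: 'a set"
  have "pairwise (\<lambda>z w. disjnt (?b z) (?b w)) S"
  proof (rule pairwiseI)
    fix z w assume zw: "z \<in> S" "w \<in> S" "z \<noteq> w"
    then have "z \<in> extensional Basis" "w \<in> extensional Basis" using S(2) by (auto simp: PiE_def)
    then obtain b where b: "b \<in> Basis" "z b \<noteq> w b" using zw(3) extensionalityI by blast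
    have False if "x \<in> ?b z" "x \<in> ?b w" for x
    proof -
      have "real_of_int (z b) < x \<bullet> b" "x \<bullet> b < real_of_int (z b + 1)"
        "real_of_int (w b) < x \<bullet> b" "x \<bullet> b < real_of_int (w b + 1)" using that b(1) by (auto simp: mem_box)
      then have "real_of_int (z b) < real_of_int (w b + 1)" "real_of_int (w b) < real_of_int (z b + 1)" by linarith+
      then have "z b < w b + 1" "w b < z b + 1" by (simp_all only: of_int_less_iff)
      then show False using b(2) by simp
    qed
    then show "disjnt (?b z) (?b w)" by (auto simp: disjnt_def)
  qed
  then have "measure lebesgue (\<Union>z\<in>S. ?b z) = (\<Sum>z\<in>S. measure lebesgue (?b z))"
    using S(1) by (intro measure_UNION') auto
  also have "\<dots> = real (card S)" by (simp add: measure_cell)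
  finally have "real (card S) = measure lebesgue (\<Union>z\<in>S. ?b z)" by simp
  also have "\<dots> \<le> measure lebesgue T"
  proof (rule measure_mono_fmeasurable)
    show "(\<Union>z\<in>S. ?b z) \<subseteq> T" using sub box_subset_cbox unfolding cell_cbox by blast
    show "(\<Union>z\<in>S. ?b z) \<in> sets lebesgue" by (auto intro!: sets.finite_UN S(1))
  qed (rule T)
  finally show ?thesis .
qed

lemma measure_le_cells_out:
  fixes K :: "'a::euclidean_space set"
  assumes "convex_body K"
  shows "measure lebesgue K \<le> real (card (cells_out K))"
proof -
  have fin: "finite (cells_out K)" using assms by (intro finite_cells_out) (simp add: convex_body_def compact_imp_bounded)
  have "measure lebesgue K \<le> measure lebesgue (\<Union>z\<in>cells_out K. cell z)"
  proof (rule measure_mono_fmeasurable)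
    show "K \<subseteq> (\<Union>z\<in>cells_out K. cell z)"
    proof
      fix x assume x: "x \<in> K"
      define z where "z = restrict (\<lambda>b. \<lfloor>x \<bullet> b\<rfloor>) Basis"
      have "x \<in> cell z" by (simp add: cellset_def z_def)
      moreover have "z \<in> cells_out K" using x \<open>x \<in> cell z\<close> unfolding cells_out_def z_def by auto
      ultimately show "x \<in> (\<Union>z\<in>cells_out K. cell z)" by blast
    qed
    show "K \<in> sets lebesgue" using convex_body_lmeasurable[OF assms] by auto
    show "(\<Union>z\<in>cells_out K. cell z) \<in> lmeasurable"
      using fin by (intro fmeasurable.finite_UN) (auto simp: cell_cbox)
  qed
  also have "\<dots> \<le> (\<Sum>z\<in>cells_out K. measure lebesgue (cell z))"
    using fin by (intro measure_UNION_le) (auto simp: cell_cbox)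
  also have "\<dots> = real (card (cells_out K))" by (simp add: measure_cell)
  finally show ?thesis .
qed

section \<open>Shrinking neighbourhoods of the boundary and growth of order n\<close>

definition nbhd :: "'a::euclidean_space set \<Rightarrow> real \<Rightarrow> 'a set" where
  "nbhd F d = {x. \<exists>y\<in>F. dist x y \<le> d}"

lemma nbhd_compact:
  assumes "compact F" shows "compact (nbhd F d)"
proof -
  have "nbhd F d = {x + y | x y. x \<in> F \<and> y \<in> cball 0 d}"
  proof (intro equalityI subsetI)
    fix x assume "x \<in> nbhd F d"
    then obtain y where "y \<in> F" "dist x y \<le> d" unfolding nbhd_def by blast
    then have "x = y + (x - y)" "x - y \<in> cball 0 d" "y \<in> F" by (auto simp: dist_norm norm_minus_commute)
    then show "x \<in> {x + y | x y. x \<in> F \<and> y \<in> cball 0 d}" by blast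
  next
    fix x assume "x \<in> {x + y | x y. x \<in> F \<and> y \<in> cball 0 d}"
    then obtain y v where "y \<in> F" "x = y + v" "norm v \<le> d" by auto
    then have "y \<in> F" "dist x y \<le> d" by (auto simp: dist_norm)
    then show "x \<in> nbhd F d" unfolding nbhd_def by blast
  qed
  then show ?thesis using compact_sums[OF assms compact_cball[of 0 d]] by metis
qed

text \<open>By outer regularity the compact null set has an open superset of measure below
  \<open>e\<close>, and this contains a neighbourhood of some positive radius.\<close>

lemma nbhd_measure_tendsto_0:
  fixes F :: "'a::euclidean_space set"
  assumes F: "compact F" "negligible F"
  shows "((\<lambda>d. measure lebesgue (nbhd F d)) \<longlongrightarrow> 0) (at_right 0)"
proof (rule tendstoI)
  fix e :: real assume e: "e > 0"
  have "F \<in> sets lebesgue" using F(2) by (simp add: negligible_imp_sets)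
  then obtain T where T: "open T" "F \<subseteq> T" "(T - F) \<in> lmeasurable" "emeasure lebesgue (T - F) < ennreal e"
    using sets_lebesgue_outer_open e by metis
  obtain r where r: "r > 0" "(\<Union>x\<in>F. cball x r) \<subseteq> T"
    using compact_subset_open_imp_cball_epsilon_subset[OF F(1) T(1,2)] by metis
  have mF: "F \<in> lmeasurable" "measure lebesgue F = 0" using F(2) negligible_iff_measure by auto
  have TF: "T = (T - F) \<union> F" using T(2) by auto
  have mT: "T \<in> lmeasurable" using fmeasurable.Un[OF T(3) mF(1)] TF by simp
  have "measure lebesgue T \<le> measure lebesgue (T - F) + measure lebesgue F"
    using measure_Un_le[of "T - F" lebesgue F] T(3) mF(1) TF by (simp add: fmeasurableD)
  moreover have "measure lebesgue (T - F) < e"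
    using T(4) by (simp add: emeasure_eq_measure2[OF T(3)] ennreal_less_iff)
  ultimately have mTe: "measure lebesgue T < e" using mF by simp
  have "\<forall>\<^sub>F d in at_right 0. d < r" using r(1) by (auto intro: eventually_at_right_less simp: eventually_at_right_field)
  then show "\<forall>\<^sub>F d in at_right 0. dist (measure lebesgue (nbhd F d)) 0 < e"
  proof eventually_elim
    case (elim d)
    have "nbhd F d \<subseteq> T" using r(2) elim unfolding nbhd_def by (fastforce simp: dist_commute)
    then have "measure lebesgue (nbhd F d) \<le> measure lebesgue T"
      using nbhd_compact[OF F(1)] mT by (intro measure_mono_fmeasurable) (simp_all add: fmeasurableD lmeasurable_compact)
    then have "measure lebesgue (nbhd F d) < e" using mTe by (rule order.strict_trans1)
    then show ?case by (simp only: dist_real_def diff_0_right abs_of_nonneg[OF measure_nonneg])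
  qed
qed

lemma measure_scale: "measure lebesgue ((*\<^sub>R) r ` S) = \<bar>r\<bar> ^ DIM('a) * measure lebesgue (S :: 'a::euclidean_space set)"
  using measure_lebesgue_affine[of r 0 S] by simp

lemma dist_in_cell:
  fixes x :: "'a::euclidean_space"
  assumes "x \<in> cell z" "y \<in> cell z"
  shows "dist x y \<le> real DIM('a)"
proof -
  have "dist x y \<le> (\<Sum>b\<in>Basis. \<bar>(x - y) \<bullet> b\<bar>)" unfolding dist_norm by (rule norm_le_l1)
  also have "\<dots> \<le> (\<Sum>b\<in>(Basis::'a set). 1)"
    using assms by (intro sum_mono) (force simp: cellset_def inner_diff_left)
  finally show ?thesis by simp
qed

text \<open>A cube that meets \<open>t K\<close> without being contained in it meets the boundary of \<open>t K\<close>.\<close>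
lemma boundary_cells:
  fixes K :: "'a::euclidean_space set"
  assumes K: "convex_body K" and t: "t > 0"
  shows "real (card (cells_out ((*\<^sub>R) t ` K) - cells_in ((*\<^sub>R) t ` K)))
    \<le> t ^ DIM('a) * measure lebesgue (nbhd (frontier K) (real DIM('a) / t))"
proof -
  let ?N = "nbhd (frontier K) (real DIM('a) / t)"
  have "compact (frontier K)" using K by (simp add: convex_body_def compact_frontier)
  then have c: "compact ?N" by (rule nbhd_compact)
  have "real (card (cells_out ((*\<^sub>R) t ` K) - cells_in ((*\<^sub>R) t ` K))) \<le> measure lebesgue ((*\<^sub>R) t ` ?N)"
  proof (rule card_cells_le_measure)
    show "finite (cells_out ((*\<^sub>R) t ` K) - cells_in ((*\<^sub>R) t ` K))"
      using convex_body_scale[OF K, of t]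
      by (intro finite_Diff finite_cells_out) (simp add: convex_body_def compact_imp_bounded)
    show "cells_out ((*\<^sub>R) t ` K) - cells_in ((*\<^sub>R) t ` K) \<subseteq> PiE Basis (\<lambda>_. UNIV)" by (auto simp: cells_out_def)
    show "(*\<^sub>R) t ` ?N \<in> lmeasurable" using c by (intro lmeasurable_compact compact_scaling)
    fix z assume z: "z \<in> cells_out ((*\<^sub>R) t ` K) - cells_in ((*\<^sub>R) t ` K)"
    let ?C = "(*\<^sub>R) (1 / t) ` cell z"
    from z have zz: "cell z \<inter> (*\<^sub>R) t ` K \<noteq> {}" "\<not> cell z \<subseteq> (*\<^sub>R) t ` K" by (auto simp: cells_out_def cells_in_def)
    have 1: "?C \<inter> K \<noteq> {}"
    proof -
      from zz(1) obtain k where "k \<in> K" "t *\<^sub>R k \<in> cell z" by blast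
      then have "(1 / t) *\<^sub>R (t *\<^sub>R k) \<in> ?C" by blast
      then show ?thesis using \<open>k \<in> K\<close> t by auto
    qed
    have 2: "?C - K \<noteq> {}"
    proof
      assume "?C - K = {}"
      have "x \<in> (*\<^sub>R) t ` K" if "x \<in> cell z" for x
      proof -
        have "(1 / t) *\<^sub>R x \<in> K" using that \<open>?C - K = {}\<close> by blast
        then have "t *\<^sub>R ((1 / t) *\<^sub>R x) \<in> (*\<^sub>R) t ` K" by blast
        then show ?thesis using t by simp
      qed
      then show False using zz(2) by blast
    qed
    have "connected ?C" using convex_body_scale[OF convex_body_cell[of z], of "1 / t"] by (simp add: convex_body_def convex_connected)
    then have "?C \<inter> frontier K \<noteq> {}" by (rule connected_Int_frontier) (use 1 2 in auto)
    then obtain y where y: "y \<in> cell z" "(1 / t) *\<^sub>R y \<in> frontier K" by blast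
    show "cell z \<subseteq> (*\<^sub>R) t ` ?N"
    proof
      fix x assume x: "x \<in> cell z"
      have "dist ((1 / t) *\<^sub>R x) ((1 / t) *\<^sub>R y) \<le> real DIM('a) / t"
        using dist_in_cell[OF x y(1)] t by (simp add: dist_scale divide_right_mono)
      then have "(1 / t) *\<^sub>R x \<in> ?N" using y(2) unfolding nbhd_def by blast
      then have "t *\<^sub>R ((1 / t) *\<^sub>R x) \<in> (*\<^sub>R) t ` ?N" by blast
      then show "x \<in> (*\<^sub>R) t ` ?N" using t by simp
    qed
  qed
  then show ?thesis using t by (simp add: measure_scale)
qed

lemma cells_in_measure:
  fixes K :: "'a::euclidean_space set"
  assumes "convex_body K"
  shows "\<bar>real (card (cells_in K)) - vol K\<bar> \<le> real (card (cells_out K - cells_in K))"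
proof -
  have fin: "finite (cells_out K)" using assms by (intro finite_cells_out) (simp add: convex_body_def compact_imp_bounded)
  then have fin2: "finite (cells_in K)" using cells_in_out finite_subset by blast
  have "real (card (cells_in K)) \<le> vol K" unfolding vol_def
    using convex_body_lmeasurable[OF assms] by (intro card_cells_le_measure fin2) (auto simp: cells_in_def)
  moreover have "vol K \<le> real (card (cells_out K))" unfolding vol_def by (rule measure_le_cells_out[OF assms])
  moreover have "card (cells_out K - cells_in K) = card (cells_out K) - card (cells_in K)"
    by (rule card_Diff_subset[OF fin2 cells_in_out])
  moreover have "card (cells_in K) \<le> card (cells_out K)" by (rule card_mono[OF fin cells_in_out])
  ultimately show ?thesis by (simp add: of_nat_diff)
qed

text \<open>The error in \<open>cell_estimate\<close> and the discrepancy between the number of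
  inner cubes and the volume are both governed by the boundary cubes. Their number is o(m^n) because
  the boundary of a convex body is a null set, so only volume survives at order m^n.\<close>

theorem real_val_asymptotics:
  fixes f :: "'a::euclidean_space set \<Rightarrow> real"
  assumes f: "real_val f"
  obtains c where "\<And>K. convex_body K \<Longrightarrow> (\<lambda>m. f ((*\<^sub>R) (real m) ` K) / real m ^ DIM('a)) \<longlonglongrightarrow> c * vol K"
proof -
  obtain d where d: "d > 0" "\<And>K'. convex_body K' \<Longrightarrow> hausdist {0} K' < d \<Longrightarrow> \<bar>f {0} - f K'\<bar> < 1"
    using real_val_cont[OF f convex_body_singleton zero_less_one] by metis
  \<comment> \<open>Continuity at {0} bounds \<open>f\<close> only on bodies inside a small cube;
    replacing f(K) by f(s K) makes this the unit cube. The dimension bounds the diameter of the unit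
    cube as in \<open>dist_in_cell\<close>, and the 2 gives a strict inequality.\<close>
  define s where "s = d / (2 * real DIM('a))"
  have s: "s > 0" "s * real DIM('a) < d" using d(1) by (simp_all add: s_def field_simps)
  define g where "g K = f ((*\<^sub>R) s ` K)" for K
  have g: "real_val g" unfolding g_def by (rule real_val_scale[OF f s(1)])
  define B where "B = \<bar>f {0}\<bar> + 1"
  have gB: "\<bar>g K\<bar> \<le> B" if K: "convex_body K" "K \<subseteq> cell (\<lambda>_. 0)" for K
  proof -
    have 0: "0 \<in> cell (\<lambda>_. 0 :: int)" by (simp add: cellset_def)
    have x: "dist 0 (s *\<^sub>R x) \<le> s * real DIM('a)" if "x \<in> K" for x
      using dist_in_cell[OF 0, of x] that K(2) s(1) by (auto simp: mult_left_mono)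
    have "hausdist {0} ((*\<^sub>R) s ` K) \<le> s * real DIM('a)"
      using K(1) x by (intro hausdist_le) (auto simp: convex_body_def)
    then have "\<bar>f {0} - f ((*\<^sub>R) s ` K)\<bar> < 1" using s(2) by (intro d(2) convex_body_scale K) auto
    then show ?thesis unfolding g_def B_def by linarith
  qed
  obtain c where c: "\<bar>c\<bar> \<le> 2 ^ DIM('a) * B"
    "\<And>K. convex_body K \<Longrightarrow> \<bar>g K - c * real (card (cells_in K))\<bar> \<le> 2 ^ DIM('a) * B * real (card (cells_out K - cells_in K))"
    using cell_estimate[OF g gB] by blast
  define D where "D = 2 ^ DIM('a) * B"
  have est: "\<bar>g ((*\<^sub>R) t ` K) / t ^ DIM('a) - c * vol K\<bar> \<le> 2 * D * measure lebesgue (nbhd (frontier K) (real DIM('a) / t))"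
    if K: "convex_body K" and t: "t > 0" for K t
  proof -
    let ?tK = "(*\<^sub>R) t ` K" and ?\<mu> = "measure lebesgue (nbhd (frontier K) (real DIM('a) / t))"
    let ?N = "real (card (cells_out ?tK - cells_in ?tK))"
    have b: "convex_body ?tK" using K by (rule convex_body_scale)
    have v: "vol ?tK = t ^ DIM('a) * vol K" unfolding vol_def measure_scale using t by simp
    have D0: "D \<ge> 0" unfolding D_def B_def by simp
    have "\<bar>c\<bar> * \<bar>real (card (cells_in ?tK)) - vol ?tK\<bar> \<le> D * ?N"
      using c(1) cells_in_measure[OF b] by (intro mult_mono) (auto simp: D_def B_def)
    then have 1: "\<bar>c * real (card (cells_in ?tK)) - c * vol ?tK\<bar> \<le> D * ?N"
      by (metis abs_mult right_diff_distrib)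
    have 2: "\<bar>g ?tK - c * real (card (cells_in ?tK))\<bar> \<le> D * ?N" using c(2)[OF b] by (simp add: D_def)
    have "\<bar>g ?tK - c * vol ?tK\<bar> \<le> 2 * D * ?N" using 1 2 by linarith
    also have "\<dots> \<le> 2 * D * (t ^ DIM('a) * ?\<mu>)"
      using boundary_cells[OF K t] D0 by (intro mult_left_mono) auto
    finally have "\<bar>g ?tK - c * vol ?tK\<bar> \<le> t ^ DIM('a) * (2 * D * ?\<mu>)" by (simp add: mult_ac)
    moreover have "g ?tK - c * vol ?tK = t ^ DIM('a) * (g ?tK / t ^ DIM('a) - c * vol K)"
      using t by (simp add: v right_diff_distrib)
    ultimately have "t ^ DIM('a) * \<bar>g ?tK / t ^ DIM('a) - c * vol K\<bar> \<le> t ^ DIM('a) * (2 * D * ?\<mu>)"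
      using t by (simp add: abs_mult)
    then show ?thesis using t by simp
  qed
  show ?thesis
  \<comment> \<open>Since f(m K) = g((m/s) K), passing back from \<open>g\<close> to
    \<open>f\<close> costs the factor s^n.\<close>
  proof (rule that[of "c / s ^ DIM('a)"])
    fix K :: "'a set" assume K: "convex_body K"
    let ?F = "\<lambda>m. f ((*\<^sub>R) (real m) ` K) / real m ^ DIM('a)"
    let ?\<mu> = "\<lambda>d. measure lebesgue (nbhd (frontier K) d)"
    have fr: "compact (frontier K)" "negligible (frontier K)"
      using K by (simp_all add: convex_body_def compact_frontier negligible_convex_frontier)
    have "filterlim (\<lambda>m. real DIM('a) / (real m / s)) (at_right 0) sequentially"
    proof (rule tendsto_imp_filterlim_at_right)
      have "(\<lambda>m. (real DIM('a) * s) * inverse (real m)) \<longlonglongrightarrow> (real DIM('a) * s) * 0"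
        by (intro tendsto_intros LIMSEQ_inverse_real_of_nat[THEN LIMSEQ_imp_Suc] lim_inverse_n)
      then show "(\<lambda>m. real DIM('a) / (real m / s)) \<longlonglongrightarrow> 0" by (simp add: field_simps)
      show "\<forall>\<^sub>F m in sequentially. 0 < real DIM('a) / (real m / s)"
        using eventually_gt_at_top[of 0] by eventually_elim (use s in simp)
    qed
    then have \<mu>: "(\<lambda>m. ?\<mu> (real DIM('a) / (real m / s))) \<longlonglongrightarrow> 0"
      by (rule filterlim_compose[OF nbhd_measure_tendsto_0[OF fr]])
    have "(\<lambda>m. g ((*\<^sub>R) (real m / s) ` K) / (real m / s) ^ DIM('a) - c * vol K) \<longlonglongrightarrow> 0"
    proof (rule Lim_null_comparison)
      show "\<forall>\<^sub>F m in sequentially. norm (g ((*\<^sub>R) (real m / s) ` K) / (real m / s) ^ DIM('a) - c * vol K)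
         \<le> 2 * D * ?\<mu> (real DIM('a) / (real m / s))"
        using eventually_gt_at_top[of 0]
        proof eventually_elim
          case (elim m)
          then show ?case using est[OF K, of "real m / s"] s by (simp only: real_norm_def) simp
        qed
      show "(\<lambda>m. 2 * D * ?\<mu> (real DIM('a) / (real m / s))) \<longlonglongrightarrow> 0"
        using tendsto_mult_left[OF \<mu>, of "2 * D"] by simp
    qed
    then have "(\<lambda>m. (g ((*\<^sub>R) (real m / s) ` K) / (real m / s) ^ DIM('a)) / s ^ DIM('a)) \<longlonglongrightarrow> c * vol K / s ^ DIM('a)"
      by (intro tendsto_divide tendsto_const) (auto simp: LIM_zero_iff s less_imp_neq[OF s(1), symmetric])
    moreover have "(g ((*\<^sub>R) (real m / s) ` K) / (real m / s) ^ DIM('a)) / s ^ DIM('a) = ?F m" for m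
      using s(1) by (simp add: g_def image_image power_divide)
    ultimately show "?F \<longlonglongrightarrow> c / s ^ DIM('a) * vol K" by simp
  qed
qed

subsection \<open>The homogeneous decomposition\<close>

definition homog :: "nat \<Rightarrow> ('a::euclidean_space set \<Rightarrow> real) \<Rightarrow> bool" where
  "homog j f \<longleftrightarrow> (\<forall>K r. convex_body K \<and> r > 0 \<longrightarrow> f ((*\<^sub>R) r ` K) = r ^ j * f K)"

text \<open>Integer factors give rational ones by scaling up and down, and continuity of r -> f(r K)
  gives the real ones.\<close>

lemma homogI_nat:
  fixes f :: "'a::euclidean_space set \<Rightarrow> real"
  assumes f: "real_val f" and h: "\<And>K m. convex_body K \<Longrightarrow> m \<ge> 1 \<Longrightarrow> f ((*\<^sub>R) (real m) ` K) = real m ^ k * f K"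
  shows "homog k f"
  unfolding homog_def
proof (intro allI impI)
  fix K :: "'a set" and r :: real assume *: "convex_body K \<and> r > 0"
  then have K: "convex_body K" and r: "r > 0" by auto
  have rat: "f ((*\<^sub>R) (real p / real q) ` K) = (real p / real q) ^ k * f K" if "p \<ge> 1" "q \<ge> 1" for p q
  proof -
    have "f ((*\<^sub>R) (real q) ` (*\<^sub>R) (real p / real q) ` K) = real q ^ k * f ((*\<^sub>R) (real p / real q) ` K)"
      by (rule h) (use K that in \<open>auto simp: convex_body_scale\<close>)
    moreover have "(*\<^sub>R) (real q) ` (*\<^sub>R) (real p / real q) ` K = (*\<^sub>R) (real p) ` K"
      using that by (simp add: image_image)
    ultimately have "real q ^ k * f ((*\<^sub>R) (real p / real q) ` K) = real p ^ k * f K" using h[OF K that(1)] by simp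
    then show ?thesis using that by (simp add: power_divide field_simps)
  qed
  \<comment> \<open>Rounding up keeps the numerators positive, as \<open>rat\<close>
    requires.\<close>
  define p where "p i = nat \<lceil>r * real (Suc i)\<rceil>" for i
  define s where "s i = real (p i) / real (Suc i)" for i
  have p: "real (p i) \<ge> r * real (Suc i)" "real (p i) \<le> r * real (Suc i) + 1" for i
  proof -
    have "r * real (Suc i) > 0" using r by simp
    then show "real (p i) \<ge> r * real (Suc i)" "real (p i) \<le> r * real (Suc i) + 1"
      unfolding p_def using ceiling_correct[of "r * real (Suc i)"] by linarith+
  qed
  have "r * real (Suc i) > 0" for i using r by simp
  then have p1: "p i \<ge> 1" for i using p(1)[of i]
    by (metis Suc_leI One_nat_def less_le_trans of_nat_0_less_iff)
  have s_lim: "s \<longlonglongrightarrow> r"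
  proof (rule tendsto_sandwich[OF _ _ tendsto_const])
    show "\<forall>\<^sub>F i in sequentially. r \<le> s i"
      using p(1) by (intro always_eventually) (simp add: s_def pos_le_divide_eq del: of_nat_Suc)
    have "s i \<le> r + 1 / real (Suc i)" for i
    proof -
      have "s i \<le> (r * real (Suc i) + 1) / real (Suc i)"
        unfolding s_def by (intro divide_right_mono p) simp
      then show ?thesis by (simp add: add_divide_distrib del: of_nat_Suc)
    qed
    then show "\<forall>\<^sub>F i in sequentially. s i \<le> r + 1 / real (Suc i)" by (intro always_eventually) blast
    have "(\<lambda>i. r + 1 / real (Suc i)) \<longlonglongrightarrow> r + 0"
      by (intro tendsto_add tendsto_const LIMSEQ_Suc[OF lim_1_over_n])
    then show "(\<lambda>i. r + 1 / real (Suc i)) \<longlonglongrightarrow> r" by simp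
  qed
  have "isCont (\<lambda>r. f ((*\<^sub>R) r ` K)) r" unfolding isCont_def by (rule real_val_scale_tendsto[OF f K])
  then have "(\<lambda>i. f ((*\<^sub>R) (s i) ` K)) \<longlonglongrightarrow> f ((*\<^sub>R) r ` K)" using s_lim by (rule isCont_tendsto_compose)
  moreover have "(\<lambda>i. f ((*\<^sub>R) (s i) ` K)) = (\<lambda>i. s i ^ k * f K)"
  proof
    fix i show "f ((*\<^sub>R) (s i) ` K) = s i ^ k * f K" unfolding s_def by (rule rat[OF p1]) simp
  qed
  moreover have "(\<lambda>i. s i ^ k * f K) \<longlonglongrightarrow> r ^ k * f K" by (intro tendsto_intros s_lim)
  ultimately show "f ((*\<^sub>R) r ` K) = r ^ k * f K" using LIMSEQ_unique by metis
qed

lemma nat_poly_coeffs_eq: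
  fixes a b :: "nat \<Rightarrow> real"
  assumes "\<And>m::nat. m \<ge> 1 \<Longrightarrow> (\<Sum>j\<le>k. a j * real m ^ j) = (\<Sum>j\<le>k. b j * real m ^ j)" and "j \<le> k"
  shows "a j = b j"
proof (rule ccontr)
  assume ne: "a j \<noteq> b j"
  have "finite {x. (\<Sum>i\<le>k. (a i - b i) * x ^ i) = 0} \<longleftrightarrow> (\<exists>i\<le>k. a i - b i \<noteq> 0)"
    by (rule polyfun_finite_roots)
  then have "finite {x. (\<Sum>i\<le>k. (a i - b i) * x ^ i) = 0}" using ne assms(2) by auto
  moreover have "real ` {1..} \<subseteq> {x. (\<Sum>i\<le>k. (a i - b i) * x ^ i) = 0}"
    using assms(1) by (auto simp: left_diff_distrib sum_subtractf)
  ultimately have "finite (real ` {1..})" by (rule rev_finite_subset)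
  then show False using infinite_Ici[of "1::nat"] by (simp add: finite_image_iff inj_on_def)
qed

text \<open>The combination f(2 K) - 2^(k+1) f(K) kills degree k+1 and multiplies the part of degree
  j by 2^j - 2^(k+1), which is nonzero for j at most k. The induction hypothesis thus yields the
  lower parts up to known factors, and what is left of \<open>f\<close> has degree k+1. Obtained as
  linear combinations of scaled copies of \<open>f\<close>, the parts inherit all properties of a
  valuation.\<close>

lemma homog_decomposition_aux:
  fixes f :: "'a::euclidean_space set \<Rightarrow> real"
  assumes "real_val f" and "\<And>K. convex_body K \<Longrightarrow> \<exists>a. \<forall>m\<ge>1. f ((*\<^sub>R) (real m) ` K) = (\<Sum>j\<le>k. a j * real m ^ j)"
  shows "\<exists>g. (\<forall>j\<le>k. real_val (g j) \<and> homog j (g j)) \<and> (\<forall>K. convex_body K \<longrightarrow> f K = (\<Sum>j\<le>k. g j K))"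
  using assms
proof (induction k arbitrary: f)
  case 0
  have "homog 0 f"
  proof (rule homogI_nat[OF 0(1)])
    fix K :: "'a set" and m :: nat assume K: "convex_body K" "m \<ge> 1"
    obtain a where a: "\<forall>m\<ge>1. f ((*\<^sub>R) (real m) ` K) = (\<Sum>j\<le>0. a j * real m ^ j)" using 0(2)[OF K(1)] by blast
    have "f ((*\<^sub>R) (real m) ` K) = a 0" using a K(2) by simp
    moreover have "f ((*\<^sub>R) (real 1) ` K) = a 0" using a[rule_format, of 1] by simp
    ultimately show "f ((*\<^sub>R) (real m) ` K) = real m ^ 0 * f K" by simp
  qed
  then show ?case using 0(1) by (intro exI[of _ "\<lambda>_. f"]) simp
next
  case (Suc k)
  define c :: "nat \<Rightarrow> real" where "c j = 2 ^ j - 2 ^ Suc k" for j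
  have c0: "c j \<noteq> 0" if "j \<le> k" for j using that by (simp add: c_def power_inject_exp del: power_Suc)
  define \<psi> where "\<psi> K = f ((*\<^sub>R) 2 ` K) - 2 ^ Suc k * f K" for K
  have \<psi>: "real_val \<psi>" unfolding \<psi>_def
    by (intro real_val_diff real_val_scale real_val_cmult Suc.prems(1)) simp
  have \<psi>m: "\<psi> ((*\<^sub>R) (real m) ` K) = (\<Sum>j\<le>k. (c j * a j) * real m ^ j)"
    if "\<forall>m\<ge>1. f ((*\<^sub>R) (real m) ` K) = (\<Sum>j\<le>Suc k. a j * real m ^ j)" "m \<ge> 1" for K a m
  proof -
    have 2: "(*\<^sub>R) 2 ` (*\<^sub>R) (real m) ` K = (*\<^sub>R) (real (2 * m)) ` K" by (simp add: image_image)
    have "\<psi> ((*\<^sub>R) (real m) ` K) = (\<Sum>j\<le>Suc k. a j * real (2 * m) ^ j) - 2 ^ Suc k * (\<Sum>j\<le>Suc k. a j * real m ^ j)"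
      unfolding \<psi>_def 2 using that(1)[rule_format, of m] that(1)[rule_format, of "2 * m"] that(2) by simp
    also have "\<dots> = (\<Sum>j\<le>Suc k. (c j * a j) * real m ^ j)"
      unfolding sum_distrib_left sum_subtractf[symmetric]
      by (intro sum.cong refl) (simp add: c_def power_mult_distrib algebra_simps)
    also have "\<dots> = (\<Sum>j\<le>k. (c j * a j) * real m ^ j)" by (simp add: c_def)
    finally show ?thesis .
  qed
  have "\<exists>h. (\<forall>j\<le>k. real_val (h j) \<and> homog j (h j)) \<and> (\<forall>K. convex_body K \<longrightarrow> \<psi> K = (\<Sum>j\<le>k. h j K))"
  proof (rule Suc.IH[OF \<psi>])
    fix K :: "'a set" assume K: "convex_body K"
    obtain a where a: "\<forall>m\<ge>1. f ((*\<^sub>R) (real m) ` K) = (\<Sum>j\<le>Suc k. a j * real m ^ j)" using Suc.prems(2)[OF K] by blast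
    show "\<exists>a. \<forall>m\<ge>1. \<psi> ((*\<^sub>R) (real m) ` K) = (\<Sum>j\<le>k. a j * real m ^ j)"
      by (rule exI[of _ "\<lambda>j. c j * a j"]) (use \<psi>m[OF a] in blast)
  qed
  then obtain h where h: "\<And>j. j \<le> k \<Longrightarrow> real_val (h j)" "\<And>j. j \<le> k \<Longrightarrow> homog j (h j)"
    "\<And>K. convex_body K \<Longrightarrow> \<psi> K = (\<Sum>j\<le>k. h j K)" by blast
  define g where "g j = (if j \<le> k then (\<lambda>K. h j K / c j) else (\<lambda>K. f K - (\<Sum>i\<le>k. h i K / c i)))" for j
  have g1: "real_val (g j)" for j
    unfolding g_def using h(1) Suc.prems(1) by (auto intro!: real_val_diff real_val_divide real_val_sum)
  have g2: "homog j (g j)" if "j \<le> k" for j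
    using h(2)[OF that] that unfolding homog_def g_def by simp
  have g3: "homog (Suc k) (g (Suc k))"
  proof (rule homogI_nat[OF g1])
    fix K :: "'a set" and m :: nat assume K: "convex_body K" "m \<ge> 1"
    obtain a where a: "\<forall>m\<ge>1. f ((*\<^sub>R) (real m) ` K) = (\<Sum>j\<le>Suc k. a j * real m ^ j)" using Suc.prems(2)[OF K(1)] by blast
    have hm: "h j ((*\<^sub>R) (real m) ` K) = h j K * real m ^ j" if "m \<ge> 1" "j \<le> k" for m j
      using h(2)[OF that(2)] K(1) that(1) unfolding homog_def by simp
    \<comment> \<open>Comparing coefficients in m identifies the components supplied by the
      induction with the coefficients of the polynomial f(m K).\<close>
    have ha: "h j K = c j * a j" if "j \<le> k" for j
    proof (rule nat_poly_coeffs_eq[OF _ that])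
      fix m :: nat assume m: "m \<ge> 1"
      have "(\<Sum>j\<le>k. h j K * real m ^ j) = \<psi> ((*\<^sub>R) (real m) ` K)"
        using h(3)[OF convex_body_scale[OF K(1)], of "real m"] hm[OF m] by simp
      then show "(\<Sum>j\<le>k. h j K * real m ^ j) = (\<Sum>j\<le>k. c j * a j * real m ^ j)" using \<psi>m[OF a m] by simp
    qed
    have *: "g (Suc k) ((*\<^sub>R) (real m) ` K) = a (Suc k) * real m ^ Suc k" if m: "m \<ge> 1" for m
    proof -
      have "(\<Sum>i\<le>k. h i ((*\<^sub>R) (real m) ` K) / c i) = (\<Sum>i\<le>k. a i * real m ^ i)"
        by (intro sum.cong refl) (use hm[OF m] ha c0 in simp)
      then show ?thesis using a m by (simp add: g_def)
    qed
    have "g (Suc k) K = a (Suc k)" using *[of 1] by simp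
    then show "g (Suc k) ((*\<^sub>R) (real m) ` K) = real m ^ Suc k * g (Suc k) K" using *[OF K(2)] by simp
  qed
  have "f K = (\<Sum>j\<le>Suc k. g j K)" for K by (simp add: g_def)
  then show ?case using g1 g2 g3 by (intro exI[of _ g]) (auto simp: le_Suc_eq)
qed

text \<open>Otherwise F(m) divided by m^(degree p) would tend both to 0 and to the leading
  coefficient.\<close>

lemma nat_poly_degree_le:
  assumes F: "\<And>m::nat. m \<ge> 1 \<Longrightarrow> F m = poly p (real m)" and lim: "(\<lambda>m. F m / real m ^ n) \<longlonglongrightarrow> L"
  shows "degree p \<le> n"
proof (rule ccontr)
  assume "\<not> degree p \<le> n"
  then have d: "degree p > n" by simp
  have "(\<lambda>m. (F m / real m ^ n) * (1 / real m) ^ (degree p - n)) \<longlonglongrightarrow> L * 0 ^ (degree p - n)"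
    by (intro tendsto_intros lim lim_1_over_n)
  then have "(\<lambda>m. (F m / real m ^ n) * (1 / real m) ^ (degree p - n)) \<longlonglongrightarrow> 0" using d by (simp add: power_0_left)
  moreover have "\<forall>\<^sub>F m in sequentially. (F m / real m ^ n) * (1 / real m) ^ (degree p - n) = poly p (real m) / real m ^ degree p"
    using eventually_ge_at_top[of 1]
  proof eventually_elim
    case (elim m)
    have "real m ^ degree p = real m ^ n * real m ^ (degree p - n)" using d by (simp add: power_add[symmetric])
    then show ?case using F[OF elim] by (simp add: power_one_over)
  qed
  ultimately have l0: "(\<lambda>m. poly p (real m) / real m ^ degree p) \<longlonglongrightarrow> 0" by (rule Lim_transform_eventually)
  have "(\<lambda>m. \<Sum>i\<le>degree p. coeff p i * (1 / real m) ^ (degree p - i)) \<longlonglongrightarrow> (\<Sum>i\<le>degree p. coeff p i * 0 ^ (degree p - i))"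
    by (intro tendsto_intros lim_1_over_n)
  moreover have "\<forall>\<^sub>F m in sequentially. (\<Sum>i\<le>degree p. coeff p i * (1 / real m) ^ (degree p - i)) = poly p (real m) / real m ^ degree p"
    using eventually_ge_at_top[of 1]
  proof eventually_elim
    case (elim m)
    have "coeff p i * (1 / real m) ^ (degree p - i) = coeff p i * real m ^ i / real m ^ degree p" if "i \<le> degree p" for i
    proof -
      have "real m ^ degree p = real m ^ i * real m ^ (degree p - i)" using that by (simp add: power_add[symmetric])
      then show ?thesis using elim by (simp add: power_one_over)
    qed
    then show ?case unfolding poly_altdef sum_divide_distrib by (intro sum.cong) auto
  qed
  ultimately have "(\<lambda>m. poly p (real m) / real m ^ degree p) \<longlonglongrightarrow> (\<Sum>i\<le>degree p. coeff p i * 0 ^ (degree p - i))"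
    by (rule Lim_transform_eventually)
  moreover have "(\<Sum>i\<le>degree p. coeff p i * 0 ^ (degree p - i)) = (\<Sum>i\<in>{degree p}. coeff p i * 0 ^ (degree p - i))"
    by (rule sum.mono_neutral_right) (auto simp: power_0_left)
  ultimately have l1: "(\<lambda>m. poly p (real m) / real m ^ degree p) \<longlonglongrightarrow> lead_coeff p" by simp
  have "lead_coeff p = 0" by (rule LIMSEQ_unique[OF l1 l0])
  then show False using d by auto
qed

lemma poly_sum_upto: "degree p \<le> n \<Longrightarrow> poly p x = (\<Sum>j\<le>n. coeff p j * x ^ j)" for x :: real
  unfolding poly_altdef by (rule sum.mono_neutral_left) (auto simp: coeff_eq_0)

lemma fdiff_sum: "fdiff k (\<lambda>r. \<Sum>j\<in>J. c j * F j r) r = (\<Sum>j\<in>J. c j * fdiff k (F j) r)"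
  by (induction k arbitrary: r) (simp_all add: sum_subtractf right_diff_distrib)

lemma fdiff_power: "j < k \<Longrightarrow> fdiff k (\<lambda>r. real r ^ j) r = 0"
proof (induction k arbitrary: j)
  case (Suc k)
  have "(\<lambda>r. real (Suc r) ^ j - real r ^ j) = (\<lambda>r. \<Sum>i\<in>{..<j}. real (j choose i) * real r ^ i)"
  proof
    fix r
    have "real (Suc r) ^ j = (real r + 1) ^ j" by (simp add: add.commute)
    also have "\<dots> = (\<Sum>i\<le>j. real (j choose i) * real r ^ i)" by (subst binomial_ring) simp
    also have "\<dots> = (\<Sum>i<j. real (j choose i) * real r ^ i) + real r ^ j" by (simp add: lessThan_Suc_atMost[symmetric])
    finally show "real (Suc r) ^ j - real r ^ j = (\<Sum>i\<in>{..<j}. real (j choose i) * real r ^ i)" by simp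
  qed
  then have "fdiff (Suc k) (\<lambda>r. real r ^ j) r = (\<Sum>i\<in>{..<j}. real (j choose i) * fdiff k (\<lambda>r. real r ^ i) r)"
    by (simp only: fdiff_shift fdiff_sum)
  also have "\<dots> = 0" using Suc by (intro sum.neutral) auto
  finally show ?case .
qed simp

lemma fdiff_tendsto: "(\<And>r. r \<ge> r0 \<Longrightarrow> (\<lambda>i. F i r) \<longlonglongrightarrow> G r) \<Longrightarrow> r \<ge> r0 \<Longrightarrow> (\<lambda>i. fdiff k (F i) r) \<longlonglongrightarrow> fdiff k G r"
  by (induction k arbitrary: r) (auto intro!: tendsto_diff)

lemma fdiff_cong: "(\<And>s. s \<ge> r \<Longrightarrow> F s = G s) \<Longrightarrow> fdiff k F r = fdiff k G r"
  by (induction k arbitrary: r) auto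

text \<open>The order of the difference that vanishes on a polytope depends on its number of
  vertices, which is unbounded along an approximation of \<open>K\<close>. The growth rate m^n caps
  the degree at the dimension, so the difference of order n+1 vanishes on all polytopes and, by
  continuity, on \<open>K\<close>.\<close>

lemma real_val_nat_poly:
  fixes f :: "'a::euclidean_space set \<Rightarrow> real"
  assumes f: "real_val f" and K: "convex_body K"
  shows "\<exists>a. \<forall>m\<ge>1. f ((*\<^sub>R) (real m) ` K) = (\<Sum>j\<le>DIM('a). a j * real m ^ j)"
proof -
  obtain c where c: "\<And>K. convex_body K \<Longrightarrow> (\<lambda>m. f ((*\<^sub>R) (real m) ` K) / real m ^ DIM('a)) \<longlonglongrightarrow> c * vol K"
    using real_val_asymptotics[OF f] by blast
  let ?n = "DIM('a)"
  have hull: "fdiff (Suc ?n) (\<lambda>m. f ((*\<^sub>R) (real m) ` (convex hull V))) r = 0" if V: "finite V" "V \<noteq> {}" and "r \<ge> 1" for V r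
  proof -
    obtain p where p: "\<And>m. m \<ge> 1 \<Longrightarrow> f ((*\<^sub>R) (real m) ` (convex hull V)) = poly p (real m)"
      using polytope_poly[OF f V] by blast
    have "degree p \<le> ?n" by (rule nat_poly_degree_le[OF p c[OF convex_body_hull[OF V]]])
    then have "f ((*\<^sub>R) (real m) ` (convex hull V)) = (\<Sum>j\<le>?n. coeff p j * real m ^ j)" if "m \<ge> 1" for m
      using p[OF that] poly_sum_upto by simp
    then have "fdiff (Suc ?n) (\<lambda>m. f ((*\<^sub>R) (real m) ` (convex hull V))) r
       = fdiff (Suc ?n) (\<lambda>m. \<Sum>j\<in>{..?n}. coeff p j * real m ^ j) r" using \<open>r \<ge> 1\<close> by (intro fdiff_cong) auto
    also have "\<dots> = 0" unfolding fdiff_sum by (intro sum.neutral) (simp add: fdiff_power del: fdiff.simps)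
    finally show ?thesis .
  qed
  obtain V where V: "\<And>i. finite (V i)" "\<And>i. V i \<noteq> {}" "\<And>i. V i \<subseteq> K" "(\<lambda>i::nat. hausdist K (convex hull V i)) \<longlonglongrightarrow> 0"
    using hull_sequence[OF K] by blast
  have body: "convex_body (convex hull V i)" for i using V convex_body_hull by blast
  have lim: "(\<lambda>i. f ((*\<^sub>R) (real m) ` (convex hull V i))) \<longlonglongrightarrow> f ((*\<^sub>R) (real m) ` K)" if "m \<ge> 1" for m
    using real_val_tendsto[OF real_val_scale[OF f] K _ V(4), of "real m"] body that by simp
  have zero: "fdiff (Suc ?n) (\<lambda>m. f ((*\<^sub>R) (real m) ` K)) r = 0" if "r \<ge> 1" for r
  proof -
    have "(\<lambda>i. fdiff (Suc ?n) (\<lambda>m. f ((*\<^sub>R) (real m) ` (convex hull V i))) r) \<longlonglongrightarrow> fdiff (Suc ?n) (\<lambda>m. f ((*\<^sub>R) (real m) ` K)) r"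
      by (rule fdiff_tendsto[of 1]) (use lim that in auto)
    then have "(\<lambda>i::nat. 0) \<longlonglongrightarrow> fdiff (Suc ?n) (\<lambda>m. f ((*\<^sub>R) (real m) ` K)) r"
      by (simp only: hull[OF V(1,2) that])
    then show ?thesis by (simp only: LIMSEQ_const_iff)
  qed
  have "\<exists>p. \<forall>r. f ((*\<^sub>R) (real (Suc r)) ` K) = poly p (real r)"
    by (rule fdiff_zero_imp_poly[of "Suc ?n"]) (use zero fdiff_Suc_arg[of "Suc ?n" "\<lambda>r. f ((*\<^sub>R) (real r) ` K)"] in \<open>simp del: fdiff.simps\<close>)
  then obtain p where p: "\<And>r. f ((*\<^sub>R) (real (Suc r)) ` K) = poly p (real r)" by blast
  let ?q = "pcompose p [:-1, 1:]"
  have q: "f ((*\<^sub>R) (real m) ` K) = poly ?q (real m)" if "m \<ge> 1" for m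
    using p[of "m - 1"] that by (simp add: poly_pcompose of_nat_diff)
  have "degree ?q \<le> ?n" by (rule nat_poly_degree_le[OF q c[OF K]])
  then have "\<forall>m\<ge>1. f ((*\<^sub>R) (real m) ` K) = (\<Sum>j\<le>?n. coeff ?q j * real m ^ j)" using q poly_sum_upto by simp
  then show ?thesis by blast
qed

text \<open>McMullen's decomposition, with Hadwiger's description of the component of top degree.\<close>
theorem homog_decomposition:
  fixes f :: "'a::euclidean_space set \<Rightarrow> real"
  assumes f: "real_val f"
  shows "\<exists>g c. (\<forall>j\<le>DIM('a). real_val (g j) \<and> homog j (g j)) \<and>
    (\<forall>K. convex_body K \<longrightarrow> f K = (\<Sum>j\<le>DIM('a). g j K) \<and> g 0 K = f {0} \<and> g DIM('a) K = c * vol K \<and>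
      (\<lambda>m. f ((*\<^sub>R) (real m) ` K) / real m ^ DIM('a)) \<longlonglongrightarrow> c * vol K)"
proof -
  let ?n = "DIM('a)"
  obtain g where g: "\<And>j. j \<le> ?n \<Longrightarrow> real_val (g j)" "\<And>j. j \<le> ?n \<Longrightarrow> homog j (g j)"
    "\<And>K. convex_body K \<Longrightarrow> f K = (\<Sum>j\<le>?n. g j K)"
    using homog_decomposition_aux[OF f real_val_nat_poly[OF f]] by blast
  obtain c where c: "\<And>K. convex_body K \<Longrightarrow> (\<lambda>m. f ((*\<^sub>R) (real m) ` K) / real m ^ ?n) \<longlonglongrightarrow> c * vol K"
    using real_val_asymptotics[OF f] by blast
  have gj: "g j ((*\<^sub>R) r ` K) = r ^ j * g j K" if "j \<le> ?n" "convex_body K" "r > 0" for j K r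
    using g(2)[OF that(1)] that unfolding homog_def by blast
  have g0: "g j {0} = 0" if "j \<le> ?n" "j \<ge> 1" for j
  proof -
    have "g j {0} = 2 ^ j * g j {0}" using gj[OF that(1), of "{0}" 2] by simp
    moreover have "(1::real) < 2 ^ j" by (rule one_less_power) (use that(2) in auto)
    then have "2 ^ j \<noteq> (1::real)" by linarith
    ultimately show ?thesis by simp
  qed
  have "f {0} = (\<Sum>j\<le>?n. g j {0})" by (rule g(3)) simp
  also have "\<dots> = (\<Sum>j\<in>{0}. g j {0})" by (rule sum.mono_neutral_right) (use g0 in auto)
  finally have f0: "f {0} = g 0 {0}" by simp
  \<comment> \<open>The part of degree 0 is constant along r K with r > 0, and r K shrinks to
    {0}.\<close>
  have 1: "g 0 K = f {0}" if K: "convex_body K" for K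
  proof -
    have "((\<lambda>r. g 0 ((*\<^sub>R) r ` K)) \<longlongrightarrow> g 0 ((*\<^sub>R) 0 ` K)) (at_right 0)"
      by (rule real_val_scale_tendsto[OF g(1) K]) simp
    moreover have "(*\<^sub>R) 0 ` K = {0}" using K by (auto simp: convex_body_def)
    ultimately have "((\<lambda>r. g 0 ((*\<^sub>R) r ` K)) \<longlongrightarrow> g 0 {0}) (at_right 0)" by simp
    moreover have "((\<lambda>r. g 0 ((*\<^sub>R) r ` K)) \<longlongrightarrow> g 0 K) (at_right 0)"
      by (rule tendsto_eventually) (use gj[OF _ K] in \<open>auto simp: eventually_at_right_field intro!: exI[of _ 1]\<close>)
    ultimately have "g 0 {0} = g 0 K" by (rule tendsto_unique[OF trivial_limit_at_right_real])
    then show ?thesis using f0 by simp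
  qed
  \<comment> \<open>Division by m^n isolates the top part in the limit, which the asymptotics
    identify as a multiple of volume.\<close>
  have 2: "g ?n K = c * vol K" if K: "convex_body K" for K
  proof -
    have "(\<lambda>m. \<Sum>j\<le>?n. g j K * (1 / real m) ^ (?n - j)) \<longlonglongrightarrow> (\<Sum>j\<le>?n. g j K * 0 ^ (?n - j))"
      by (intro tendsto_intros lim_1_over_n)
    moreover have "(\<Sum>j\<le>?n. g j K * 0 ^ (?n - j)) = (\<Sum>j\<in>{?n}. g j K * 0 ^ (?n - j))"
      by (rule sum.mono_neutral_right) (auto simp: power_0_left)
    ultimately have "(\<lambda>m. \<Sum>j\<le>?n. g j K * (1 / real m) ^ (?n - j)) \<longlonglongrightarrow> g ?n K" by simp
    moreover have "\<forall>\<^sub>F m in sequentially. (\<Sum>j\<le>?n. g j K * (1 / real m) ^ (?n - j)) = f ((*\<^sub>R) (real m) ` K) / real m ^ ?n"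
      using eventually_ge_at_top[of 1]
    proof eventually_elim
      case (elim m)
      have "g j K * (1 / real m) ^ (?n - j) = g j ((*\<^sub>R) (real m) ` K) / real m ^ ?n" if "j \<le> ?n" for j
      proof -
        have "real m ^ ?n = real m ^ j * real m ^ (?n - j)" using that by (simp add: power_add[symmetric])
        then show ?thesis using elim gj[OF that K, of "real m"] by (simp add: power_one_over)
      qed
      then show ?case unfolding g(3)[OF convex_body_scale[OF K]] sum_divide_distrib by (intro sum.cong) auto
    qed
    ultimately have "(\<lambda>m. f ((*\<^sub>R) (real m) ` K) / real m ^ ?n) \<longlonglongrightarrow> g ?n K" by (rule Lim_transform_eventually)
    then show ?thesis using c[OF K] LIMSEQ_unique by blast
  qed
  show ?thesis using g 1 2 c by (intro exI[of _ g] exI[of _ c]) simp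
qed

subsection \<open>Parallelepipeds\<close>

fun para :: "'a::euclidean_space list \<Rightarrow> 'a set" where
  "para [] = {0}"
| "para (v # vs) = msum (para vs) (closed_segment 0 v)"

definition indep :: "'a::euclidean_space list \<Rightarrow> bool" where
  "indep vs \<longleftrightarrow> distinct vs \<and> independent (set vs)"

lemma convex_body_para [simp]: "convex_body (para vs)"
  by (induction vs) (auto intro: convex_body_msum)

lemma para_span: "para vs \<subseteq> span (set vs)"
proof (induction vs)
  case (Cons v vs)
  have "x + y \<in> span (set (v # vs))" if "x \<in> para vs" "y \<in> closed_segment 0 v" for x y
  proof -
    have "x \<in> span (set (v # vs))" using Cons that(1) span_mono[of "set vs" "set (v # vs)"] by auto
    moreover have "y \<in> span (set (v # vs))" using that(2) by (auto simp: in_segment intro: span_scale span_base)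
    ultimately show ?thesis by (rule span_add)
  qed
  then show ?case unfolding para.simps msum_def by blast
qed (simp add: span_zero)

lemma zero_in_para: "0 \<in> para vs"
  by (induction vs) (auto simp: msum_def intro: exI[of _ 0])

lemma para_swap: "para (v # w # vs) = para (w # v # vs)"
  by (simp add: msum_assoc msum_commute[of "closed_segment 0 w"])

lemma scale_segment: "(*\<^sub>R) r ` closed_segment 0 v = closed_segment 0 (r *\<^sub>R v)"
  using closed_segment_linear_image[of "(*\<^sub>R) r" 0 v] by simp

lemma scale_para: "(*\<^sub>R) r ` para vs = para (map ((*\<^sub>R) r) vs)"
  by (induction vs) (simp_all add: scale_msum scale_segment)

lemma indep_ConsD:
  assumes "indep (v # vs)"
  shows "indep vs" "v \<notin> span (set vs)"
  using assms by (auto simp: indep_def independent_insert split: if_splits)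

lemma indep_ConsI:
  assumes "indep vs" "v \<notin> span (set vs)"
  shows "indep (v # vs)"
  using assms span_base[of v "set vs"] by (auto simp: indep_def independent_insert)

lemma indep_swap: "indep (v # w # vs) \<Longrightarrow> indep (w # v # vs)"
  by (auto simp: indep_def insert_commute)

lemma indep_scale:
  assumes "indep vs" "r \<noteq> 0"
  shows "indep (map ((*\<^sub>R) r) vs)"
proof -
  have inj: "inj ((*\<^sub>R) r :: 'a \<Rightarrow> 'a)" using assms(2) by (simp add: inj_on_def)
  have "independent ((*\<^sub>R) r ` set vs)"
    using assms(1) inj by (intro linear_independent_injective_image) (auto simp: indep_def intro: inj_on_subset)
  then show ?thesis using assms(1) inj by (simp add: indep_def distinct_map inj_on_def)
qed

lemma indep_length: "indep vs \<Longrightarrow> length vs \<le> DIM('a)" for vs :: "'a::euclidean_space list"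
  using independent_bound[of "set vs"] distinct_card[of vs] by (auto simp: indep_def)

lemma indep_extend:
  fixes vs :: "'a::euclidean_space list"
  assumes "indep vs" "length vs < DIM('a)"
  obtains x where "indep (x # vs)"
proof -
  have "dim (set vs) < DIM('a)"
    using dim_eq_card_independent[of "set vs"] assms distinct_card[of vs] by (auto simp: indep_def)
  then have "span (set vs) \<noteq> UNIV" by (metis dim_UNIV dim_span less_irrefl)
  then obtain x where "x \<notin> span (set vs)" by blast
  then show ?thesis using indep_ConsI[OF assms(1)] that by blast
qed

lemma mem_msum_segment:
  assumes "l \<ge> 0"
  shows "x \<in> msum F (closed_segment 0 (l *\<^sub>R v)) \<longleftrightarrow> (\<exists>y\<in>F. \<exists>s\<in>{0..l}. x = y + s *\<^sub>R v)"
proof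
  assume "x \<in> msum F (closed_segment 0 (l *\<^sub>R v))"
  then obtain y u where "y \<in> F" "0 \<le> u" "u \<le> 1" "x = y + (u * l) *\<^sub>R v"
    unfolding msum_def in_segment by auto
  moreover have "u * l \<in> {0..l}" using assms \<open>0 \<le> u\<close> \<open>u \<le> 1\<close> by (simp add: mult_left_le_one_le)
  ultimately show "\<exists>y\<in>F. \<exists>s\<in>{0..l}. x = y + s *\<^sub>R v" by blast
next
  assume "\<exists>y\<in>F. \<exists>s\<in>{0..l}. x = y + s *\<^sub>R v"
  then obtain y s where ys: "y \<in> F" "0 \<le> s" "s \<le> l" "x = y + s *\<^sub>R v" by auto
  have "s *\<^sub>R v \<in> closed_segment 0 (l *\<^sub>R v)"
  proof (cases "l = 0")
    case True
    then show ?thesis using ys by simp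
  next
    case False
    then have "s *\<^sub>R v = (1 - s / l) *\<^sub>R 0 + (s / l) *\<^sub>R (l *\<^sub>R v)" "0 \<le> s / l" "s / l \<le> 1" using assms ys by auto
    then show ?thesis unfolding in_segment by blast
  qed
  then show "x \<in> msum F (closed_segment 0 (l *\<^sub>R v))" using ys unfolding msum_def by blast
qed

lemma additive_bounded_linear:
  fixes h :: "real \<Rightarrow> real"
  assumes add: "\<And>x y. x \<ge> 0 \<Longrightarrow> y \<ge> 0 \<Longrightarrow> h (x + y) = h x + h y"
    and e: "e > 0" and bd: "\<And>x. 0 \<le> x \<Longrightarrow> x \<le> e \<Longrightarrow> \<bar>h x\<bar> \<le> B" and x: "x \<ge> 0"
  shows "h x = x * h 1"
proof -
  \<comment> \<open>Additive with value 0 at 1, hence determined by its values on the unit interval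
    and bounded; a bounded additive function is 0.\<close>
  define r where "r x = h (e * x) - x * h e" for x
  have radd: "r (x + y) = r x + r y" if "x \<ge> 0" "y \<ge> 0" for x y
    using add[of "e * x" "e * y"] that e by (simp add: r_def algebra_simps)
  have r0: "r 0 = 0" using radd[of 0 0] by simp
  have rm: "r (real m * x) = real m * r x" if "x \<ge> 0" for m x
  proof (induction m)
    case (Suc m)
    have "real (Suc m) * x = real m * x + x" by (simp add: algebra_simps)
    then show ?case using radd[of "real m * x" x] that Suc by (simp add: algebra_simps)
  qed (simp add: r0)
  have r1: "r 1 = 0" by (simp add: r_def)
  have bound: "\<bar>r x\<bar> \<le> B + \<bar>h e\<bar>" if "x \<ge> 0" for x
  proof -
    define m where "m = nat \<lfloor>x\<rfloor>"
    have m: "real m \<le> x" "x - real m \<le> 1" unfolding m_def using that by linarith+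
    have "r x = r (real m * 1) + r (x - real m)" using radd[of "real m" "x - real m"] m by simp
    then have rx: "r x = r (x - real m)" using rm[of 1 m] r1 by simp
    have "\<bar>h (e * (x - real m))\<bar> \<le> B" using m e by (intro bd) (auto simp: mult_left_le)
    moreover have "\<bar>(x - real m) * h e\<bar> \<le> \<bar>h e\<bar>" using m by (simp add: abs_mult mult_left_le_one_le)
    ultimately show ?thesis unfolding rx by (simp add: r_def)
  qed
  have rz: "r x = 0" if "x \<ge> 0" for x
  proof -
    have "\<bar>r x\<bar> = 0"
    proof (rule real_archimedian_rdiv_eq_0)
      fix m :: nat assume "0 < m"
      show "real m * \<bar>r x\<bar> \<le> B + \<bar>h e\<bar>"
        using bound[of "real m * x"] rm[OF that, of m] that by (simp add: abs_mult)
    qed simp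
    then show ?thesis by simp
  qed
  have "h x = x / e * h e" using rz[of "x / e"] x e by (simp add: r_def)
  moreover have "h 1 = 1 / e * h e" using rz[of "1 / e"] e by (simp add: r_def)
  ultimately show ?thesis by simp
qed

lemma msum_segment_split:
  assumes "l \<ge> 0" "m \<ge> 0"
  shows "msum F (closed_segment 0 ((l + m) *\<^sub>R v))
    = msum F (closed_segment 0 (l *\<^sub>R v)) \<union> translate (msum F (closed_segment 0 (m *\<^sub>R v))) (l *\<^sub>R v)"
proof -
  have "x \<in> msum F (closed_segment 0 ((l + m) *\<^sub>R v)) \<longleftrightarrow>
    x \<in> msum F (closed_segment 0 (l *\<^sub>R v)) \<or> x \<in> translate (msum F (closed_segment 0 (m *\<^sub>R v))) (l *\<^sub>R v)" for x
  proof
    assume "x \<in> msum F (closed_segment 0 ((l + m) *\<^sub>R v))"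
    then obtain y s where ys: "y \<in> F" "0 \<le> s" "s \<le> l + m" "x = y + s *\<^sub>R v"
      using assms mem_msum_segment[of "l + m" x F v] by auto
    show "x \<in> msum F (closed_segment 0 (l *\<^sub>R v)) \<or> x \<in> translate (msum F (closed_segment 0 (m *\<^sub>R v))) (l *\<^sub>R v)"
    proof (cases "s \<le> l")
      case True
      then show ?thesis using ys mem_msum_segment[OF assms(1)] by force
    next
      case False
      then have "y + (s - l) *\<^sub>R v \<in> msum F (closed_segment 0 (m *\<^sub>R v))"
        using ys unfolding mem_msum_segment[OF assms(2)] by force
      moreover have "x = (y + (s - l) *\<^sub>R v) + l *\<^sub>R v" using ys by (simp add: algebra_simps)
      ultimately show ?thesis unfolding translate_def by blast
    qed
  next
    assume "x \<in> msum F (closed_segment 0 (l *\<^sub>R v)) \<or> x \<in> translate (msum F (closed_segment 0 (m *\<^sub>R v))) (l *\<^sub>R v)"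
    then show "x \<in> msum F (closed_segment 0 ((l + m) *\<^sub>R v))"
    proof
      assume "x \<in> msum F (closed_segment 0 (l *\<^sub>R v))"
      then show ?thesis using assms unfolding mem_msum_segment[OF assms(1)] mem_msum_segment[OF add_nonneg_nonneg[OF assms]]
        by force
    next
      assume "x \<in> translate (msum F (closed_segment 0 (m *\<^sub>R v))) (l *\<^sub>R v)"
      then obtain y s where ys: "y \<in> F" "0 \<le> s" "s \<le> m" "x = (y + s *\<^sub>R v) + l *\<^sub>R v"
        unfolding translate_def using mem_msum_segment[OF assms(2), of _ F v] by auto
      then have "x = y + (l + s) *\<^sub>R v" by (simp add: algebra_simps)
      moreover have "l + s \<in> {0..l + m}" using ys assms by simp
      ultimately show ?thesis using ys(1) unfolding mem_msum_segment[OF add_nonneg_nonneg[OF assms]] by blast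
    qed
  qed
  then show ?thesis by blast
qed

lemma msum_segment_Int:
  assumes "l \<ge> 0" "m \<ge> 0" and F: "\<And>x. x \<in> F \<Longrightarrow> x \<bullet> w = \<beta>" and v: "v \<bullet> w \<noteq> 0"
  shows "msum F (closed_segment 0 (l *\<^sub>R v)) \<inter> translate (msum F (closed_segment 0 (m *\<^sub>R v))) (l *\<^sub>R v) = translate F (l *\<^sub>R v)"
proof (intro equalityI subsetI)
  fix x assume x: "x \<in> msum F (closed_segment 0 (l *\<^sub>R v)) \<inter> translate (msum F (closed_segment 0 (m *\<^sub>R v))) (l *\<^sub>R v)"
  obtain y s where ys: "y \<in> F" "0 \<le> s" "s \<le> l" "x = y + s *\<^sub>R v"
    using x mem_msum_segment[OF assms(1), of x F v] by auto
  obtain z t where zt: "z \<in> F" "0 \<le> t" "t \<le> m" "x = (z + t *\<^sub>R v) + l *\<^sub>R v"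
    using x unfolding translate_def using mem_msum_segment[OF assms(2), of _ F v] by auto
  have "x \<bullet> w = \<beta> + s * (v \<bullet> w)" using ys F by (simp add: inner_add_left)
  moreover have "x \<bullet> w = \<beta> + (t + l) * (v \<bullet> w)" using zt F by (simp add: inner_add_left algebra_simps)
  ultimately have "s = t + l" using v by simp
  then have "s = l" using ys zt by simp
  then show "x \<in> translate F (l *\<^sub>R v)" using ys unfolding translate_def by blast
next
  fix x assume "x \<in> translate F (l *\<^sub>R v)"
  then obtain y where y: "y \<in> F" "x = y + l *\<^sub>R v" unfolding translate_def by blast
  have "x \<in> msum F (closed_segment 0 (l *\<^sub>R v))" unfolding mem_msum_segment[OF assms(1)]
    using y assms(1) by force
  moreover have "y \<in> msum F (closed_segment 0 (m *\<^sub>R v))" unfolding mem_msum_segment[OF assms(2)]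
    by (rule bexI[OF _ y(1)], rule bexI[of _ 0]) (use assms(2) in auto)
  then have "x \<in> translate (msum F (closed_segment 0 (m *\<^sub>R v))) (l *\<^sub>R v)" unfolding translate_def y(2) by (rule imageI)
  ultimately show "x \<in> msum F (closed_segment 0 (l *\<^sub>R v)) \<inter> translate (msum F (closed_segment 0 (m *\<^sub>R v))) (l *\<^sub>R v)" by simp
qed

lemma hausdist_msum_segment:
  assumes F: "convex_body F" and l: "l \<ge> 0"
  shows "hausdist F (msum F (closed_segment 0 (l *\<^sub>R v))) \<le> l * norm v"
proof (rule hausdist_le)
  show "F \<noteq> {}" "msum F (closed_segment 0 (l *\<^sub>R v)) \<noteq> {}"
    using F convex_body_msum[OF F convex_body_segment] by (auto simp: convex_body_def)
  fix x assume "x \<in> F"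
  then have "x \<in> msum F (closed_segment 0 (l *\<^sub>R v))" unfolding mem_msum_segment[OF l] using l by force
  then show "\<exists>y\<in>msum F (closed_segment 0 (l *\<^sub>R v)). dist x y \<le> l * norm v" using l by (intro bexI[of _ x]) auto
next
  fix x assume "x \<in> msum F (closed_segment 0 (l *\<^sub>R v))"
  then obtain y s where ys: "y \<in> F" "0 \<le> s" "s \<le> l" "x = y + s *\<^sub>R v"
    using mem_msum_segment[OF l, of x F v] by auto
  then have "dist y x \<le> l * norm v" by (simp add: dist_norm mult_right_mono)
  then show "\<exists>y\<in>F. dist y x \<le> l * norm v" using ys(1) by blast
qed

text \<open>Two prisms over \<open>F\<close> stacked along \<open>v\<close> form a prism whose
  heights add, and they meet in a translate of \<open>F\<close> because \<open>F\<close> lies in a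
  hyperplane transverse to \<open>v\<close>. The increment over \<open>f F\<close> is therefore
  additive in the height, and it is locally bounded by continuity.\<close>

lemma real_val_msum_segment:
  fixes f :: "'a::euclidean_space set \<Rightarrow> real"
  assumes f: "real_val f" and F: "convex_body F" and Fw: "\<And>x. x \<in> F \<Longrightarrow> x \<bullet> w = \<beta>" and v: "v \<bullet> w \<noteq> 0" and l: "l \<ge> 0"
  shows "f (msum F (closed_segment 0 (l *\<^sub>R v))) = f F + l * (f (msum F (closed_segment 0 v)) - f F)"
proof -
  define G where "G l = msum F (closed_segment 0 (l *\<^sub>R v))" for l
  have body: "convex_body (G l)" for l unfolding G_def by (rule convex_body_msum[OF F convex_body_segment])
  have G0: "G 0 = F" unfolding G_def by (simp add: msum_singleton translate_def)
  define h where "h l = f (G l) - f F" for l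
  have add: "h (x + y) = h x + h y" if "x \<ge> 0" "y \<ge> 0" for x y
  proof -
    have un: "G (x + y) = G x \<union> translate (G y) (x *\<^sub>R v)" unfolding G_def by (rule msum_segment_split[OF that])
    have int: "G x \<inter> translate (G y) (x *\<^sub>R v) = translate F (x *\<^sub>R v)" unfolding G_def by (rule msum_segment_Int[OF that Fw v])
    have "f (G x) + f (translate (G y) (x *\<^sub>R v)) = f (G (x + y)) + f (translate F (x *\<^sub>R v))"
      unfolding un int[symmetric] by (rule real_valD(1)[OF f]) (use body convex_body_translate un[symmetric] in auto)
    then show ?thesis using real_valD(2)[OF f] body F by (simp add: h_def)
  qed
  obtain d where d: "d > 0" "\<And>K'. convex_body K' \<Longrightarrow> hausdist F K' < d \<Longrightarrow> \<bar>f F - f K'\<bar> < 1"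
    using real_val_cont[OF f F zero_less_one] by blast
  have bd: "\<bar>h x\<bar> \<le> 1" if "0 \<le> x" "x \<le> d / (norm v + 1)" for x
  proof -
    have "hausdist F (G x) \<le> x * norm v" unfolding G_def by (rule hausdist_msum_segment[OF F that(1)])
    also have "\<dots> \<le> d / (norm v + 1) * norm v" by (rule mult_right_mono[OF that(2)]) simp
    also have "\<dots> < d" using d(1) by (simp add: pos_divide_less_eq add_nonneg_pos)
    finally have "\<bar>f F - f (G x)\<bar> < 1" by (rule d(2)[OF body])
    then show ?thesis by (simp add: h_def)
  qed
  have "d / (norm v + 1) > 0" using d(1) by (simp add: add_nonneg_pos)
  from additive_bounded_linear[of h, OF add this bd l] have "h l = l * h 1" .
  then show ?thesis by (simp add: h_def G_def)
qed

lemma transverse_functional: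
  fixes v :: "'a::euclidean_space"
  assumes "v \<notin> span S"
  obtains w where "\<And>x. x \<in> span S \<Longrightarrow> x \<bullet> w = 0" "v \<bullet> w \<noteq> (0::real)"
proof -
  obtain y z where yz: "y \<in> span S" "\<And>w. w \<in> span S \<Longrightarrow> orthogonal z w" "v = y + z"
    using orthogonal_subspace_decomp_exists[of S v] by blast
  have "x \<bullet> z = 0" if "x \<in> span S" for x using yz(2)[OF that] by (simp add: orthogonal_def inner_commute)
  moreover have "v \<bullet> z = z \<bullet> z" using calculation[OF yz(1)] yz(3) by (simp add: inner_add_left)
  moreover have "z \<noteq> 0" using yz assms by auto
  ultimately show ?thesis using that[of z] by simp
qed

lemma para_affine:
  assumes f: "real_val f" and v: "v \<notin> span (set vs)" and l: "l \<ge> 0"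
  shows "f (para ((l *\<^sub>R v) # vs)) = f (para vs) + l * (f (para (v # vs)) - f (para vs))"
proof -
  obtain w where w: "\<And>x. x \<in> span (set vs) \<Longrightarrow> x \<bullet> w = 0" "v \<bullet> w \<noteq> 0" using transverse_functional[OF v] by blast
  show ?thesis using real_val_msum_segment[OF f convex_body_para _ w(2) l, of vs 0] w(1) para_span by auto
qed

lemma para_set:
  assumes "distinct vs"
  shows "{\<Sum>v\<in>set vs. c v *\<^sub>R v | c. \<forall>v\<in>set vs. 0 \<le> c v \<and> c v \<le> 1} \<subseteq> para vs"
  using assms
proof (induction vs)
  case (Cons a vs)
  show ?case
  proof clarify
    fix c assume c: "\<forall>v\<in>set (a # vs). 0 \<le> c v \<and> c v \<le> (1::real)"
    have "(\<Sum>v\<in>set vs. c v *\<^sub>R v) \<in> para vs" using Cons c by auto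
    moreover have "c a *\<^sub>R a \<in> closed_segment 0 a" using c by (auto simp: in_segment)
    ultimately have "(\<Sum>v\<in>set vs. c v *\<^sub>R v) + c a *\<^sub>R a \<in> para (a # vs)" unfolding para.simps msum_def by blast
    then show "(\<Sum>v\<in>set (a # vs). c v *\<^sub>R v) \<in> para (a # vs)" using Cons.prems by (simp add: add.commute)
  qed
qed simp

subsection \<open>Nonnegative valuations\<close>

text \<open>The section by the bounding hyperplane has smaller dimension and value 0, so the values
  of the two pieces add up to that of \<open>X\<close>, which is 0; being nonnegative, both
  vanish.\<close>

lemma nonneg_val_Int_halfspace:
  fixes f :: "'a::euclidean_space set \<Rightarrow> real"
  assumes f: "real_val f" and nn: "\<And>K. convex_body K \<Longrightarrow> f K \<ge> 0"
    and X: "convex_body X" "f X = 0"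
    and low: "\<And>Y. convex_body Y \<Longrightarrow> aff_dim Y < aff_dim X \<Longrightarrow> f Y = 0"
    and ne: "X \<inter> {x. a \<bullet> x \<le> b} \<noteq> {}"
  shows "f (X \<inter> {x. a \<bullet> x \<le> b}) = 0"
proof (cases "X \<subseteq> {x. a \<bullet> x \<le> b}")
  case True
  then show ?thesis using X by (simp add: Int_absorb2)
next
  case False
  let ?A = "X \<inter> {x. a \<bullet> x \<le> b}" and ?B = "X \<inter> {x. b \<le> a \<bullet> x}" and ?C = "X \<inter> {x. a \<bullet> x = b}"
  have A: "convex_body ?A" using X ne by (intro convex_body_Int) (auto simp: closed_halfspace_le convex_halfspace_le)
  have B: "convex_body ?B" using X False by (intro convex_body_Int) (auto simp: closed_halfspace_ge convex_halfspace_ge)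
  have un: "?A \<union> ?B = X" and int: "?A \<inter> ?B = ?C" by auto
  have C: "convex_body ?C" using convex_body_Int_of_Un[OF A B] X(1) un int by simp
  have "affine hull ?C \<subset> affine hull X"
  proof
    show "affine hull ?C \<subseteq> affine hull X" by (rule hull_mono) auto
    obtain x where "x \<in> X" "a \<bullet> x \<noteq> b" using False by auto
    moreover have "affine hull ?C \<subseteq> {x. a \<bullet> x = b}" by (rule hull_minimal) (auto simp: affine_hyperplane)
    ultimately show "affine hull ?C \<noteq> affine hull X" using hull_inc[of x X affine] by auto
  qed
  then have "f ?C = 0" by (intro low[OF C] aff_dim_psubset)
  moreover have "f ?A + f ?B = f X + f ?C" using real_valD(1)[OF f A B] X(1) un int by simp
  ultimately show ?thesis using nn[OF A] nn[OF B] X(2) by linarith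
qed

lemma nonneg_val_Int_polyhedron:
  fixes f :: "'a::euclidean_space set \<Rightarrow> real"
  assumes f: "real_val f" and nn: "\<And>K. convex_body K \<Longrightarrow> f K \<ge> 0"
    and low: "\<And>Y. convex_body Y \<Longrightarrow> aff_dim Y < d \<Longrightarrow> f Y = 0"
    and X: "convex_body X" "f X = 0" "aff_dim X \<le> d"
    and F: "finite F" "\<And>h. h \<in> F \<Longrightarrow> \<exists>a b. h = {x. a \<bullet> x \<le> b}" and ne: "X \<inter> \<Inter>F \<noteq> {}"
  shows "convex_body (X \<inter> \<Inter>F) \<and> f (X \<inter> \<Inter>F) = 0"
  using F ne
proof (induction F rule: finite_induct)
  case empty
  then show ?case using X by simp
next
  case (insert h F)
  have "\<exists>a b. h = {x. a \<bullet> x \<le> b}" by (rule insert.prems(1)) simp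
  then obtain a b where h: "h = {x. a \<bullet> x \<le> b}" by (elim exE)
  have "X \<inter> \<Inter>F \<noteq> {}" using insert.prems(2) by auto
  from insert.IH[OF insert.prems(1)[OF insertI2] this]
  have IH: "convex_body (X \<inter> \<Inter>F)" "f (X \<inter> \<Inter>F) = 0" by simp_all
  have eq: "X \<inter> \<Inter>(insert h F) = (X \<inter> \<Inter>F) \<inter> {x. a \<bullet> x \<le> b}" unfolding h by auto
  have ne: "(X \<inter> \<Inter>F) \<inter> {x. a \<bullet> x \<le> b} \<noteq> {}" using insert.prems(2) unfolding eq .
  have le: "aff_dim (X \<inter> \<Inter>F) \<le> d" using X(3) aff_dim_subset[of "X \<inter> \<Inter>F" X] by auto
  have "f ((X \<inter> \<Inter>F) \<inter> {x. a \<bullet> x \<le> b}) = 0"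
    by (rule nonneg_val_Int_halfspace[OF f nn IH _ ne]) (use low le in auto)
  moreover have "convex_body ((X \<inter> \<Inter>F) \<inter> {x. a \<bullet> x \<le> b})"
    by (rule convex_body_Int[OF IH(1) closed_halfspace_le convex_halfspace_le ne])
  ultimately show ?case unfolding eq by simp
qed

text \<open>Cut a polytope out of a parallelepiped of the same dimension by finitely many halfspaces:
  the pieces cut off in each step have nonnegative values adding up to \<open>0\<close>.\<close>
theorem nonneg_val_zero:
  fixes f :: "'a::euclidean_space set \<Rightarrow> real"
  assumes f: "real_val f" and nn: "\<And>K. convex_body K \<Longrightarrow> f K \<ge> 0"
    and para0: "\<And>vs. indep vs \<Longrightarrow> f (para vs) = 0"
    and K: "convex_body K"
  shows "f K = 0"
  using K
proof (induction "nat (aff_dim K)" arbitrary: K rule: less_induct)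
  case less
  note K = less.prems
  obtain k0 where k0: "k0 \<in> K" using K by (auto simp: convex_body_def)
  define K' where "K' = translate K (- k0)"
  have K': "convex_body K'" unfolding K'_def by (rule convex_body_translate[OF K])
  have K'eq: "K' = (+) (- k0) ` K" unfolding K'_def translate_def by (simp add: add.commute)
  have z: "0 \<in> K'" unfolding K'eq using k0 by force
  have dK: "aff_dim K' = aff_dim K" unfolding K'eq by (rule aff_dim_translation_eq)
  have nK: "aff_dim K \<ge> 0" using K aff_dim_negative_iff[of K] unfolding convex_body_def by linarith
  \<comment> \<open>The induction hypothesis disposes of the sections created by cutting.\<close>
  have low: "f Y = 0" if "convex_body Y" "aff_dim Y < aff_dim K" for Y
  proof (rule less.hyps[OF _ that(1)])
    have "0 \<le> aff_dim Y" using that(1) aff_dim_negative_iff[of Y] unfolding convex_body_def by linarith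
    then show "nat (aff_dim Y) < nat (aff_dim K)" using that(2) by simp
  qed
  have dimK': "aff_dim K' = int (dim K')" by (rule aff_dim_zero) (simp add: z hull_inc)
  obtain B where B: "B \<subseteq> span K'" "pairwise orthogonal B" "\<And>x. x \<in> B \<Longrightarrow> norm x = 1" "independent B"
    "card B = dim (span K')" "span B = span K'"
    using orthonormal_basis_subspace[OF subspace_span[of K']] by metis
  have finB: "finite B" using B(4) independent_imp_finite by blast
  obtain bs where bs: "set bs = B" "distinct bs" using finite_distinct_list[OF finB] by blast
  obtain R where R: "R > 0" "\<And>x. x \<in> K' \<Longrightarrow> norm x \<le> R" using convex_body_norm_bound[OF K'] by blast
  \<comment> \<open>\<open>Q\<close> is the cube of half side \<open>R\<close> about 0 in
    \<open>span K'\<close>, on an orthonormal basis: it contains \<open>K'\<close> without exceeding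
    its dimension.\<close>
  define t where "t = (- R) *\<^sub>R \<Sum>B"
  define Q where "Q = translate (para (map ((*\<^sub>R) (2 * R)) bs)) t"
  have Q: "convex_body Q" unfolding Q_def by (intro convex_body_translate convex_body_para)
  have "indep (map ((*\<^sub>R) (2 * R)) bs)" using bs B(4) R(1) by (intro indep_scale) (auto simp: indep_def)
  then have fQ: "f Q = 0" unfolding Q_def using real_valD(2)[OF f convex_body_para] para0 by simp
  have t: "t \<in> span K'" unfolding t_def by (intro span_scale span_sum) (use B(1) in blast)
  have "para (map ((*\<^sub>R) (2 * R)) bs) \<subseteq> span K'"
  proof -
    have "para (map ((*\<^sub>R) (2 * R)) bs) \<subseteq> span ((*\<^sub>R) (2 * R) ` B)" using para_span[of "map ((*\<^sub>R) (2 * R)) bs"] bs by simp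
    also have "\<dots> \<subseteq> span K'" by (rule span_minimal) (use B(1) in \<open>auto intro: span_scale\<close>)
    finally show ?thesis .
  qed
  then have "Q \<subseteq> span K'" unfolding Q_def translate_def using t by (auto intro: span_add)
  then have "aff_dim Q \<le> aff_dim (span K')" by (rule aff_dim_subset)
  also have "\<dots> = aff_dim K" using dimK' dK by (simp add: aff_dim_subspace)
  finally have dQ: "aff_dim Q \<le> aff_dim K" .
  have sub: "K' \<subseteq> Q"
  proof
    fix x assume x: "x \<in> K'"
    define c where "c v = (x \<bullet> v + R) / (2 * R)" for v
    have "\<bar>x \<bullet> v\<bar> \<le> R" if "v \<in> B" for v
      using Cauchy_Schwarz_ineq2[of x v] B(3)[OF that] R(2)[OF x] by simp
    then have c: "\<forall>v\<in>B. 0 \<le> c v \<and> c v \<le> 1" unfolding c_def using R(1) by (force simp: abs_le_iff)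
    have "(\<Sum>v\<in>B. c v *\<^sub>R v) \<in> para bs" using para_set[OF bs(2)] c bs(1) by blast
    then have "(2 * R) *\<^sub>R (\<Sum>v\<in>B. c v *\<^sub>R v) \<in> para (map ((*\<^sub>R) (2 * R)) bs)"
      unfolding scale_para[symmetric] by blast
    moreover have "x = (2 * R) *\<^sub>R (\<Sum>v\<in>B. c v *\<^sub>R v) + t"
    proof -
      have "(2 * R) *\<^sub>R (\<Sum>v\<in>B. c v *\<^sub>R v) = (\<Sum>v\<in>B. (x \<bullet> v + R) *\<^sub>R v)"
        unfolding scaleR_sum_right c_def using R(1) by (intro sum.cong) auto
      also have "\<dots> = (\<Sum>v\<in>B. (x \<bullet> v) *\<^sub>R v) + R *\<^sub>R \<Sum>B"
        by (simp add: scaleR_add_left sum.distrib scaleR_sum_right)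
      also have "(\<Sum>v\<in>B. (x \<bullet> v) *\<^sub>R v) = x"
        by (rule orthonormal_basis_expand[OF B(2,3) _ finB]) (use B(6) x span_base in auto)
      finally show ?thesis by (simp add: t_def)
    qed
    ultimately show "x \<in> Q" unfolding Q_def translate_def by blast
  qed
  have hull: "f (convex hull V) = 0" if V: "finite V" "V \<noteq> {}" "V \<subseteq> K'" for V
  proof -
    have P: "convex hull V \<subseteq> Q" using V(3) sub Q by (intro hull_minimal) (auto simp: convex_body_def)
    have "polyhedron (convex hull V)" using V(1) by (intro polytope_imp_polyhedron) (auto simp: polytope_def)
    then obtain F where F: "finite F" "convex hull V = \<Inter>F" "\<forall>h\<in>F. \<exists>a b. a \<noteq> 0 \<and> h = {x. a \<bullet> x \<le> b}"
      unfolding polyhedron_def by blast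
    have eq: "Q \<inter> \<Inter>F = convex hull V" using P F(2) by blast
    have "convex_body (Q \<inter> \<Inter>F) \<and> f (Q \<inter> \<Inter>F) = 0"
    proof (rule nonneg_val_Int_polyhedron[OF f nn low Q fQ dQ F(1)])
      show "\<exists>a b. h = {x. a \<bullet> x \<le> b}" if "h \<in> F" for h using bspec[OF F(3) that] by (elim exE conjE) (intro exI)
      show "Q \<inter> \<Inter>F \<noteq> {}" unfolding eq using V by simp
    qed
    then show ?thesis unfolding eq by blast
  qed
  obtain V where V: "\<And>i. finite (V i)" "\<And>i. V i \<noteq> {}" "\<And>i. V i \<subseteq> K'" "(\<lambda>i::nat. hausdist K' (convex hull V i)) \<longlonglongrightarrow> 0"
    using hull_sequence[OF K'] by blast
  have "(\<lambda>i. f (convex hull V i)) \<longlonglongrightarrow> f K'"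
    by (rule real_val_tendsto[OF f K' _ V(4)]) (intro always_eventually allI convex_body_hull V)
  then have "f K' = 0" using hull[OF V(1,2,3)] by (simp add: LIMSEQ_const_iff)
  then show ?case unfolding K'_def using real_valD(2)[OF f K] by simp
qed

text \<open>For \<open>v\<close> outside the span of \<open>vs\<close> this is, by
  \<open>para_affine\<close>, the slope of the affine function l -> f(para (l v # vs)) on the
  half-line.\<close>

definition slope :: "('a::euclidean_space set \<Rightarrow> real) \<Rightarrow> 'a list \<Rightarrow> 'a \<Rightarrow> real" where
  "slope f vs v = f (para (v # vs)) - f (para vs)"

lemma para_middle: "para (xs @ v # ys) = para (v # xs @ ys)"
proof (induction xs)
  case (Cons a xs)
  have "para ((a # xs) @ v # ys) = para (a # v # xs @ ys)" using Cons by simp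
  then show ?case by (simp add: para_swap del: para.simps)
qed simp

lemma indep_middle: "indep (xs @ v # ys) \<longleftrightarrow> indep (v # xs @ ys)"
  by (auto simp: indep_def)

lemma indep_scale_Cons:
  assumes "indep (x # vs)" "r \<noteq> 0"
  shows "indep ((r *\<^sub>R x) # vs)"
proof (rule indep_ConsI)
  show "indep vs" using indep_ConsD[OF assms(1)] by blast
  show "r *\<^sub>R x \<notin> span (set vs)"
  proof
    assume "r *\<^sub>R x \<in> span (set vs)"
    then have "(1 / r) *\<^sub>R (r *\<^sub>R x) \<in> span (set vs)" by (rule span_scale)
    then show False using assms(2) indep_ConsD(2)[OF assms(1)] by simp
  qed
qed

lemma indep_scale_prefix:
  assumes "r \<noteq> 0"
  shows "indep (xs @ ys) \<Longrightarrow> indep (map ((*\<^sub>R) r) xs @ ys)"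
proof (induction xs arbitrary: ys)
  case (Cons x xs)
  then have "indep (xs @ x # ys)" by (simp add: indep_middle)
  then have "indep (x # map ((*\<^sub>R) r) xs @ ys)" using Cons.IH indep_middle by blast
  then show ?case using indep_scale_Cons[OF _ assms] by simp
qed simp

context
  fixes f :: "'a::euclidean_space set \<Rightarrow> real"
  assumes f: "real_val f" and nn: "\<And>K. convex_body K \<Longrightarrow> f K \<ge> 0"
begin

text \<open>An affine function on the half-line that stays nonnegative cannot decrease; the length
  \<open>l\<close> is chosen so that its value would be -1.\<close>

lemma slope_nonneg:
  assumes v: "v \<notin> span (set vs)"
  shows "slope f vs v \<ge> 0"
proof (rule ccontr)
  assume neg: "\<not> slope f vs v \<ge> 0"
  define l where "l = (f (para vs) + 1) / (- slope f vs v)"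
  have l: "l \<ge> 0" unfolding l_def using neg nn[OF convex_body_para, of vs] by (intro divide_nonneg_nonneg) auto
  have "f (para ((l *\<^sub>R v) # vs)) = f (para vs) + l * slope f vs v"
    using para_affine[OF f v l] by (simp add: slope_def)
  also have "l * slope f vs v = - (f (para vs) + 1)" unfolding l_def using neg by simp
  finally show False using nn[OF convex_body_para, of "(l *\<^sub>R v) # vs"] by simp
qed

lemma slope_scale:
  assumes i: "indep (v # x # vs)" and m: "m \<ge> 0"
  shows "slope f ((m *\<^sub>R x) # vs) v = slope f vs v + m * (slope f (x # vs) v - slope f vs v)"
proof -
  have 1: "x \<notin> span (set (v # vs))" using indep_ConsD(2)[OF indep_swap[OF i]] .
  have 2: "x \<notin> span (set vs)" using indep_ConsD(2)[OF indep_ConsD(1)[OF i]] .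
  have "f (para (v # (m *\<^sub>R x) # vs)) = f (para ((m *\<^sub>R x) # v # vs))" by (simp only: para_swap)
  also have "\<dots> = f (para (v # vs)) + m * (f (para (v # x # vs)) - f (para (v # vs)))"
    using para_affine[OF f 1 m] by (simp only: para_swap[of x v])
  finally show ?thesis using para_affine[OF f 2 m] by (simp add: slope_def algebra_simps)
qed

text \<open>The slope along \<open>v\<close> is itself affine in the length of the edge
  \<open>x\<close> (\<open>slope_scale\<close>) and nonnegative for all lengths, so
  \<open>slope_nonneg\<close> can be repeated one level up.\<close>

lemma slope_mono:
  assumes i: "indep (v # x # vs)"
  shows "slope f vs v \<le> slope f (x # vs) v"
proof (rule ccontr)
  assume "\<not> slope f vs v \<le> slope f (x # vs) v"
  define e where "e = slope f vs v - slope f (x # vs) v"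
  then have e: "e > 0" using \<open>\<not> slope f vs v \<le> slope f (x # vs) v\<close> by simp
  have s0: "slope f vs v \<ge> 0"
    by (rule slope_nonneg) (use indep_ConsD(2)[OF indep_ConsD(1)[OF indep_swap[OF i]]] in simp)
  define m where "m = (slope f vs v + 1) / e"
  have m: "m > 0" unfolding m_def using s0 e by (intro divide_pos_pos) auto
  have "indep ((m *\<^sub>R x) # v # vs)" using indep_scale_Cons[OF indep_swap[OF i]] m by simp
  then have "slope f ((m *\<^sub>R x) # vs) v \<ge> 0" by (rule slope_nonneg[OF indep_ConsD(2)[OF indep_swap]])
  moreover have "slope f ((m *\<^sub>R x) # vs) v = slope f vs v - m * e"
    using slope_scale[OF i, of m] m by (simp add: e_def right_diff_distrib)
  moreover have "m * e = slope f vs v + 1" unfolding m_def using e by simp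
  ultimately show False by simp
qed

lemma slope_scale_le:
  assumes i: "indep (v # x # vs)" and m: "m \<ge> 1"
  shows "slope f ((m *\<^sub>R x) # vs) v \<le> m * slope f (x # vs) v"
proof -
  have s0: "slope f vs v \<ge> 0"
    by (rule slope_nonneg) (use indep_ConsD(2)[OF indep_ConsD(1)[OF indep_swap[OF i]]] in simp)
  have "slope f ((m *\<^sub>R x) # vs) v = m * slope f (x # vs) v - (m - 1) * slope f vs v"
    using slope_scale[OF i, of m] m by (simp add: algebra_simps)
  moreover have "(m - 1) * slope f vs v \<ge> 0" using m s0 by simp
  ultimately show ?thesis by linarith
qed

text \<open>Each stretched edge costs at most one factor \<open>m\<close> by
  \<open>slope_scale_le\<close>. Separating a prefix \<open>xs\<close> from the rest
  \<open>ys\<close> lets the induction stretch one edge at a time.\<close>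

lemma slope_scale_prefix_le:
  assumes m: "m \<ge> 1"
  shows "indep (v # xs @ ys) \<Longrightarrow> slope f (map ((*\<^sub>R) m) xs @ ys) v \<le> m ^ length xs * slope f (xs @ ys) v"
proof (induction xs arbitrary: ys)
  case (Cons x xs)
  have i1: "indep (v # xs @ x # ys)" using Cons.prems indep_middle[of "v # xs" x ys] indep_swap by simp
  then have i2: "indep (xs @ v # x # ys)" using indep_middle by blast
  have "indep (map ((*\<^sub>R) m) xs @ v # x # ys)" using indep_scale_prefix[OF _ i2] m by simp
  then have "indep (v # map ((*\<^sub>R) m) xs @ x # ys)" using indep_middle by blast
  then have i3: "indep (v # x # map ((*\<^sub>R) m) xs @ ys)" using indep_middle[of "v # map ((*\<^sub>R) m) xs" x ys] indep_swap by simp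
  have "slope f (map ((*\<^sub>R) m) (x # xs) @ ys) v \<le> m * slope f (x # map ((*\<^sub>R) m) xs @ ys) v"
    using slope_scale_le[OF i3 m] by simp
  also have "slope f (x # map ((*\<^sub>R) m) xs @ ys) v = slope f (map ((*\<^sub>R) m) xs @ x # ys) v"
    unfolding slope_def by (simp only: para.simps para_middle)
  also have "m * \<dots> \<le> m * (m ^ length xs * slope f (xs @ x # ys) v)"
    using Cons.IH[OF i1] m by (intro mult_left_mono) auto
  also have "slope f (xs @ x # ys) v = slope f ((x # xs) @ ys) v"
    unfolding slope_def by (simp only: para.simps para_middle append_Cons)
  finally show ?case by (simp add: mult.assoc)
qed simp

text \<open>Extending the edge list to a basis only increases a slope, so every slope lies between 0
  and a slope in full dimension.\<close>

lemma zero_top_slopes_imp_const_para: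
  assumes top: "\<And>v vs. indep (v # vs) \<Longrightarrow> length (v # vs) = DIM('a) \<Longrightarrow> slope f vs v = 0"
    and i: "indep vs"
  shows "f (para vs) = f {0}"
proof -
  have slope0: "slope f vs v = 0" if "indep (v # vs)" for v vs
    using that
  proof (induction "DIM('a) - length (v # vs)" arbitrary: vs)
    case 0
    then show ?case using indep_length[of "v # vs"] top[of v vs] by simp
  next
    case (Suc k)
    then have "length (v # vs) < DIM('a)" by simp
    then obtain x where x: "indep (x # v # vs)" using indep_extend[OF Suc.prems] by blast
    then have i: "indep (v # x # vs)" by (rule indep_swap)
    have "slope f (x # vs) v = 0" by (rule Suc.hyps(1)) (use Suc.hyps(2) i in auto)
    moreover have "slope f vs v \<ge> 0" by (rule slope_nonneg) (use indep_ConsD(2)[OF Suc.prems] in simp)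
    ultimately show ?case using slope_mono[OF i] by simp
  qed
  show ?thesis using i
  proof (induction vs)
    case (Cons v vs)
    then show ?case using slope0[OF Cons.prems] indep_ConsD(1)[OF Cons.prems] by (simp add: slope_def)
  qed simp
qed

text \<open>The leading nonzero component of \<open>f\<close> is nonnegative.\<close>
theorem zero_top_slopes_imp_const:
  assumes top: "\<And>v vs. indep (v # vs) \<Longrightarrow> length (v # vs) = DIM('a) \<Longrightarrow> slope f vs v = 0"
    and K: "convex_body K"
  shows "f K = f {0}"
proof -
  let ?n = "DIM('a)"
  obtain g c where gg: "\<forall>j\<le>?n. real_val (g j) \<and> homog j (g j)"
    "\<forall>K. convex_body K \<longrightarrow> f K = (\<Sum>j\<le>?n. g j K) \<and> g 0 K = f {0} \<and> g ?n K = c * vol K \<and>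
      (\<lambda>m. f ((*\<^sub>R) (real m) ` K) / real m ^ ?n) \<longlonglongrightarrow> c * vol K"
    using homog_decomposition[OF f] by (elim exE conjE)
  have g: "\<And>j. j \<le> ?n \<Longrightarrow> real_val (g j)" "\<And>j. j \<le> ?n \<Longrightarrow> homog j (g j)"
    "\<And>K. convex_body K \<Longrightarrow> f K = (\<Sum>j\<le>?n. g j K)" "\<And>K. convex_body K \<Longrightarrow> g 0 K = f {0}"
    "\<And>K. convex_body K \<Longrightarrow> g ?n K = c * vol K"
    using gg by blast+
  have gm: "g j ((*\<^sub>R) (real m) ` K) = real m ^ j * g j K" if "j \<le> ?n" "convex_body K" "m \<ge> 1" for j m K
    using g(2)[OF that(1)] that unfolding homog_def by simp
  have fm: "f ((*\<^sub>R) (real m) ` K) = (\<Sum>j\<le>?n. g j K * real m ^ j)" if "convex_body K" "m \<ge> 1" for m K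
    unfolding g(3)[OF convex_body_scale[OF that(1)]] using gm that by (intro sum.cong) auto
  \<comment> \<open>A value that is constant over all dilates leaves only the coefficient of
    m^0.\<close>
  have gpara: "g j (para vs) = 0" if vs: "indep vs" and j: "1 \<le> j" "j \<le> ?n" for vs j
  proof -
    have "g j (para vs) = (if j = 0 then f {0} else 0)"
    proof (rule nat_poly_coeffs_eq[OF _ j(2)])
      fix m :: nat assume m: "m \<ge> 1"
      have "(\<Sum>j\<le>?n. g j (para vs) * real m ^ j) = f (para (map ((*\<^sub>R) (real m)) vs))"
        using fm[OF convex_body_para m, of vs] by (simp add: scale_para)
      also have "\<dots> = f {0}" using m by (intro zero_top_slopes_imp_const_para[OF top] indep_scale vs) auto
      also have "\<dots> = (\<Sum>j\<in>{0}. (if j = 0 then f {0} else 0) * real m ^ j)" by simp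
      also have "\<dots> = (\<Sum>j\<le>?n. (if j = 0 then f {0} else 0) * real m ^ j)" by (rule sum.mono_neutral_left) auto
      finally show "(\<Sum>j\<le>?n. g j (para vs) * real m ^ j) = (\<Sum>j\<le>?n. (if j = 0 then f {0} else 0) * real m ^ j)" .
    qed
    then show ?thesis using j by simp
  qed
  have gz: "g j K = 0" if "1 \<le> j" "j \<le> ?n" "convex_body K" for j K
    using that
  proof (induction "?n - j" arbitrary: j K rule: less_induct)
    case less
    note j = less.prems(1,2)
    have high: "g i K = 0" if "i > j" "i \<le> ?n" "convex_body K" for i K
      using less.hyps[of i K] that j by simp
    \<comment> \<open>With the higher parts gone, this is the leading coefficient of the nonnegative
      polynomial m -> f(m K).\<close>
    have "g j K \<ge> 0" if K: "convex_body K" for K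
    proof -
      have "(\<lambda>m. \<Sum>i\<le>j. g i K * (1 / real m) ^ (j - i)) \<longlonglongrightarrow> (\<Sum>i\<le>j. g i K * 0 ^ (j - i))"
        by (intro tendsto_intros lim_1_over_n)
      moreover have "(\<Sum>i\<le>j. g i K * 0 ^ (j - i)) = (\<Sum>i\<in>{j}. g i K * 0 ^ (j - i))"
        by (rule sum.mono_neutral_right) (auto simp: power_0_left)
      ultimately have lim: "(\<lambda>m. \<Sum>i\<le>j. g i K * (1 / real m) ^ (j - i)) \<longlonglongrightarrow> g j K" by simp
      have "\<forall>\<^sub>F m in sequentially. 0 \<le> (\<Sum>i\<le>j. g i K * (1 / real m) ^ (j - i))"
        using eventually_ge_at_top[of 1]
      proof eventually_elim
        case (elim m)
        have "f ((*\<^sub>R) (real m) ` K) = (\<Sum>i\<le>j. g i K * real m ^ i)"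
          unfolding fm[OF K elim] by (rule sum.mono_neutral_right) (use high[OF _ _ K] j in auto)
        also have "\<dots> = real m ^ j * (\<Sum>i\<le>j. g i K * (1 / real m) ^ (j - i))"
          unfolding sum_distrib_left
        proof (intro sum.cong refl)
          fix i assume "i \<in> {..j}"
          then have "real m ^ j = real m ^ i * real m ^ (j - i)" by (simp add: power_add[symmetric])
          then show "g i K * real m ^ i = real m ^ j * (g i K * (1 / real m) ^ (j - i))"
            using elim by (simp add: power_one_over)
        qed
        finally have "real m ^ j * (\<Sum>i\<le>j. g i K * (1 / real m) ^ (j - i)) \<ge> 0"
          using nn[OF convex_body_scale[OF K], of "real m"] by simp
        moreover have "real m ^ j > 0" using elim by simp
        ultimately show ?case by (simp only: zero_le_mult_iff) linarith
      qed
      then show ?thesis by (rule tendsto_lowerbound[OF lim]) simp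
    qed
    then show ?case using nonneg_val_zero[OF g(1)[OF j(2)] _ gpara[OF _ j]] less.prems(3) by blast
  qed
  have "f K = (\<Sum>j\<in>{0}. g j K)" unfolding g(3)[OF K] by (rule sum.mono_neutral_right) (use gz K in auto)
  then show ?thesis using g(4)[OF K] by simp
qed

text \<open>Dually, the nonzero component of \<open>f\<close> of lowest degree is nonnegative.\<close>
theorem zero_low_dim_imp_volume:
  assumes low: "\<And>vs. indep vs \<Longrightarrow> length vs < DIM('a) \<Longrightarrow> f (para vs) = 0"
  obtains c where "\<And>K. convex_body K \<Longrightarrow> f K = c * vol K"
proof -
  let ?n = "DIM('a)"
  obtain g c where gg: "\<forall>j\<le>?n. real_val (g j) \<and> homog j (g j)"
    "\<forall>K. convex_body K \<longrightarrow> f K = (\<Sum>j\<le>?n. g j K) \<and> g 0 K = f {0} \<and> g ?n K = c * vol K \<and>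
      (\<lambda>m. f ((*\<^sub>R) (real m) ` K) / real m ^ ?n) \<longlonglongrightarrow> c * vol K"
    using homog_decomposition[OF f] by (elim exE conjE)
  have g: "\<And>j. j \<le> ?n \<Longrightarrow> real_val (g j)" "\<And>j. j \<le> ?n \<Longrightarrow> homog j (g j)"
    "\<And>K. convex_body K \<Longrightarrow> f K = (\<Sum>j\<le>?n. g j K)" "\<And>K. convex_body K \<Longrightarrow> g 0 K = f {0}"
    "\<And>K. convex_body K \<Longrightarrow> g ?n K = c * vol K"
    using gg by blast+
  have gr: "g j ((*\<^sub>R) r ` K) = r ^ j * g j K" if "j \<le> ?n" "convex_body K" "r > 0" for j r K
    using g(2)[OF that(1)] that unfolding homog_def by simp
  have fr: "f ((*\<^sub>R) r ` K) = (\<Sum>j\<le>?n. g j K * r ^ j)" if "convex_body K" "r > 0" for r K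
    unfolding g(3)[OF convex_body_scale[OF that(1)]] using gr that by (intro sum.cong) auto
  \<comment> \<open>Dropping an edge gives 0, so \<open>para_affine\<close> has no constant term:
    \<open>f\<close> is linear in each edge and hence of degree n on parallelepipeds of full
    dimension.\<close>
  have scale1: "f (para ((r *\<^sub>R x) # vs)) = r * f (para (x # vs))" if "indep (x # vs)" "length (x # vs) = ?n" "r \<ge> 0" for r x vs
    using para_affine[OF f indep_ConsD(2)[OF that(1)] that(3)] low[OF indep_ConsD(1)[OF that(1)]] that(2) by simp
  have scale: "f (para (map ((*\<^sub>R) r) xs @ ys)) = r ^ length xs * f (para (xs @ ys))"
    if "indep (xs @ ys)" "length (xs @ ys) = ?n" "r > 0" for r xs ys
    using that(1,2)
  proof (induction xs arbitrary: ys)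
    case (Cons x xs)
    have i: "indep (xs @ x # ys)" using Cons.prems(1) by (simp add: indep_middle)
    have "indep (map ((*\<^sub>R) r) xs @ x # ys)" using indep_scale_prefix[OF _ i] that(3) by simp
    then have i2: "indep (x # map ((*\<^sub>R) r) xs @ ys)" by (simp add: indep_middle)
    have "f (para (map ((*\<^sub>R) r) (x # xs) @ ys)) = r * f (para (x # map ((*\<^sub>R) r) xs @ ys))"
      using scale1[OF i2, of r] Cons.prems(2) that(3) by simp
    also have "para (x # map ((*\<^sub>R) r) xs @ ys) = para (map ((*\<^sub>R) r) xs @ x # ys)" by (simp only: para_middle)
    also have "f \<dots> = r ^ length xs * f (para (xs @ x # ys))" by (rule Cons.IH[OF i]) (use Cons.prems in simp)
    also have "para (xs @ x # ys) = para ((x # xs) @ ys)" by (simp only: para_middle append_Cons)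
    finally show ?case by simp
  qed simp
  have gpara: "g j (para vs) = 0" if vs: "indep vs" and j: "j < ?n" for vs j
  proof -
    have "g j (para vs) = (if j = ?n then f (para vs) else 0)"
    proof (rule nat_poly_coeffs_eq[OF _ less_imp_le[OF j]])
      fix m :: nat assume m: "m \<ge> 1"
      have "(\<Sum>j\<le>?n. g j (para vs) * real m ^ j) = f (para (map ((*\<^sub>R) (real m)) vs))"
        using fr[OF convex_body_para, of "real m" vs] m by (simp add: scale_para)
      also have "\<dots> = real m ^ ?n * f (para vs)"
      proof (cases "length vs = ?n")
        case True
        then show ?thesis using scale[of vs "[]" "real m"] vs m by simp
      next
        case False
        then have l: "length vs < ?n" using indep_length[OF vs] by simp
        have "indep (map ((*\<^sub>R) (real m)) vs)" using m by (intro indep_scale vs) simp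
        then show ?thesis using low[OF vs l] low[of "map ((*\<^sub>R) (real m)) vs"] l by simp
      qed
      also have "\<dots> = (\<Sum>j\<in>{?n}. (if j = ?n then f (para vs) else 0) * real m ^ j)" by simp
      also have "\<dots> = (\<Sum>j\<le>?n. (if j = ?n then f (para vs) else 0) * real m ^ j)" by (rule sum.mono_neutral_left) auto
      finally show "(\<Sum>j\<le>?n. g j (para vs) * real m ^ j) = (\<Sum>j\<le>?n. (if j = ?n then f (para vs) else 0) * real m ^ j)" .
    qed
    then show ?thesis using j by simp
  qed
  have gz: "g j K = 0" if "j < ?n" "convex_body K" for j K
    using that
  proof (induction j arbitrary: K rule: less_induct)
    case (less j)
    note j = less.prems(1)
    have lower: "g i K = 0" if "i < j" "convex_body K" for i K using less.IH[OF that(1) _ that(2)] that j by simp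
    \<comment> \<open>With the lower parts gone, the part of degree j dominates on the shrinking
      dilates by 1/m.\<close>
    have "g j K \<ge> 0" if K: "convex_body K" for K
    proof -
      have "(\<lambda>m. \<Sum>i\<in>{j..?n}. g i K * (1 / real m) ^ (i - j)) \<longlonglongrightarrow> (\<Sum>i\<in>{j..?n}. g i K * 0 ^ (i - j))"
        by (intro tendsto_intros lim_1_over_n)
      moreover have "(\<Sum>i\<in>{j..?n}. g i K * 0 ^ (i - j)) = (\<Sum>i\<in>{j}. g i K * 0 ^ (i - j))"
        by (rule sum.mono_neutral_right) (use j in \<open>auto simp: power_0_left\<close>)
      ultimately have lim: "(\<lambda>m. \<Sum>i\<in>{j..?n}. g i K * (1 / real m) ^ (i - j)) \<longlonglongrightarrow> g j K" by simp
      have "\<forall>\<^sub>F m in sequentially. 0 \<le> (\<Sum>i\<in>{j..?n}. g i K * (1 / real m) ^ (i - j))"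
        using eventually_ge_at_top[of 1]
      proof eventually_elim
        case (elim m)
        have r: "1 / real m > 0" using elim by simp
        have "f ((*\<^sub>R) (1 / real m) ` K) = (\<Sum>i\<in>{j..?n}. g i K * (1 / real m) ^ i)"
          unfolding fr[OF K r] by (rule sum.mono_neutral_right) (use lower[OF _ K] in auto)
        also have "\<dots> = (1 / real m) ^ j * (\<Sum>i\<in>{j..?n}. g i K * (1 / real m) ^ (i - j))"
          unfolding sum_distrib_left
        proof (intro sum.cong refl)
          fix i assume "i \<in> {j..?n}"
          then have "(1 / real m) ^ i = (1 / real m) ^ j * (1 / real m) ^ (i - j)" by (simp only: power_add[symmetric]) simp
          then show "g i K * (1 / real m) ^ i = (1 / real m) ^ j * (g i K * (1 / real m) ^ (i - j))" by simp
        qed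
        finally have "(1 / real m) ^ j * (\<Sum>i\<in>{j..?n}. g i K * (1 / real m) ^ (i - j)) \<ge> 0"
          using nn[OF convex_body_scale[OF K], of "1 / real m"] by simp
        moreover have "(1 / real m) ^ j > 0" using r by (rule zero_less_power)
        ultimately show ?case by (simp only: zero_le_mult_iff) linarith
      qed
      then show ?thesis by (rule tendsto_lowerbound[OF lim]) simp
    qed
    then show ?case using nonneg_val_zero[OF g(1) _ gpara[OF _ j]] less.prems by (meson less_imp_le)
  qed
  show ?thesis
  proof (rule that[of c])
    fix K :: "'a set" assume K: "convex_body K"
    have "f K = (\<Sum>j\<in>{?n}. g j K)" unfolding g(3)[OF K] by (rule sum.mono_neutral_right) (use gz K in auto)
    then show "f K = c * vol K" using g(5)[OF K] by simp
  qed
qed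

end

subsection \<open>Volumes\<close>

lemma vol_nonneg [simp]: "vol K \<ge> 0"
  by (simp add: vol_def)

lemma vol_eq_0_iff:
  assumes "convex_body K"
  shows "vol K = 0 \<longleftrightarrow> interior K = {}"
proof -
  have "vol K = 0 \<longleftrightarrow> negligible K"
    using convex_body_lmeasurable[OF assms] by (simp add: vol_def negligible_iff_measure)
  then show ?thesis using assms negligible_convex_interior[of K] by (simp add: convex_body_def)
qed

lemma vol_mono: "convex_body A \<Longrightarrow> convex_body B \<Longrightarrow> A \<subseteq> B \<Longrightarrow> vol A \<le> vol B"
  unfolding vol_def by (intro measure_mono_fmeasurable) (auto dest: convex_body_lmeasurable fmeasurableD)

lemma vol_translate: "vol (translate K t) = vol K"
  unfolding vol_def translate_def using measure_translation[of t K] by (simp add: add.commute)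

lemma interior_nonempty_iff_aff_dim:
  fixes K :: "'a::euclidean_space set"
  assumes "convex_body K"
  shows "interior K \<noteq> {} \<longleftrightarrow> aff_dim K = int DIM('a)"
proof
  assume "interior K \<noteq> {}"
  then show "aff_dim K = int DIM('a)" by (rule aff_dim_nonempty_interior)
next
  assume "aff_dim K = int DIM('a)"
  then have "affine hull K = UNIV" by (simp add: aff_dim_eq_full)
  then have "rel_interior K = interior K" by (rule rel_interior_interior)
  then show "interior K \<noteq> {}" using assms rel_interior_eq_empty[of K] by (auto simp: convex_body_def)
qed

lemma vol_pos_iff: "convex_body K \<Longrightarrow> vol K > 0 \<longleftrightarrow> aff_dim K = int DIM('a)" for K :: "'a::euclidean_space set"
  using vol_eq_0_iff[of K] interior_nonempty_iff_aff_dim[of K] vol_nonneg[of K] by linarith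

lemma vol_hyperplane:
  assumes "convex_body K" "w \<noteq> 0" "\<And>x. x \<in> K \<Longrightarrow> x \<bullet> w = \<beta>"
  shows "vol K = 0"
proof -
  have "negligible {x. w \<bullet> x = \<beta>}" using assms(2) by (intro negligible_hyperplane) simp
  then have "negligible K" by (rule negligible_subset) (use assms(3) in \<open>auto simp: inner_commute\<close>)
  then show ?thesis by (simp add: vol_def negligible_imp_measure0)
qed

lemma vol_para_low:
  fixes vs :: "'a::euclidean_space list"
  assumes "length vs < DIM('a)"
  shows "vol (para vs) = 0"
proof -
  have "dim (para vs) \<le> dim (set vs)" using dim_subset[OF para_span[of vs]] by simp
  also have "\<dots> \<le> card (set vs)" by (rule dim_le_card') simp
  also have "\<dots> < DIM('a)" using card_length[of vs] assms by simp
  finally have "negligible (para vs)" by (rule negligible_lowdim)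
  then show ?thesis by (simp add: vol_def negligible_imp_measure0)
qed

lemma mem_para: "v \<in> set vs \<Longrightarrow> v \<in> para vs"
proof (induction vs)
  case (Cons a vs)
  show ?case
  proof (cases "v = a")
    case True
    have "0 + a \<in> para (a # vs)" unfolding para.simps msum_def using zero_in_para[of vs] ends_in_segment(2)[of a 0] by blast
    then show ?thesis using True by simp
  next
    case False
    then have "v \<in> para vs" using Cons by simp
    then have "v + 0 \<in> para (a # vs)" unfolding para.simps msum_def using ends_in_segment(1)[of 0 a] by blast
    then show ?thesis by simp
  qed
qed simp

lemma vol_para_pos:
  fixes vs :: "'a::euclidean_space list"
  assumes "indep vs" "length vs = DIM('a)"
  shows "vol (para vs) > 0"
proof -
  have "card (set vs) = DIM('a)" using assms distinct_card[of vs] by (simp add: indep_def)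
  then have "dim (set vs) = DIM('a)" using assms(1) dim_eq_card_independent[of "set vs"] by (simp add: indep_def)
  moreover have "dim (set vs) \<le> dim (para vs)" using mem_para by (intro dim_subset) blast
  ultimately have "dim (para vs) = DIM('a)" using dim_subset_UNIV[of "para vs"] by simp
  moreover have "aff_dim (para vs) = int (dim (para vs))" by (rule aff_dim_zero) (simp add: zero_in_para hull_inc)
  ultimately show ?thesis by (simp add: vol_pos_iff)
qed

text \<open>The stacking argument of \<open>real_val_msum_segment\<close> for volume, where the
  common face is a null set. If \<open>v\<close> is parallel to the hyperplane, both sides are
  0.\<close>

lemma vol_prism:
  assumes L: "convex_body L" and w: "w \<noteq> 0" and Lw: "\<And>x. x \<in> L \<Longrightarrow> x \<bullet> w = \<beta>" and l: "l \<ge> 0"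
  shows "vol (msum L (closed_segment 0 (l *\<^sub>R v))) = l * vol (msum L (closed_segment 0 v))"
proof -
  define G where "G l = msum L (closed_segment 0 (l *\<^sub>R v))" for l
  have body: "convex_body (G l)" for l unfolding G_def by (rule convex_body_msum[OF L convex_body_segment])
  have "vol (G l) = l * vol (G 1)"
  proof (cases "v \<bullet> w = 0")
    case True
    have "vol (G l) = 0" if l0: "l \<ge> 0" for l
    proof (rule vol_hyperplane[OF body w])
      fix x assume "x \<in> G l"
      then obtain y s where "y \<in> L" "x = y + s *\<^sub>R v" unfolding G_def using mem_msum_segment[OF l0, of x L v] by auto
      then show "x \<bullet> w = \<beta>" using Lw True by (simp add: inner_add_left)
    qed
    then show ?thesis using l by simp
  next
    case False
    show ?thesis
    proof (rule additive_bounded_linear[of "\<lambda>l. vol (G l)" 1 "vol (G 1)", OF _ _ _ l])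
      fix x y :: real assume xy: "x \<ge> 0" "y \<ge> 0"
      let ?A = "G x" and ?B = "translate (G y) (x *\<^sub>R v)"
      have un: "G (x + y) = ?A \<union> ?B" unfolding G_def by (rule msum_segment_split[OF xy])
      have int: "?A \<inter> ?B = translate L (x *\<^sub>R v)" unfolding G_def by (rule msum_segment_Int[OF xy Lw False])
      have "vol (translate L (x *\<^sub>R v)) = 0" using vol_hyperplane[OF L w Lw] by (simp add: vol_translate)
      moreover have "measure lebesgue (?A \<union> ?B) = measure lebesgue ?A + measure lebesgue ?B - measure lebesgue (?A \<inter> ?B)"
        by (intro measure_Un3 convex_body_lmeasurable convex_body_translate body)
      ultimately have "vol (G (x + y)) = vol ?A + vol ?B" unfolding un int by (simp add: vol_def)
      then show "vol (G (x + y)) = vol (G x) + vol (G y)" by (simp add: vol_translate)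
    next
      fix x :: real assume x: "0 \<le> x" "x \<le> 1"
      have "G x \<subseteq> G 1" unfolding G_def using mem_msum_segment[OF x(1)] mem_msum_segment[of 1 _ L v] x by fastforce
      then show "\<bar>vol (G x)\<bar> \<le> vol (G 1)" using vol_mono[OF body body] by simp
    qed simp
  qed
  then show ?thesis by (simp add: G_def)
qed

lemma msum_segmentI:
  assumes "y \<in> F" "0 \<le> s" "s \<le> l"
  shows "y + s *\<^sub>R v \<in> msum F (closed_segment 0 (l *\<^sub>R v))"
proof -
  have "0 \<le> l" using assms by simp
  moreover have "s \<in> {0..l}" using assms by simp
  ultimately show ?thesis using assms(1) mem_msum_segment by blast
qed

text \<open>A functional that kills \<open>d\<close> but not \<open>e\<close> bounds the norm when j
  is nonzero; for j = 0 only multiples of \<open>d\<close> remain. The bound keeps the balls in the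
  next proof apart.\<close>

lemma lattice_norm_lower_bound:
  fixes d e :: "'a::euclidean_space"
  assumes "d \<noteq> 0" "e \<notin> span {d}"
  obtains k where "k > 0" "\<And>i j :: int. (i, j) \<noteq> (0, 0) \<Longrightarrow> norm (of_int i *\<^sub>R d + of_int j *\<^sub>R e) \<ge> k"
proof -
  obtain w where w: "\<And>x. x \<in> span {d} \<Longrightarrow> x \<bullet> w = 0" "e \<bullet> w \<noteq> 0" using transverse_functional[OF assms(2)] by blast
  have dw: "d \<bullet> w = 0" using w(1) span_base[of d "{d}"] by simp
  have w0: "norm w > 0" using w(2) by auto
  define k where "k = min (norm d) (\<bar>e \<bullet> w\<bar> / norm w)"
  show ?thesis
  proof (rule that[of k])
    show "k > 0" unfolding k_def using assms(1) w(2) w0 by simp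
    fix i j :: int assume ij: "(i, j) \<noteq> (0, 0)"
    show "norm (of_int i *\<^sub>R d + of_int j *\<^sub>R e) \<ge> k"
    proof (cases "j = 0")
      case True
      then have "\<bar>real_of_int i\<bar> \<ge> 1" using ij by auto
      then have "norm d \<le> \<bar>real_of_int i\<bar> * norm d" using mult_right_mono[of 1 "\<bar>real_of_int i\<bar>" "norm d"] by simp
      then show ?thesis using True by (simp add: k_def)
    next
      case False
      then have j1: "\<bar>real_of_int j\<bar> \<ge> 1" by auto
      have "\<bar>e \<bullet> w\<bar> \<le> \<bar>real_of_int j\<bar> * \<bar>e \<bullet> w\<bar>" using mult_right_mono[OF j1, of "\<bar>e \<bullet> w\<bar>"] by simp
      also have "\<dots> = \<bar>(of_int i *\<^sub>R d + of_int j *\<^sub>R e) \<bullet> w\<bar>" by (simp add: inner_add_left dw abs_mult)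
      also have "\<dots> \<le> norm (of_int i *\<^sub>R d + of_int j *\<^sub>R e) * norm w" by (rule Cauchy_Schwarz_ineq2)
      finally have "\<bar>e \<bullet> w\<bar> / norm w \<le> norm (of_int i *\<^sub>R d + of_int j *\<^sub>R e)" using w0 by (simp add: pos_divide_le_eq)
      then show ?thesis by (simp add: k_def)
    qed
  qed
qed

text \<open>The sum contains about \<open>m\<^sup>2\<close> disjoint translates of a fixed ball.\<close>
lemma vol_quadratic_growth:
  fixes X :: "'a::euclidean_space set"
  assumes X: "convex_body X" "interior X \<noteq> {}" and de: "d \<noteq> 0" "e \<notin> span {d}"
  obtains c where "c > 0" "\<And>m::nat. vol (msum (msum X (closed_segment 0 (real m *\<^sub>R d))) (closed_segment 0 (real m *\<^sub>R e))) \<ge> c * real m ^ 2"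
proof -
  obtain k where k: "k > 0" "\<And>i j :: int. (i, j) \<noteq> (0, 0) \<Longrightarrow> norm (of_int i *\<^sub>R d + of_int j *\<^sub>R e) \<ge> k"
    using lattice_norm_lower_bound[OF de] by blast
  obtain a r where r: "r > 0" "ball a r \<subseteq> X" using X(2) by (meson all_not_in_conv interior_subset mem_interior order_trans)
  define \<rho> where "\<rho> = min r (k / 2)"
  have \<rho>: "\<rho> > 0" "\<rho> \<le> r" "2 * \<rho> \<le> k" unfolding \<rho>_def using r k by auto
  define b where "b = (\<lambda>(i, j). ball (a + real i *\<^sub>R d + real j *\<^sub>R e) \<rho>)"
  show ?thesis
  proof (rule that[of "measure lebesgue (ball a \<rho>)"])
    show "measure lebesgue (ball a \<rho>) > 0" using content_ball_pos[OF \<rho>(1)] by simp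
    fix m :: nat
    let ?M = "msum (msum X (closed_segment 0 (real m *\<^sub>R d))) (closed_segment 0 (real m *\<^sub>R e))"
    let ?I = "{..<m} \<times> {..<m}"
    have "pairwise (\<lambda>p q. disjnt (b p) (b q)) ?I"
    proof (rule pairwiseI)
      fix p q :: "nat \<times> nat" assume "p \<noteq> q"
      obtain i j i' j' where pq: "p = (i, j)" "q = (i', j')" by (cases p, cases q)
      have "norm (of_int (int i - int i') *\<^sub>R d + of_int (int j - int j') *\<^sub>R e) \<ge> k"
        by (rule k(2)) (use \<open>p \<noteq> q\<close> pq in auto)
      then have "dist (a + real i *\<^sub>R d + real j *\<^sub>R e) (a + real i' *\<^sub>R d + real j' *\<^sub>R e) \<ge> 2 * \<rho>"
        using \<rho>(3) by (simp add: dist_norm scaleR_left_diff_distrib algebra_simps)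
      then have "\<rho> + \<rho> \<le> dist (a + real i *\<^sub>R d + real j *\<^sub>R e) (a + real i' *\<^sub>R d + real j' *\<^sub>R e)" by simp
      from disjoint_ballI[OF this] show "disjnt (b p) (b q)" by (simp add: b_def pq disjnt_def)
    qed
    then have "measure lebesgue (\<Union>p\<in>?I. b p) = (\<Sum>p\<in>?I. measure lebesgue (b p))"
      by (intro measure_UNION') (auto simp: b_def)
    also have "\<dots> = (\<Sum>p\<in>?I. measure lebesgue (ball a \<rho>))"
    proof (rule sum.cong[OF refl])
      fix p :: "nat \<times> nat" obtain i j where p: "p = (i, j)" by (cases p)
      have "b p = (+) (real i *\<^sub>R d + real j *\<^sub>R e) ` ball a \<rho>" using ball_translation[of "real i *\<^sub>R d + real j *\<^sub>R e" a \<rho>] by (simp add: b_def p algebra_simps)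
      then show "measure lebesgue (b p) = measure lebesgue (ball a \<rho>)" by (simp only: measure_translation)
    qed
    also have "\<dots> = measure lebesgue (ball a \<rho>) * real m ^ 2" by (simp add: power2_eq_square)
    finally have eq: "measure lebesgue (ball a \<rho>) * real m ^ 2 = measure lebesgue (\<Union>p\<in>?I. b p)" by simp
    have body: "convex_body ?M" by (intro convex_body_msum X convex_body_segment)
    have "b p \<subseteq> ?M" if pI: "p \<in> ?I" for p
    proof
      obtain i j where p: "p = (i, j)" "i < m" "j < m" using pI by auto
      fix x assume "x \<in> b p"
      then have "x - real i *\<^sub>R d - real j *\<^sub>R e \<in> ball a r"
        using \<rho>(2) unfolding b_def p by (simp add: dist_norm algebra_simps)
      then have "x - real i *\<^sub>R d - real j *\<^sub>R e \<in> X" using r(2) by blast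
      then have "(x - real i *\<^sub>R d - real j *\<^sub>R e) + real i *\<^sub>R d \<in> msum X (closed_segment 0 (real m *\<^sub>R d))"
        using p(2) by (intro msum_segmentI) auto
      then have "(x - real j *\<^sub>R e) \<in> msum X (closed_segment 0 (real m *\<^sub>R d))" by simp
      then have "(x - real j *\<^sub>R e) + real j *\<^sub>R e \<in> ?M"
        using p(3) by (intro msum_segmentI) auto
      then show "x \<in> ?M" by simp
    qed
    then have "measure lebesgue (\<Union>p\<in>?I. b p) \<le> measure lebesgue ?M"
      by (intro measure_mono_fmeasurable convex_body_lmeasurable[OF body] sets.finite_UN) (auto simp: b_def)
    then show "measure lebesgue (ball a \<rho>) * real m ^ 2 \<le> vol ?M" unfolding eq vol_def .
  qed
qed

text \<open>Scaling all n edges by \<open>m\<close> lengthens the edge \<open>v\<close> by the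
  factor m and multiplies its slope by at most m^(n-1), while the base \<open>para vs\<close> has
  volume 0 and disappears after division by m^n. Applied to \<open>om\<close>, a vanishing slope
  bounds the volume coefficient by 0.\<close>

lemma slope_volume_le:
  fixes f :: "'a::euclidean_space set \<Rightarrow> real"
  assumes f: "real_val f" and nn: "\<And>K. convex_body K \<Longrightarrow> f K \<ge> 0"
    and lim: "\<And>K. convex_body K \<Longrightarrow> (\<lambda>m. f ((*\<^sub>R) (real m) ` K) / real m ^ DIM('a)) \<longlonglongrightarrow> c * vol K"
    and i: "indep (v # vs)" and len: "length (v # vs) = DIM('a)"
  shows "c * vol (para (v # vs)) \<le> slope f vs v"
proof -
  let ?n = "DIM('a)"
  have iv: "indep vs" using indep_ConsD(1)[OF i] .
  have l1: "(\<lambda>m. f ((*\<^sub>R) (real m) ` para (v # vs)) / real m ^ ?n) \<longlonglongrightarrow> c * vol (para (v # vs))"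
    by (rule lim[OF convex_body_para])
  have "(\<lambda>m. f ((*\<^sub>R) (real m) ` para vs) / real m ^ ?n) \<longlonglongrightarrow> c * vol (para vs)"
    by (rule lim[OF convex_body_para])
  moreover have "vol (para vs) = 0" using len by (intro vol_para_low) simp
  ultimately have l2: "(\<lambda>m. f ((*\<^sub>R) (real m) ` para vs) / real m ^ ?n + slope f vs v) \<longlonglongrightarrow> 0 + slope f vs v"
    by (intro tendsto_add tendsto_const) simp
  have "\<forall>\<^sub>F m in sequentially. f ((*\<^sub>R) (real m) ` para (v # vs)) / real m ^ ?n \<le> f ((*\<^sub>R) (real m) ` para vs) / real m ^ ?n + slope f vs v"
    using eventually_ge_at_top[of 1]
  proof eventually_elim
    case (elim m)
    then have m: "real m \<ge> 1" by simp
    let ?vs = "map ((*\<^sub>R) (real m)) vs"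
    have "indep (v # ?vs)" using indep_scale_prefix[of "real m" vs "[v]"] i m by (simp add: indep_middle)
    then have nv: "v \<notin> span (set ?vs)" by (rule indep_ConsD(2))
    have "f ((*\<^sub>R) (real m) ` para (v # vs)) = f (para ((real m *\<^sub>R v) # ?vs))" by (simp only: scale_para list.map)
    also have "\<dots> = f (para ?vs) + real m * slope f ?vs v"
      using para_affine[OF f nv, of "real m"] by (simp add: slope_def)
    also have "\<dots> \<le> f (para ?vs) + real m * (real m ^ length vs * slope f vs v)"
      using slope_scale_prefix_le[OF f nn m, of v vs "[]"] i m by (intro add_left_mono mult_left_mono) auto
    also have "real m * (real m ^ length vs * slope f vs v) = real m ^ ?n * slope f vs v"
      using len by (simp add: mult.assoc flip: power_Suc)
    finally have "f ((*\<^sub>R) (real m) ` para (v # vs)) \<le> f ((*\<^sub>R) (real m) ` para vs) + real m ^ ?n * slope f vs v"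
      by (simp only: scale_para)
    then have "f ((*\<^sub>R) (real m) ` para (v # vs)) / real m ^ ?n
       \<le> (f ((*\<^sub>R) (real m) ` para vs) + real m ^ ?n * slope f vs v) / real m ^ ?n"
      by (rule divide_right_mono) simp
    then show ?case using m by (simp add: add_divide_distrib)
  qed
  then show ?thesis using tendsto_le[OF _ l2 l1] by simp
qed

text \<open>\<open>L\<close> already spans a hyperplane, and two points of \<open>M\<close> at
  different heights over it add the missing dimension.\<close>

lemma aff_dim_msum_transverse:
  fixes L M :: "'a::euclidean_space set"
  assumes L: "aff_dim L = int DIM('a) - 1" "\<And>x. x \<in> L \<Longrightarrow> x \<bullet> w = \<beta>" and x: "x \<in> M" "y \<in> M" "x \<bullet> w \<noteq> y \<bullet> w"
  shows "aff_dim (msum L M) = int DIM('a)"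
proof -
  have tr: "translate L x = (+) x ` L" unfolding translate_def by (simp add: add.commute)
  have Lne: "L \<noteq> {}" using L(1) by force
  then obtain l where l: "l \<in> L" by blast
  have "affine hull (translate L x) \<subset> affine hull (msum L M)"
  proof
    show "affine hull (translate L x) \<subseteq> affine hull (msum L M)"
      by (rule hull_mono) (use x in \<open>auto simp: translate_def msum_def\<close>)
    have "translate L x \<subseteq> {z. w \<bullet> z = \<beta> + x \<bullet> w}"
      using L(2) by (auto simp: translate_def inner_add_left inner_commute[of w])
    then have "affine hull (translate L x) \<subseteq> {z. w \<bullet> z = \<beta> + x \<bullet> w}"
      by (rule hull_minimal) (rule affine_hyperplane)
    moreover have "(l + y) \<bullet> w \<noteq> \<beta> + x \<bullet> w" using L(2)[OF l] x(3) by (simp add: inner_add_left)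
    moreover have "l + y \<in> affine hull (msum L M)" by (rule hull_inc) (use l x in \<open>auto simp: msum_def\<close>)
    ultimately show "affine hull (translate L x) \<noteq> affine hull (msum L M)" by (auto simp: inner_commute[of w])
  qed
  then have "aff_dim (translate L x) < aff_dim (msum L M)" by (rule aff_dim_psubset)
  moreover have "aff_dim (translate L x) = aff_dim L" unfolding tr by (rule aff_dim_translation_eq)
  ultimately show ?thesis using L(1) aff_dim_le_DIM[of "msum L M"] by linarith
qed

lemma collinear_body_segment:
  fixes E :: "'a::euclidean_space set"
  assumes E: "convex_body E" and xy: "x \<in> E" "y \<in> E" "x \<bullet> w < y \<bullet> w"
    and ext: "\<And>z. z \<in> E \<Longrightarrow> x \<bullet> w \<le> z \<bullet> w \<and> z \<bullet> w \<le> y \<bullet> w"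
    and line: "\<And>z. z \<in> E \<Longrightarrow> z - x \<in> span {y - x}"
  shows "E = closed_segment x y"
proof
  show "closed_segment x y \<subseteq> E" using E xy by (simp add: convex_body_def closed_segment_subset)
  show "E \<subseteq> closed_segment x y"
  proof
    fix z assume z: "z \<in> E"
    obtain k where k: "z - x = k *\<^sub>R (y - x)" using line[OF z] by (auto simp: span_singleton)
    have p: "(y - x) \<bullet> w > 0" using xy(3) by (simp add: inner_diff_left)
    have "(z - x) \<bullet> w = k * ((y - x) \<bullet> w)" using k by simp
    moreover have "0 \<le> (z - x) \<bullet> w" "(z - x) \<bullet> w \<le> (y - x) \<bullet> w" using ext[OF z] by (simp_all add: inner_diff_left)
    ultimately have "0 \<le> k" "k \<le> 1" using p by (auto simp: zero_le_mult_iff)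
    moreover have "z = (1 - k) *\<^sub>R x + k *\<^sub>R y" using k by (simp add: algebra_simps)
    ultimately show "z \<in> closed_segment x y" unfolding in_segment by blast
  qed
qed

lemma span_singletonI_orthogonal:
  fixes d e :: "'a::euclidean_space"
  assumes "\<And>u. u \<bullet> d = 0 \<Longrightarrow> u \<bullet> e = 0"
  shows "e \<in> span {d}"
proof (rule ccontr)
  assume "e \<notin> span {d}"
  then obtain w where w: "\<And>x. x \<in> span {d} \<Longrightarrow> x \<bullet> w = 0" "e \<bullet> w \<noteq> 0" using transverse_functional by blast
  have "w \<bullet> d = 0" using w(1)[of d] span_base[of d "{d}"] by (simp add: inner_commute)
  then show False using assms[of w] w(2) by (simp add: inner_commute)
qed

subsection \<open>Minkowski valuations\<close>

locale mink_val =
  fixes \<Phi> :: "'a::euclidean_space set \<Rightarrow> 'a set"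
  assumes bodies: "maps_bodies \<Phi>" and cont: "mink_continuous \<Phi>"
    and trans: "mink_trans_inv \<Phi>" and val: "mink_valuation \<Phi>"
begin

lemma body [simp]: "convex_body K \<Longrightarrow> convex_body (\<Phi> K)"
  using bodies unfolding maps_bodies_def by blast

definition h :: "'a \<Rightarrow> 'a set \<Rightarrow> real" where
  "h u K = supp (\<Phi> K) u"

lemma real_val_h: "real_val (h u)"
  unfolding real_val_def
proof (intro conjI allI impI)
  fix K L :: "'a set" assume *: "convex_body K \<and> convex_body L \<and> convex_body (K \<union> L)"
  then have "convex_body (K \<inter> L)" using convex_body_Int_of_Un by blast
  moreover have "msum (\<Phi> K) (\<Phi> L) = msum (\<Phi> (K \<union> L)) (\<Phi> (K \<inter> L))" using val * unfolding mink_valuation_def by blast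
  then have "supp (msum (\<Phi> K) (\<Phi> L)) u = supp (msum (\<Phi> (K \<union> L)) (\<Phi> (K \<inter> L))) u" by simp
  ultimately show "h u K + h u L = h u (K \<union> L) + h u (K \<inter> L)" using * by (simp add: h_def supp_msum)
next
  fix K :: "'a set" and t assume "convex_body K"
  then show "h u (translate K t) = h u K" using trans unfolding mink_trans_inv_def h_def by simp
next
  fix K :: "'a set" and e :: real assume *: "convex_body K \<and> 0 < e"
  have pos: "norm u + 1 > 0" by (simp add: add_nonneg_pos)
  then have "e / (norm u + 1) > 0" using * by simp
  then have "\<exists>d>0. \<forall>K'. convex_body K' \<and> hausdist K K' < d \<longrightarrow> hausdist (\<Phi> K) (\<Phi> K') < e / (norm u + 1)"
    using cont[unfolded mink_continuous_def, THEN spec[of _ K], THEN spec[of _ "e / (norm u + 1)"]] * by simp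
  then obtain d where d: "d > 0" "\<forall>K'. convex_body K' \<and> hausdist K K' < d \<longrightarrow> hausdist (\<Phi> K) (\<Phi> K') < e / (norm u + 1)"
    by (elim exE conjE)
  show "\<exists>d>0. \<forall>K'. convex_body K' \<and> hausdist K K' < d \<longrightarrow> \<bar>h u K - h u K'\<bar> < e"
  proof (intro exI[of _ d] conjI allI impI)
    fix K' assume K': "convex_body K' \<and> hausdist K K' < d"
    then have hd: "hausdist (\<Phi> K) (\<Phi> K') < e / (norm u + 1)" using d(2) by simp
    have "\<bar>h u K - h u K'\<bar> \<le> norm u * hausdist (\<Phi> K) (\<Phi> K')"
      unfolding h_def using * K' by (intro supp_hausdist) auto
    also have "\<dots> \<le> (norm u + 1) * hausdist (\<Phi> K) (\<Phi> K')"
      using * K' by (intro mult_right_mono hausdist_nonneg) auto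
    also have "\<dots> < e" using hd pos by (simp add: pos_less_divide_eq mult.commute)
    finally show "\<bar>h u K - h u K'\<bar> < e" .
  qed (use d in auto)
qed

text \<open>The defect of additivity of the support function. For v = -u it is the width of
  \<open>\<Phi> K\<close> in direction \<open>u\<close>, because the support function vanishes at
  0.\<close>

definition om :: "'a \<Rightarrow> 'a \<Rightarrow> 'a set \<Rightarrow> real" where
  "om u v K = h u K + h v K - h (u + v) K"

lemma real_val_om: "real_val (om u v)"
  unfolding om_def by (intro real_val_diff real_val_add real_val_h)

lemma om_nonneg: "convex_body K \<Longrightarrow> om u v K \<ge> 0"
  unfolding om_def h_def using supp_subadd[of "\<Phi> K" u v] by simp

lemma h_zero [simp]: "convex_body K \<Longrightarrow> h 0 K = 0"
  by (simp add: h_def supp_0_arg)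

lemma slope_om: "slope (om u v) vs x = slope (h u) vs x + slope (h v) vs x - slope (h (u + v)) vs x"
  by (simp add: slope_def om_def)

text \<open>Nonnegative slopes of \<open>om\<close> say that the increment of the support function
  is subadditive in \<open>u\<close>, hence is itself a support function: along each edge
  \<open>\<Phi>\<close> grows by a Minkowski summand.\<close>

lemma slope_body:
  assumes v: "v \<notin> span (set vs)"
  shows "\<exists>E. convex_body E \<and> (\<forall>u. supp E u = slope (h u) vs v)"
proof (rule sublinear_body[of "\<lambda>u. slope (h u) vs v"])
  fix u1 u2
  have "0 \<le> slope (om u1 u2) vs v" by (rule slope_nonneg[OF real_val_om om_nonneg v])
  then show "slope (h (u1 + u2)) vs v \<le> slope (h u1) vs v + slope (h u2) vs v" by (simp add: slope_om)
next
  fix r :: real and u assume "r \<ge> 0"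
  then show "slope (h (r *\<^sub>R u)) vs v = r * slope (h u) vs v"
    unfolding slope_def h_def by (simp add: supp_scale_arg right_diff_distrib del: para.simps)
next
  fix E assume "convex_body E" "\<And>u. supp E u = slope (h u) vs v"
  then show ?thesis by blast
qed

lemma Phi_para_Cons:
  assumes v: "v \<notin> span (set vs)" and E: "convex_body E" "\<And>u. supp E u = slope (h u) vs v" and l: "l \<ge> 0"
  shows "\<Phi> (para ((l *\<^sub>R v) # vs)) = msum (\<Phi> (para vs)) ((*\<^sub>R) l ` E)"
proof (rule body_eq_supp)
  show "convex_body (\<Phi> (para ((l *\<^sub>R v) # vs)))" by (rule body[OF convex_body_para])
  show "convex_body (msum (\<Phi> (para vs)) ((*\<^sub>R) l ` E))"
    by (intro convex_body_msum convex_body_scale E body convex_body_para)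
  fix u
  have "supp (\<Phi> (para ((l *\<^sub>R v) # vs))) u = h u (para vs) + l * slope (h u) vs v"
    using para_affine[OF real_val_h[of u] v l] by (simp add: h_def slope_def)
  then show "supp (\<Phi> (para ((l *\<^sub>R v) # vs))) u = supp (msum (\<Phi> (para vs)) ((*\<^sub>R) l ` E)) u"
    using E l by (simp add: supp_msum supp_scale_body convex_body_scale h_def)
qed

lemma Phi_para_summand:
  assumes "indep vs"
  shows "\<exists>G. convex_body G \<and> \<Phi> (para vs) = msum (\<Phi> {0}) G"
  using assms
proof (induction vs)
  case Nil
  then show ?case by (intro exI[of _ "{0}"]) (simp add: msum_singleton translate_def)
next
  case (Cons v vs)
  obtain G where G: "convex_body G" "\<Phi> (para vs) = msum (\<Phi> {0}) G" using Cons indep_ConsD(1) by blast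
  obtain E where E: "convex_body E" "\<And>u. supp E u = slope (h u) vs v" using slope_body[OF indep_ConsD(2)[OF Cons.prems]] by blast
  have "\<Phi> (para (v # vs)) = msum (msum (\<Phi> {0}) G) E"
    using Phi_para_Cons[OF indep_ConsD(2)[OF Cons.prems] E, of 1] G by simp
  then show ?case using G(1) E(1) convex_body_msum by (intro exI[of _ "msum G E"]) (simp add: msum_assoc)
qed

end

section \<open>Consequences of the volume bounds\<close>

locale mink_val_VC = mink_val +
  fixes w :: 'a and \<beta> C :: real
  assumes dim_L: "aff_dim (\<Phi> {0}) = int DIM('a) - 1" and w0: "w \<noteq> 0"
    and L_hyp: "\<And>x. x \<in> \<Phi> {0} \<Longrightarrow> x \<bullet> w = \<beta>"
    and VC_upper: "\<And>K. convex_body K \<Longrightarrow> vol (\<Phi> K) \<le> C * vol K" and C_pos: "C > 0"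
    and VC_lower: "\<And>K. convex_body K \<Longrightarrow> vol K > 0 \<Longrightarrow> vol (\<Phi> K) > 0"
begin

text \<open>\<open>\<Phi> {0}\<close> spans a hyperplane with normal \<open>w\<close>. If the other
  summand \<open>G\<close> had positive width in direction \<open>w\<close>, the sum would have
  interior, against the upper volume bound for a flat parallelepiped.\<close>

lemma om_w_low:
  assumes vs: "indep vs" "length vs < DIM('a)"
  shows "om w (- w) (para vs) = 0"
proof -
  obtain G where G: "convex_body G" "\<Phi> (para vs) = msum (\<Phi> {0}) G" using Phi_para_summand[OF vs(1)] by blast
  have b: "convex_body (msum (\<Phi> {0}) G)" by (intro convex_body_msum body convex_body_singleton G)
  have "vol (msum (\<Phi> {0}) G) = 0"
    using VC_upper[OF convex_body_para, of vs] vol_para_low[OF vs(2)] vol_nonneg[of "msum (\<Phi> {0}) G"] G(2) by simp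
  then have "aff_dim (msum (\<Phi> {0}) G) \<noteq> int DIM('a)" using vol_pos_iff[OF b] by simp
  then have hor: "x \<bullet> w = y \<bullet> w" if "x \<in> G" "y \<in> G" for x y
    using aff_dim_msum_transverse[OF dim_L L_hyp that] by blast
  obtain g where g: "g \<in> G" using G(1) by (auto simp: convex_body_def)
  have "supp G w = g \<bullet> w" using hor g by (intro supp_eqI[OF G(1) g]) (metis order_refl)
  moreover have "supp G (- w) = g \<bullet> (- w)" using hor g by (intro supp_eqI[OF G(1) g]) (metis inner_minus_right order_refl)
  moreover obtain l where l: "l \<in> \<Phi> {0}" using body[OF convex_body_singleton, of 0] by (auto simp: convex_body_def)
  have "supp (\<Phi> {0}) w = l \<bullet> w" using L_hyp l by (intro supp_eqI body convex_body_singleton) auto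
  moreover have "supp (\<Phi> {0}) (- w) = l \<bullet> (- w)" using L_hyp l by (intro supp_eqI body convex_body_singleton) auto
  ultimately show ?thesis by (simp add: om_def h_def G supp_msum body supp_0_arg b)
qed

text \<open>The width in direction \<open>w\<close> vanishes on flat parallelepipeds and is
  nonnegative, hence is a multiple of volume. The factor is positive since an image of the unit ball
  with zero width would have volume 0, against the lower bound.\<close>

lemma om_w_volume:
  obtains \<tau> where "\<tau> > 0" "\<And>K. convex_body K \<Longrightarrow> om w (- w) K = \<tau> * vol K"
proof -
  obtain \<tau> where \<tau>: "\<And>K. convex_body K \<Longrightarrow> om w (- w) K = \<tau> * vol K"
    using zero_low_dim_imp_volume[OF real_val_om om_nonneg om_w_low] by blast
  have K: "convex_body (cball (0::'a) 1)" by (simp add: convex_body_def)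
  have v: "vol (cball (0::'a) 1) > 0" using vol_eq_0_iff[OF K] vol_nonneg[of "cball (0::'a) 1"] by (simp add: less_le)
  have "\<tau> * vol (cball (0::'a) 1) \<ge> 0" using om_nonneg[OF K, of w "- w"] \<tau>[OF K] by simp
  then have "\<tau> \<ge> 0" using v by (simp add: zero_le_mult_iff)
  moreover have "\<tau> \<noteq> 0"
  proof
    assume "\<tau> = 0"
    then have eq: "supp (\<Phi> (cball 0 1)) w + supp (\<Phi> (cball 0 1)) (- w) = 0" using \<tau>[OF K] K by (simp add: om_def h_def supp_0_arg)
    have "vol (\<Phi> (cball 0 1)) = 0"
    proof (rule vol_hyperplane[OF body[OF K] w0])
      fix x assume "x \<in> \<Phi> (cball 0 1)"
      then have "x \<bullet> w \<le> supp (\<Phi> (cball 0 1)) w" "x \<bullet> (- w) \<le> supp (\<Phi> (cball 0 1)) (- w)"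
        using supp_ge[OF body[OF K]] by blast+
      then show "x \<bullet> w = supp (\<Phi> (cball 0 1)) w" using eq by simp
    qed
    then show False using VC_lower[OF K v] by simp
  qed
  ultimately have "\<tau> > 0" by simp
  then show ?thesis using \<tau> by (rule that)
qed

definition \<tau> :: real where
  "\<tau> = (SOME t. t > 0 \<and> (\<forall>K. convex_body K \<longrightarrow> om w (- w) K = t * vol K))"

lemma \<tau>: "\<tau> > 0" "convex_body K \<Longrightarrow> om w (- w) K = \<tau> * vol K"
proof -
  have "\<exists>t. t > 0 \<and> (\<forall>K. convex_body K \<longrightarrow> om w (- w) K = t * vol K)" using om_w_volume by metis
  then have "\<tau> > 0 \<and> (\<forall>K. convex_body K \<longrightarrow> om w (- w) K = \<tau> * vol K)" unfolding \<tau>_def by (rule someI_ex)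
  then show "\<tau> > 0" "convex_body K \<Longrightarrow> om w (- w) K = \<tau> * vol K" by blast+
qed

text \<open>Otherwise \<open>E\<close> would contain a triangle, and the volume of \<open>\<Phi>\<close> on a prism
  would grow quadratically in the height of the prism.\<close>
lemma top_slope_collinear:
  assumes i: "indep (v # vs)" and len: "length (v # vs) = DIM('a)"
    and E: "convex_body E" "\<And>u. supp E u = slope (h u) vs v"
    and xyz: "x \<in> E" "y \<in> E" "x \<bullet> w \<noteq> y \<bullet> w" "z \<in> E"
  shows "z - x \<in> span {y - x}"
proof (rule ccontr)
  assume ne: "z - x \<notin> span {y - x}"
  have v: "v \<notin> span (set vs)" by (rule indep_ConsD(2)[OF i])
  obtain G where G: "convex_body G" "\<Phi> (para vs) = msum (\<Phi> {0}) G" using Phi_para_summand[OF indep_ConsD(1)[OF i]] by blast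
  obtain g where g: "g \<in> G" using G(1) by (auto simp: convex_body_def)
  \<comment> \<open>One copy of the side y - x thickens \<open>\<Phi> {0}\<close> to a body with
    interior, as \<open>vol_quadratic_growth\<close> requires.\<close>
  define X where "X = msum (\<Phi> {0}) (closed_segment 0 (y - x))"
  have X: "convex_body X" unfolding X_def by (intro convex_body_msum body convex_body_singleton convex_body_segment)
  have "aff_dim X = int DIM('a)" unfolding X_def
    by (rule aff_dim_msum_transverse[OF dim_L L_hyp, of 0 _ "y - x"]) (use xyz(3) in \<open>auto simp: inner_diff_left\<close>)
  then have "interior X \<noteq> {}" using interior_nonempty_iff_aff_dim[OF X] by blast
  moreover have "y - x \<noteq> 0" using xyz(3) by auto
  ultimately obtain c where c: "c > 0" "\<And>m::nat. vol (msum (msum X (closed_segment 0 (real m *\<^sub>R (y - x)))) (closed_segment 0 (real m *\<^sub>R (z - x)))) \<ge> c * real m ^ 2"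
    using vol_quadratic_growth[OF X _ _ ne] by blast
  have upper: "c * real k ^ 2 \<le> C * (2 * (real k + 1) * vol (para (v # vs)))" if k: "k \<ge> 1" for k :: nat
  proof -
    let ?A = "msum (msum X (closed_segment 0 (real k *\<^sub>R (y - x)))) (closed_segment 0 (real k *\<^sub>R (z - x)))"
    \<comment> \<open>Height of the prism: M = 2 (k+1) leaves room for the thickening and up to k
      copies of each of the two sides, so that both weights \<open>a\<close> and \<open>b\<close>
      below are at most 1/2.\<close>
    define M where "M = 2 * (real k + 1)"
    have M: "M > 0" unfolding M_def by simp
    have A: "convex_body ?A" by (intro convex_body_msum X convex_body_segment)
    have PM: "\<Phi> (para ((M *\<^sub>R v) # vs)) = msum (msum (\<Phi> {0}) G) ((*\<^sub>R) M ` E)"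
      using Phi_para_Cons[OF v E, of M] M G by simp
    have "translate ?A (g + M *\<^sub>R x) \<subseteq> \<Phi> (para ((M *\<^sub>R v) # vs))"
    proof
      fix p assume "p \<in> translate ?A (g + M *\<^sub>R x)"
      then obtain q where q: "q \<in> ?A" "p = q + (g + M *\<^sub>R x)" unfolding translate_def by blast
      obtain q1 t where t: "q1 \<in> msum X (closed_segment 0 (real k *\<^sub>R (y - x)))" "0 \<le> t" "t \<le> real k" "q = q1 + t *\<^sub>R (z - x)"
        using q(1) mem_msum_segment[of "real k" q _ "z - x"] by auto
      obtain q2 s where s: "q2 \<in> X" "0 \<le> s" "s \<le> real k" "q1 = q2 + s *\<^sub>R (y - x)"
        using t(1) mem_msum_segment[of "real k" q1 X "y - x"] by auto
      obtain l s0 where l: "l \<in> \<Phi> {0}" "0 \<le> s0" "s0 \<le> 1" "q2 = l + s0 *\<^sub>R (y - x)"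
        using s(1) mem_msum_segment[of 1 q2 "\<Phi> {0}" "y - x"] unfolding X_def by auto
      define a b where "a = (s0 + s) / M" and "b = t / M"
      have ab: "0 \<le> a" "0 \<le> b" "a \<le> 1 / 2" "b \<le> 1 / 2" "M * a = s0 + s" "M * b = t"
        using s l t M by (auto simp: a_def b_def M_def field_simps)
      have "(1 - a - b) *\<^sub>R x + a *\<^sub>R y + b *\<^sub>R z \<in> E"
      proof -
        have "(1 - a - b) *\<^sub>R x + a *\<^sub>R y + b *\<^sub>R z \<in> convex hull {x, y, z}"
          unfolding convex_hull_3
          by (intro CollectI exI[of _ "1 - a - b"] exI[of _ a] exI[of _ b]) (use ab in auto)
        moreover have "convex hull {x, y, z} \<subseteq> E"
          using E(1) xyz by (intro hull_minimal) (auto simp: convex_body_def)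
        ultimately show ?thesis by blast
      qed
      moreover have "M *\<^sub>R ((1 - a - b) *\<^sub>R x + a *\<^sub>R y + b *\<^sub>R z) = M *\<^sub>R x + (M * a) *\<^sub>R (y - x) + (M * b) *\<^sub>R (z - x)"
        by (simp add: algebra_simps)
      then have "p = (l + g) + M *\<^sub>R ((1 - a - b) *\<^sub>R x + a *\<^sub>R y + b *\<^sub>R z)"
        unfolding q(2) t(4) s(4) l(4) ab by (simp add: algebra_simps)
      ultimately show "p \<in> \<Phi> (para ((M *\<^sub>R v) # vs))" unfolding PM using l(1) g unfolding msum_def by blast
    qed
    then have "vol (translate ?A (g + M *\<^sub>R x)) \<le> vol (\<Phi> (para ((M *\<^sub>R v) # vs)))"
      by (intro vol_mono convex_body_translate A body convex_body_para)
    also have "\<dots> \<le> C * vol (para ((M *\<^sub>R v) # vs))" by (rule VC_upper[OF convex_body_para])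
    also have "vol (para ((M *\<^sub>R v) # vs)) = M * vol (para (v # vs))"
    proof -
      obtain w' where w': "\<And>x. x \<in> span (set vs) \<Longrightarrow> x \<bullet> w' = 0" "v \<bullet> w' \<noteq> 0" using transverse_functional[OF v] by blast
      then have "w' \<noteq> 0" by auto
      then show ?thesis unfolding para.simps
        by (rule vol_prism[OF convex_body_para, of w' _ 0]) (use w'(1) para_span M in auto)
    qed
    finally show ?thesis using c(2)[of k] by (simp add: vol_translate M_def)
  qed
  \<comment> \<open>The linear bound loses against quadratic growth. Besides the 2 in
    \<open>M\<close>, estimating k + 1 by 2 k costs another factor 2.\<close>
  obtain k :: nat where k: "real k > 4 * C * vol (para (v # vs)) / c" using reals_Archimedean2 by blast
  have "4 * C * vol (para (v # vs)) / c \<ge> 0" using C_pos c(1) by simp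
  then have k1: "k \<ge> 1" using k by (cases k) auto
  have "c * real k ^ 2 \<le> C * (2 * (real k + 1) * vol (para (v # vs)))" by (rule upper[OF k1])
  also have "\<dots> \<le> C * (2 * (real k + real k) * vol (para (v # vs)))"
    using k1 C_pos by (intro mult_left_mono mult_right_mono) auto
  also have "\<dots> = (4 * C * vol (para (v # vs))) * real k" by simp
  finally have "(c * real k) * real k \<le> (4 * C * vol (para (v # vs))) * real k" by (simp add: power2_eq_square mult.assoc)
  then have "c * real k \<le> 4 * C * vol (para (v # vs))" using k1 by simp
  then show False using k c(1) by (simp add: pos_divide_less_eq mult.commute)
qed

text \<open>\<open>x\<close> and \<open>y\<close> are points where the increment body is extreme in
  the directions -w and w. Collinearity makes it the segment between them, and its width is the
  increment of the width of \<open>\<Phi>\<close>, which is known through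
  \<open>\<tau>\<close>.\<close>

lemma top_slope_segment:
  assumes i: "indep (v # vs)" and len: "length (v # vs) = DIM('a)"
  obtains x y where "\<And>u. slope (h u) vs v = max (x \<bullet> u) (y \<bullet> u)" "(y - x) \<bullet> w = \<tau> * vol (para (v # vs))"
proof -
  obtain E where E: "convex_body E" "\<And>u. supp E u = slope (h u) vs v"
    using slope_body[OF indep_ConsD(2)[OF i]] by blast
  obtain y where y: "y \<in> E" "y \<bullet> w = supp E w" "\<And>z. z \<in> E \<Longrightarrow> z \<bullet> w \<le> supp E w" using supp_attained[OF E(1)] by blast
  obtain x where x: "x \<in> E" "x \<bullet> (- w) = supp E (- w)" "\<And>z. z \<in> E \<Longrightarrow> z \<bullet> (- w) \<le> supp E (- w)" using supp_attained[OF E(1)] by blast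
  have "(y - x) \<bullet> w = slope (om w (- w)) vs v"
    using y(2) x(2) E(2) by (simp add: slope_om inner_diff_left) (simp add: slope_def del: para.simps)
  also have "\<dots> = \<tau> * vol (para (v # vs))"
    using om_w_low[OF indep_ConsD(1)[OF i]] len \<tau>(2)[OF convex_body_para, of "v # vs"] by (simp add: slope_def)
  finally have yx: "(y - x) \<bullet> w = \<tau> * vol (para (v # vs))" .
  then have pos: "(y - x) \<bullet> w > 0" using \<tau>(1) vol_para_pos[OF i len] by simp
  then have lt: "x \<bullet> w < y \<bullet> w" by (simp add: inner_diff_left)
  have "E = closed_segment x y"
  proof (rule collinear_body_segment[OF E(1) x(1) y(1) lt])
    show "x \<bullet> w \<le> z \<bullet> w \<and> z \<bullet> w \<le> y \<bullet> w" if "z \<in> E" for z using x(2) x(3)[OF that] y(2) y(3)[OF that] by simp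
    show "z - x \<in> span {y - x}" if "z \<in> E" for z
      by (rule top_slope_collinear[OF i len E x(1) y(1) _ that]) (use lt in simp)
  qed
  then have "slope (h u) vs v = max (x \<bullet> u) (y \<bullet> u)" for u using E(2)[of u] supp_segment[of x y u] by simp
  then show ?thesis using yx that by blast
qed

end

section \<open>The coefficient of order n and its segment\<close>

context mink_val_VC
begin

lemma top_list:
  obtains v and vs :: "'a list" where "indep (v # vs)" "length (v # vs) = DIM('a)"
proof -
  obtain bs :: "'a list" where bs: "set bs = Basis" "distinct bs" using finite_distinct_list[OF finite_Basis] by blast
  have len: "length bs = DIM('a)" using bs distinct_card by fastforce
  have i: "indep bs" using bs independent_Basis by (simp add: indep_def)
  show ?thesis
  proof (cases bs)
    case Nil
    then show ?thesis using len DIM_positive[where 'a = 'a] by simp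
  next
    case (Cons v vs)
    then show ?thesis using that i len by blast
  qed
qed

text \<open>The volume coefficient of \<open>h u\<close>. As a function of \<open>u\<close> it will
  be the support function of the segment S.\<close>

definition s :: "'a \<Rightarrow> real" where
  "s u = (SOME c. \<forall>K. convex_body K \<longrightarrow> (\<lambda>m. h u ((*\<^sub>R) (real m) ` K) / real m ^ DIM('a)) \<longlonglongrightarrow> c * vol K)"

lemma s_lim:
  assumes "convex_body K"
  shows "(\<lambda>m. h u ((*\<^sub>R) (real m) ` K) / real m ^ DIM('a)) \<longlonglongrightarrow> s u * vol K"
proof -
  have "\<exists>c. \<forall>K. convex_body K \<longrightarrow> (\<lambda>m. h u ((*\<^sub>R) (real m) ` K) / real m ^ DIM('a)) \<longlonglongrightarrow> c * vol K"
    by (rule real_val_asymptotics[OF real_val_h[of u]]) blast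
  then have "\<forall>K. convex_body K \<longrightarrow> (\<lambda>m. h u ((*\<^sub>R) (real m) ` K) / real m ^ DIM('a)) \<longlonglongrightarrow> s u * vol K"
    unfolding s_def by (rule someI_ex)
  then show ?thesis using assms by blast
qed

lemma s_unique:
  assumes "\<And>K. convex_body K \<Longrightarrow> (\<lambda>m. h u ((*\<^sub>R) (real m) ` K) / real m ^ DIM('a)) \<longlonglongrightarrow> c * vol K"
  shows "s u = c"
proof -
  obtain v and vs :: "'a list" where i: "indep (v # vs)" "length (v # vs) = DIM('a)" by (rule top_list)
  have "s u * vol (para (v # vs)) = c * vol (para (v # vs))"
    by (rule LIMSEQ_unique[OF s_lim[OF convex_body_para] assms[OF convex_body_para]])
  then show ?thesis using vol_para_pos[OF i] by simp
qed

lemma om_lim: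
  assumes K: "convex_body K"
  shows "(\<lambda>m. om u v ((*\<^sub>R) (real m) ` K) / real m ^ DIM('a)) \<longlonglongrightarrow> (s u + s v - s (u + v)) * vol K"
proof -
  have "(\<lambda>m. h u ((*\<^sub>R) (real m) ` K) / real m ^ DIM('a) + h v ((*\<^sub>R) (real m) ` K) / real m ^ DIM('a)
      - h (u + v) ((*\<^sub>R) (real m) ` K) / real m ^ DIM('a)) \<longlonglongrightarrow> s u * vol K + s v * vol K - s (u + v) * vol K"
    by (intro tendsto_diff tendsto_add s_lim K)
  then show ?thesis by (simp add: om_def add_divide_distrib diff_divide_distrib algebra_simps)
qed

lemma om_lim_nonneg: "0 \<le> s u + s v - s (u + v)"
proof -
  obtain x and vs :: "'a list" where i: "indep (x # vs)" "length (x # vs) = DIM('a)" by (rule top_list)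
  have "0 \<le> (s u + s v - s (u + v)) * vol (para (x # vs))"
    by (rule tendsto_lowerbound[OF om_lim[OF convex_body_para]])
      (auto intro!: always_eventually divide_nonneg_nonneg om_nonneg convex_body_scale simp del: para.simps)
  then show ?thesis using vol_para_pos[OF i] by (simp add: zero_le_mult_iff)
qed

lemma s_scale:
  assumes "r \<ge> 0" shows "s (r *\<^sub>R u) = r * s u"
proof (rule s_unique)
  fix K :: "'a set" assume K: "convex_body K"
  have eq: "h (r *\<^sub>R u) ((*\<^sub>R) (real m) ` K) / real m ^ DIM('a) = r * (h u ((*\<^sub>R) (real m) ` K) / real m ^ DIM('a))" for m
    using supp_scale_arg[OF body[OF convex_body_scale[OF K]] assms] by (simp add: h_def)
  show "(\<lambda>m. h (r *\<^sub>R u) ((*\<^sub>R) (real m) ` K) / real m ^ DIM('a)) \<longlonglongrightarrow> r * s u * vol K"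
    unfolding eq mult.assoc by (rule tendsto_mult_left[OF s_lim[OF K]])
qed

lemma s_zero [simp]: "s 0 = 0"
  using s_scale[of 0 0] by simp

text \<open>The width is an exact multiple of volume, so the width of S can be read off without a
  limit.\<close>

lemma s_w: "s w + s (- w) = \<tau>"
proof -
  obtain v and vs :: "'a list" where i: "indep (v # vs)" "length (v # vs) = DIM('a)" by (rule top_list)
  let ?Q = "para (v # vs)"
  have "(\<lambda>m. om w (- w) ((*\<^sub>R) (real m) ` ?Q) / real m ^ DIM('a)) \<longlonglongrightarrow> (s w + s (- w) - s (w + - w)) * vol ?Q"
    by (rule om_lim[OF convex_body_para])
  moreover have "\<forall>\<^sub>F m in sequentially. om w (- w) ((*\<^sub>R) (real m) ` ?Q) / real m ^ DIM('a) = \<tau> * vol ?Q"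
    using eventually_gt_at_top[of 0]
  proof eventually_elim
    case (elim m)
    have "vol ((*\<^sub>R) (real m) ` ?Q) = real m ^ DIM('a) * vol ?Q" by (simp add: vol_def measure_scale)
    then show ?case using \<tau>(2)[OF convex_body_scale[OF convex_body_para], of "real m" "v # vs"] elim by (simp del: para.simps)
  qed
  then have "(\<lambda>m. om w (- w) ((*\<^sub>R) (real m) ` ?Q) / real m ^ DIM('a)) \<longlonglongrightarrow> \<tau> * vol ?Q" by (rule tendsto_eventually)
  ultimately have "(s w + s (- w) - s (w + - w)) * vol ?Q = \<tau> * vol ?Q" by (rule LIMSEQ_unique)
  then show ?thesis using vol_para_pos[OF i] by simp
qed

text \<open>In directions orthogonal to y - x both ends of the increment give the same linear value,
  so the slope of \<open>om\<close> vanishes; \<open>slope_volume_le\<close> then forces equality in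
  the subadditivity of \<open>s\<close>.\<close>

lemma s_additive_perp:
  assumes i: "indep (v # vs)" and len: "length (v # vs) = DIM('a)"
    and xy: "\<And>u. slope (h u) vs v = max (x \<bullet> u) (y \<bullet> u)" and u: "u1 \<bullet> (y - x) = 0" "u2 \<bullet> (y - x) = 0"
  shows "s (u1 + u2) = s u1 + s u2"
proof -
  have "(s u1 + s u2 - s (u1 + u2)) * vol (para (v # vs)) \<le> slope (om u1 u2) vs v"
    by (rule slope_volume_le[OF real_val_om om_nonneg om_lim i len])
  also have "\<dots> = 0"
    using u by (simp add: slope_om xy inner_add_right inner_diff_right inner_commute)
  finally have "s u1 + s u2 - s (u1 + u2) \<le> 0" using vol_para_pos[OF i len] by (simp add: mult_le_0_iff)
  then show ?thesis using om_lim_nonneg[of u1 u2] by simp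
qed

text \<open>\<open>s\<close> is sublinear, hence the support function of a body. Additivity at u and
  -u for \<open>u\<close> orthogonal to y - x gives that body width 0 in these directions and
  confines it to a line; its ends are its extreme points in the directions -w and w.\<close>

lemma s_segment:
  obtains a b where "\<And>u. s u = max (a \<bullet> u) (b \<bullet> u)" "(b - a) \<bullet> w = \<tau>"
proof -
  obtain v and vs :: "'a list" where i: "indep (v # vs)" "length (v # vs) = DIM('a)" by (rule top_list)
  obtain x y where xy: "\<And>u. slope (h u) vs v = max (x \<bullet> u) (y \<bullet> u)" by (rule top_slope_segment[OF i]) blast
  have sub: "s (u + v) \<le> s u + s v" for u v using om_lim_nonneg[of u v] by simp
  obtain S where S: "convex_body S" "\<And>u. supp S u = s u" using sublinear_body[OF sub s_scale] by blast
  obtain b where b: "b \<in> S" "b \<bullet> w = s w" "\<And>z. z \<in> S \<Longrightarrow> z \<bullet> w \<le> s w" using supp_attained[OF S(1), of w] S(2) by metis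
  obtain a where a: "a \<in> S" "a \<bullet> (- w) = s (- w)" "\<And>z. z \<in> S \<Longrightarrow> z \<bullet> (- w) \<le> s (- w)" using supp_attained[OF S(1), of "- w"] S(2) by metis
  have ba: "(b - a) \<bullet> w = \<tau>" using a(2) b(2) s_w by (simp add: inner_diff_left)
  then have lt: "a \<bullet> w < b \<bullet> w" using \<tau>(1) by (simp add: inner_diff_left)
  have line: "z - a \<in> span {y - x}" if z: "z \<in> S" for z
  proof (rule span_singletonI_orthogonal)
    fix u assume u: "u \<bullet> (y - x) = 0"
    have "s (u + - u) = s u + s (- u)" by (rule s_additive_perp[OF i xy u]) (use u in simp)
    then have s0: "s u + s (- u) = 0" by simp
    have "p \<bullet> u = s u" if "p \<in> S" for p
      using supp_ge[OF S(1) that, of u] supp_ge[OF S(1) that, of "- u"] S(2) s0 by simp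
    then show "u \<bullet> (z - a) = 0" using z a(1) by (simp add: inner_diff_right inner_commute[of u])
  qed
  obtain k where k: "b - a = k *\<^sub>R (y - x)" using line[OF b(1)] by (auto simp: span_singleton)
  \<comment> \<open>The two ends differ in direction \<open>w\<close>, so b - a may replace y - x as
    the spanning vector of the line.\<close>
  have "k \<noteq> 0" using k lt by auto
  have "S = closed_segment a b"
  proof (rule collinear_body_segment[OF S(1) a(1) b(1) lt])
    show "a \<bullet> w \<le> z \<bullet> w \<and> z \<bullet> w \<le> b \<bullet> w" if "z \<in> S" for z using a(2) a(3)[OF that] b(2) b(3)[OF that] by simp
    fix z assume "z \<in> S"
    then obtain j where "z - a = j *\<^sub>R (y - x)" using line by (auto simp: span_singleton)
    then have "z - a = (j / k) *\<^sub>R (b - a)" using k \<open>k \<noteq> 0\<close> by simp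
    then show "z - a \<in> span {b - a}" unfolding span_singleton by blast
  qed
  then have "s u = max (a \<bullet> u) (b \<bullet> u)" for u using S(2)[of u] supp_segment[of a b u] by simp
  then show ?thesis using ba by (rule that)
qed

end

section \<open>The linear part and the formula for the support function\<close>

locale mink_val_segment = mink_val_VC +
  fixes a b :: 'a
  assumes s_eq: "\<And>u. s u = max (a \<bullet> u) (b \<bullet> u)" and ab_w: "(b - a) \<bullet> w = \<tau>"
begin

text \<open>\<open>s\<close> does not depend on the parallelepiped, so every increment in full
  dimension is parallel to b - a. Comparing widths in direction \<open>w\<close> fixes its length:
  up to a translation by \<open>x\<close> it is S scaled by the volume.\<close>

lemma top_slope:
  assumes i: "indep (v # vs)" and len: "length (v # vs) = DIM('a)"
  obtains x where "\<And>u. slope (h u) vs v = x \<bullet> u + vol (para (v # vs)) * (s u - a \<bullet> u)"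
proof -
  let ?V = "vol (para (v # vs))"
  obtain x y where xy: "\<And>u. slope (h u) vs v = max (x \<bullet> u) (y \<bullet> u)" "(y - x) \<bullet> w = \<tau> * ?V"
    by (rule top_slope_segment[OF i len]) blast
  have "b - a \<in> span {y - x}"
  proof (rule span_singletonI_orthogonal)
    fix u assume u: "u \<bullet> (y - x) = 0"
    have "s (u + - u) = s u + s (- u)" by (rule s_additive_perp[OF i len xy(1) u]) (use u in simp)
    then have "max (a \<bullet> u) (b \<bullet> u) + max (- (a \<bullet> u)) (- (b \<bullet> u)) = 0" by (simp add: s_eq)
    then have "a \<bullet> u = b \<bullet> u" by (simp add: max_def split: if_splits)
    then show "u \<bullet> (b - a) = 0" by (simp add: inner_diff_right inner_commute)
  qed
  then obtain k where k: "b - a = k *\<^sub>R (y - x)" by (auto simp: span_singleton)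
  then have "\<tau> = k * (\<tau> * ?V)" using ab_w xy(2) by simp
  then have kV: "k * ?V = 1" using \<tau>(1) by simp
  have "?V *\<^sub>R (b - a) = (?V * k) *\<^sub>R (y - x)" unfolding k by simp
  also have "\<dots> = y - x" using kV by (simp add: mult.commute)
  finally have yx: "y - x = ?V *\<^sub>R (b - a)" by simp
  have "slope (h u) vs v = x \<bullet> u + ?V * (s u - a \<bullet> u)" for u
  proof -
    have V: "?V \<ge> 0" by simp
    have "y \<bullet> u = x \<bullet> u + ?V * (b \<bullet> u - a \<bullet> u)"
      using yx by (metis add_diff_cancel_left' diff_add_cancel inner_add_left inner_diff_left inner_scaleR_left add.commute)
    moreover have "max 0 (?V * (b \<bullet> u - a \<bullet> u)) = ?V * max 0 (b \<bullet> u - a \<bullet> u)"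
      using V max_mult_distrib_left[of ?V 0 "b \<bullet> u - a \<bullet> u"] by simp
    moreover have "s u - a \<bullet> u = max 0 (b \<bullet> u - a \<bullet> u)" by (auto simp: s_eq max_def)
    ultimately show ?thesis unfolding xy(1) by (auto simp: max_def)
  qed
  then show ?thesis by (rule that)
qed

text \<open>Orthogonally to b - a the increment described by \<open>top_slope\<close> is linear in
  the direction, so \<open>om\<close> has slope 0 on every parallelepiped of full dimension.\<close>

lemma om_perp_const:
  assumes u: "u1 \<bullet> (b - a) = 0" "u2 \<bullet> (b - a) = 0" and K: "convex_body K"
  shows "om u1 u2 K = om u1 u2 {0}"
proof (rule zero_top_slopes_imp_const[OF real_val_om om_nonneg _ K])
  fix v and vs :: "'a list" assume i: "indep (v # vs)" "length (v # vs) = DIM('a)"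
  have p: "a \<bullet> u1 = b \<bullet> u1" "a \<bullet> u2 = b \<bullet> u2" using u by (simp_all add: inner_diff_right inner_commute)
  obtain x where "\<And>u. slope (h u) vs v = x \<bullet> u + vol (para (v # vs)) * (s u - a \<bullet> u)" using top_slope[OF i] by blast
  then show "slope (om u1 u2) vs v = 0" unfolding slope_om by (simp add: s_eq p inner_add_right)
qed

text \<open>Volume on convex bodies, written as a multiple of a valuation that is known to be continuous.\<close>
definition V :: "'a set \<Rightarrow> real" where
  "V K = om w (- w) K / \<tau>"

lemma V_vol: "convex_body K \<Longrightarrow> V K = vol K"
  using \<tau> by (simp add: V_def)

lemma real_val_V: "real_val V"
  unfolding V_def by (intro real_val_divide real_val_om)

text \<open>The coefficient of \<open>w\<close> when \<open>u\<close> is split into a vector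
  orthogonal to b - a and a multiple of \<open>w\<close>; the denominator equals w \<bullet> (b -
  a). The first component is the oblique projection \<open>pr u\<close>.\<close>

definition cf :: "'a \<Rightarrow> real" where
  "cf u = (u \<bullet> (b - a)) / \<tau>"

definition pr :: "'a \<Rightarrow> 'a" where
  "pr u = u - cf u *\<^sub>R w"

lemma cf_add: "cf (u + v) = cf u + cf v" and cf_scale: "cf (r *\<^sub>R u) = r * cf u"
  by (simp_all add: cf_def inner_add_left add_divide_distrib)

lemma pr_add: "pr (u + v) = pr u + pr v" and pr_scale: "pr (r *\<^sub>R u) = r *\<^sub>R pr u"
  by (simp_all add: pr_def cf_add cf_scale algebra_simps)

lemma cf_w: "cf w = 1" and pr_w: "pr w = 0"
  using ab_w \<tau>(1) by (simp_all add: cf_def pr_def inner_commute)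

lemma pr_perp: "pr u \<bullet> (b - a) = 0"
  using ab_w \<tau>(1) by (simp add: pr_def cf_def inner_diff_left inner_commute[of w])

lemma pr_cf: "u = pr u + cf u *\<^sub>R w"
  by (simp add: pr_def)

lemma s_perp: "u \<bullet> (b - a) = 0 \<Longrightarrow> s u = a \<bullet> u" "u \<bullet> (b - a) = 0 \<Longrightarrow> b \<bullet> u = a \<bullet> u"
  by (simp_all add: s_eq inner_diff_right inner_commute)

text \<open>Candidate for the inner product of \<open>u\<close> with p(K). Orthogonally to the
  segment the remainder h u K - h u {0} - s u V(K) is additive in \<open>u\<close>; along
  \<open>w\<close>, where it need not be, its value at \<open>w\<close> is extended
  linearly.\<close>

definition q :: "'a \<Rightarrow> 'a set \<Rightarrow> real" where
  "q u K = (h (pr u) K - h (pr u) {0} - s (pr u) * V K) + cf u * (h w K - h w {0} - s w * V K)"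

lemma real_val_q: "real_val (q u)"
  unfolding q_def by (intro real_val_add real_val_diff real_val_cmult real_val_h real_val_V real_val_const)

lemma q_add:
  assumes K: "convex_body K" shows "q (u1 + u2) K = q u1 K + q u2 K"
proof -
  have "h (pr u1) K + h (pr u2) K - h (pr u1 + pr u2) K = h (pr u1) {0} + h (pr u2) {0} - h (pr u1 + pr u2) {0}"
    using om_perp_const[OF pr_perp pr_perp K, of u1 u2] by (simp add: om_def)
  moreover have "(pr u1 + pr u2) \<bullet> (b - a) = 0" using pr_perp[of "u1 + u2"] by (simp only: pr_add)
  then have "s (pr u1 + pr u2) = s (pr u1) + s (pr u2)" by (simp add: s_perp pr_perp inner_add_right)
  ultimately show ?thesis unfolding q_def pr_add cf_add by (simp add: algebra_simps)
qed

lemma q_linear: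
  assumes K: "convex_body K" shows "linear (\<lambda>u. q u K)"
proof -
  have z: "q 0 K = 0" using q_add[OF K, of 0 0] by simp
  have pos: "q (r *\<^sub>R u) K = r * q u K" if "r \<ge> 0" for r u
  proof -
    have "h (pr (r *\<^sub>R u)) M = r * h (pr u) M" if "convex_body M" for M
      unfolding pr_scale h_def by (rule supp_scale_arg[OF body[OF that] \<open>r \<ge> 0\<close>])
    then show ?thesis using K that by (simp add: q_def pr_scale cf_scale s_scale algebra_simps)
  qed
  have neg: "q (- u) K = - q u K" for u using q_add[OF K, of u "- u"] z by simp
  show ?thesis
  proof (rule linearI)
    fix r u show "q (r *\<^sub>R u) K = r *\<^sub>R q u K"
    proof (cases "r \<ge> 0")
      case True then show ?thesis using pos by simp
    next
      case False
      then have "q ((- r) *\<^sub>R (- u)) K = (- r) * q (- u) K" by (intro pos) simp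
      then show ?thesis using neg by simp
    qed
  qed (rule q_add[OF K])
qed

lemma q_point: "q u {0} = 0"
proof -
  have "vol {0::'a} = 0" by (simp add: vol_eq_0_iff)
  then have "V {0} = 0" by (simp add: V_vol)
  then show ?thesis by (simp add: q_def)
qed

text \<open>The functional given by \<open>w\<close> is constant on \<open>\<Phi> {0}\<close>, so
  tilting a direction along \<open>w\<close> changes the support function linearly and keeps its
  maximizer.\<close>

lemma h_L_shift: "h (u + c *\<^sub>R w) {0} = h u {0} + c * \<beta>"
proof -
  have B: "convex_body (\<Phi> {0})" by simp
  obtain x where x: "x \<in> \<Phi> {0}" "x \<bullet> u = supp (\<Phi> {0}) u" "\<And>y. y \<in> \<Phi> {0} \<Longrightarrow> y \<bullet> u \<le> supp (\<Phi> {0}) u"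
    using supp_attained[OF B] by blast
  have e: "y \<bullet> (u + c *\<^sub>R w) = y \<bullet> u + c * \<beta>" if "y \<in> \<Phi> {0}" for y
    using L_hyp[OF that] by (simp add: inner_add_right)
  have "supp (\<Phi> {0}) (u + c *\<^sub>R w) = x \<bullet> (u + c *\<^sub>R w)"
    by (rule supp_eqI[OF B x(1)]) (use e x in auto)
  then show ?thesis using e[OF x(1)] x(2) by (simp add: h_def)
qed

text \<open>The right-hand side is the support function of \<open>\<Phi> {0} + q + V S\<close>; compare the two bodies in directions
  orthogonal to the segment and in the directions \<open>\<plusminus>w\<close>.\<close>
lemma h_upper:
  assumes K: "convex_body K"
  shows "h u K \<le> h u {0} + s u * V K + q u K"
proof -
  have B: "convex_body (\<Phi> K)" using K by simp
  have z: "h 0 K = 0" "h 0 {0} = 0" using K by simp_all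
  have V0: "V K \<ge> 0" using V_vol[OF K] by simp
  have w1: "h w K = q w K + \<beta> + s w * V K"
    using h_L_shift[of 0 1] z by (simp add: q_def pr_w cf_w)
  \<comment> \<open>At \<open>w\<close> the claimed bound is an equality by definition of
    \<open>q\<close>; at \<open>-w\<close> it is one because the width of \<open>\<Phi> K\<close> is
    exactly \<open>\<tau> * V K\<close>.\<close>
  have "om w (- w) K = \<tau> * V K" using \<tau>(1) by (simp add: V_def)
  then have w2: "h (- w) K = \<tau> * V K - q w K - \<beta> - s w * V K" using w1 z by (simp add: om_def)
  have sw: "s w = b \<bullet> w" using ab_w \<tau>(1) by (simp add: s_eq inner_diff_left)
  have tau: "\<tau> = b \<bullet> w - a \<bullet> w" using ab_w by (simp add: inner_diff_left)
  have cfpr: "cf (pr u) = 0" unfolding cf_def using pr_perp[of u] by simp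
  have prpr: "pr (pr u) = pr u" using cfpr by (simp add: pr_def[of "pr u"])
  have p1: "h (pr u) K = q (pr u) K + h (pr u) {0} + a \<bullet> pr u * V K"
    using s_perp(1)[OF pr_perp] by (simp add: q_def prpr cfpr)
  have qu: "q u K = q (pr u) K + cf u * q w K"
  proof -
    have "q u K = q (pr u + cf u *\<^sub>R w) K" using pr_cf[of u] by simp
    then show ?thesis using linear_add[OF q_linear[OF K]] linear_scale[OF q_linear[OF K]] by simp
  qed
  have hu: "h u {0} = h (pr u) {0} + cf u * \<beta>" using h_L_shift[of "pr u" "cf u"] pr_cf[of u] by simp
  have au: "a \<bullet> u = a \<bullet> pr u + cf u * (a \<bullet> w)" "b \<bullet> u = a \<bullet> pr u + cf u * (b \<bullet> w)"
    using arg_cong[OF pr_cf[of u], of "\<lambda>z. a \<bullet> z"] arg_cong[OF pr_cf[of u], of "\<lambda>z. b \<bullet> z"] s_perp(2)[OF pr_perp[of u]]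
    by (simp_all add: inner_add_right)
  obtain x where x: "x \<in> \<Phi> K" "x \<bullet> u = h u K" using supp_attained[OF B, of u] unfolding h_def by metis
  have xu: "x \<bullet> u = x \<bullet> pr u + cf u * (x \<bullet> w)"
    using arg_cong[OF pr_cf[of u], of "\<lambda>z. x \<bullet> z"] by (simp add: inner_add_right)
  have x1: "x \<bullet> pr u \<le> h (pr u) K" unfolding h_def by (rule supp_ge[OF B x(1)])
  have x2: "x \<bullet> w \<le> h w K" unfolding h_def by (rule supp_ge[OF B x(1)])
  have x3: "- (x \<bullet> w) \<le> h (- w) K" using supp_ge[OF B x(1), of "- w"] unfolding h_def by simp
  show ?thesis
  \<comment> \<open>The sign decides which of the directions w and -w bounds the component of
    \<open>x\<close> along \<open>w\<close>, and with it which end of the segment appears.\<close>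
  proof (cases "cf u \<ge> 0")
    case True
    have "cf u * (x \<bullet> w) \<le> cf u * h w K" using x2 True by (rule mult_left_mono)
    then have "h u K \<le> h (pr u) K + cf u * h w K" using x(2) xu x1 by linarith
    also have "\<dots> = h u {0} + (b \<bullet> u) * V K + q u K" unfolding p1 w1 qu hu au sw by (simp add: algebra_simps)
    also have "\<dots> \<le> h u {0} + s u * V K + q u K" using V0 by (intro add_mono order_refl mult_right_mono) (auto simp: s_eq)
    finally show ?thesis .
  next
    case False
    then have "(- cf u) * (- (x \<bullet> w)) \<le> (- cf u) * h (- w) K" using x3 by (intro mult_left_mono) auto
    then have "h u K \<le> h (pr u) K - cf u * h (- w) K" using x(2) xu x1 by simp
    also have "\<dots> = h u {0} + (a \<bullet> u) * V K + q u K" unfolding p1 w2 qu hu au sw tau by (simp add: algebra_simps)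
    also have "\<dots> \<le> h u {0} + s u * V K + q u K" using V0 by (intro add_mono order_refl mult_right_mono) (auto simp: s_eq)
    finally show ?thesis .
  qed
qed

text \<open>The remainder \<open>r u\<close> is nonnegative by \<open>h_upper\<close>, and its
  slopes in full dimension are odd in \<open>u\<close>. Nonnegative and odd means zero, so
  \<open>r u\<close> is constant, with value 0 at {0}.\<close>

theorem h_formula:
  assumes K: "convex_body K"
  shows "h u K = h u {0} + s u * V K + q u K"
proof -
  define r where "r u K = h u {0} + s u * V K + q u K - h u K" for u K
  have rv: "real_val (r u)" for u
    unfolding r_def by (intro real_val_diff real_val_add real_val_cmult real_val_h real_val_V real_val_q real_val_const)
  have rn: "r u K \<ge> 0" if "convex_body K" for u K using h_upper[OF that, of u] by (simp add: r_def)
  have "r u K = r u {0}"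
  proof (rule zero_top_slopes_imp_const[OF rv rn _ K])
    fix v and vs :: "'a list" assume i: "indep (v # vs)" "length (v # vs) = DIM('a)"
    obtain x where x: "\<And>u. slope (h u) vs v = x \<bullet> u + vol (para (v # vs)) * (s u - a \<bullet> u)" using top_slope[OF i] by blast
    have "V (para vs) = 0" using V_vol[OF convex_body_para, of vs] vol_para_low[of vs] i(2) by simp
    then have Vs: "slope V vs v = vol (para (v # vs))" using V_vol[OF convex_body_para, of "v # vs"] by (simp add: slope_def)
    have sl: "slope (r u) vs v = s u * slope V vs v + slope (q u) vs v - slope (h u) vs v" for u
      by (simp add: slope_def r_def algebra_simps del: para.simps)
    \<comment> \<open>The terms with \<open>s u\<close>, the only nonlinear ones, cancel by
      \<open>top_slope\<close>.\<close>
    have eq: "slope (r u) vs v = slope (q u) vs v - x \<bullet> u + vol (para (v # vs)) * (a \<bullet> u)" for u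
      unfolding sl x Vs by (simp add: algebra_simps)
    have "slope (q (- u)) vs v = - slope (q u) vs v"
      unfolding slope_def using linear_neg[OF q_linear[OF convex_body_para]] by (simp del: para.simps)
    then have "slope (r (- u)) vs v = - slope (r u) vs v" by (simp add: eq)
    moreover have "slope (r u') vs v \<ge> 0" for u'
      by (rule slope_nonneg[OF rv rn indep_ConsD(2)[OF i(1)]])
    from this[of u] this[of "- u"] have "slope (r u) vs v \<ge> 0" "slope (r (- u)) vs v \<ge> 0" .
    ultimately show "slope (r u) vs v = 0" by simp
  qed
  moreover have "r u {0} = 0"
  proof -
    have "vol {0::'a} = 0" by (simp add: vol_eq_0_iff)
    then show ?thesis by (simp add: r_def q_point V_vol)
  qed
  ultimately show ?thesis by (simp add: r_def)
qed

text \<open>The growth of order m^n was subtracted in the definition of \<open>q\<close>, so its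
  part of degree n vanishes. With \<open>q_point\<close> this leaves the degrees 1 to n-1.\<close>

lemma q_lim:
  assumes K: "convex_body K"
  shows "(\<lambda>m. q u ((*\<^sub>R) (real m) ` K) / real m ^ DIM('a)) \<longlonglongrightarrow> 0"
proof -
  let ?n = "DIM('a)"
  have "(\<lambda>m. om w (- w) ((*\<^sub>R) (real m) ` K) / real m ^ ?n / \<tau>) \<longlonglongrightarrow> (s w + s (- w) - s (w + - w)) * vol K / \<tau>"
    by (intro tendsto_divide om_lim K tendsto_const) (use \<tau>(1) in simp)
  then have V: "(\<lambda>m. V ((*\<^sub>R) (real m) ` K) / real m ^ ?n) \<longlonglongrightarrow> vol K"
    using s_w \<tau>(1) by (simp add: V_def mult.commute)
  have c: "(\<lambda>m. c / real m ^ ?n) \<longlonglongrightarrow> 0" for c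
  proof -
    have "(\<lambda>m. c * (1 / real m) ^ ?n) \<longlonglongrightarrow> c * 0 ^ ?n" by (intro tendsto_intros lim_1_over_n)
    then show ?thesis by (simp add: power_one_over power_0_left)
  qed
  have part: "(\<lambda>m. h u ((*\<^sub>R) (real m) ` K) / real m ^ ?n - h u {0} / real m ^ ?n - s u * (V ((*\<^sub>R) (real m) ` K) / real m ^ ?n))
     \<longlonglongrightarrow> s u * vol K - 0 - s u * vol K" for u
    by (intro tendsto_diff s_lim K c tendsto_mult_left V)
  have "(\<lambda>m. (h (pr u) ((*\<^sub>R) (real m) ` K) / real m ^ ?n - h (pr u) {0} / real m ^ ?n - s (pr u) * (V ((*\<^sub>R) (real m) ` K) / real m ^ ?n))
     + cf u * (h w ((*\<^sub>R) (real m) ` K) / real m ^ ?n - h w {0} / real m ^ ?n - s w * (V ((*\<^sub>R) (real m) ` K) / real m ^ ?n)))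
     \<longlonglongrightarrow> (s (pr u) * vol K - 0 - s (pr u) * vol K) + cf u * (s w * vol K - 0 - s w * vol K)"
    by (intro tendsto_add tendsto_mult_left part)
  moreover have e: "x / d - y / d - t * (z / d) = (x - y - t * z) / d" for x y z t d :: real
    by (simp add: diff_divide_distrib)
  ultimately show ?thesis unfolding e by (simp add: q_def add_divide_distrib)
qed

lemma q_decomposition:
  "\<exists>g. (\<forall>j\<in>{1..DIM('a) - 1}. real_val (g j) \<and> homog j (g j)) \<and> (\<forall>K. convex_body K \<longrightarrow> q u K = (\<Sum>j=1..DIM('a) - 1. g j K))"
proof -
  let ?n = "DIM('a)"
  obtain g c where g: "\<forall>j\<le>?n. real_val (g j) \<and> homog j (g j)"
    "\<forall>K. convex_body K \<longrightarrow> q u K = (\<Sum>j\<le>?n. g j K) \<and> g 0 K = q u {0} \<and> g ?n K = c * vol K \<and>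
      (\<lambda>m. q u ((*\<^sub>R) (real m) ` K) / real m ^ ?n) \<longlonglongrightarrow> c * vol K"
    using homog_decomposition[OF real_val_q[of u]] by (elim exE conjE)
  have gn: "g ?n K = 0" if "convex_body K" for K
  proof -
    have "g ?n K = c * vol K" "(\<lambda>m. q u ((*\<^sub>R) (real m) ` K) / real m ^ ?n) \<longlonglongrightarrow> c * vol K" using g(2) that by blast+
    moreover from this(2) have "c * vol K = 0" by (rule LIMSEQ_unique[OF _ q_lim[OF that]])
    ultimately show ?thesis by simp
  qed
  have "q u K = (\<Sum>j=1..?n - 1. g j K)" if K: "convex_body K" for K
  proof -
    have "q u K = (\<Sum>j\<le>?n. g j K)" using g(2) K by blast
    also have "\<dots> = (\<Sum>j=1..?n - 1. g j K)"
    proof (rule sum.mono_neutral_right)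
      show "\<forall>j\<in>{..?n} - {1..?n - 1}. g j K = 0"
      proof
        fix j assume "j \<in> {..?n} - {1..?n - 1}"
        then have "j = 0 \<or> j = ?n" by auto
        then show "g j K = 0" using gn[OF K] g(2) K q_point by auto
      qed
    qed auto
    finally show ?thesis .
  qed
  then show ?thesis using g(1) by (intro exI[of _ g]) auto
qed

end

subsection \<open>Vector-valued valuations\<close>

lemma vec_of_real_vals:
  fixes g :: "'a::euclidean_space \<Rightarrow> 'a set \<Rightarrow> real"
  assumes g: "\<And>b. b \<in> Basis \<Longrightarrow> real_val (g b)"
  shows "vec_continuous (\<lambda>K. \<Sum>b\<in>Basis. g b K *\<^sub>R b)" "vec_trans_inv (\<lambda>K. \<Sum>b\<in>Basis. g b K *\<^sub>R b)"
    "vec_valuation (\<lambda>K. \<Sum>b\<in>Basis. g b K *\<^sub>R b)"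
proof -
  show "vec_trans_inv (\<lambda>K. \<Sum>b\<in>Basis. g b K *\<^sub>R b)"
    unfolding vec_trans_inv_def using real_valD(2)[OF g] by simp
  show "vec_valuation (\<lambda>K. \<Sum>b\<in>Basis. g b K *\<^sub>R b)"
    unfolding vec_valuation_def
  proof (intro allI impI)
    fix K L :: "'a set" assume *: "convex_body K \<and> convex_body L \<and> convex_body (K \<union> L)"
    have "g b K *\<^sub>R b + g b L *\<^sub>R b = g b (K \<union> L) *\<^sub>R b + g b (K \<inter> L) *\<^sub>R b" if "b \<in> Basis" for b
      using real_valD(1)[OF g[OF that], of K L] * by (simp add: scaleR_add_left[symmetric])
    then show "(\<Sum>b\<in>Basis. g b K *\<^sub>R b) + (\<Sum>b\<in>Basis. g b L *\<^sub>R b)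
        = (\<Sum>b\<in>Basis. g b (K \<union> L) *\<^sub>R b) + (\<Sum>b\<in>Basis. g b (K \<inter> L) *\<^sub>R b)"
      unfolding sum.distrib[symmetric] by (intro sum.cong) auto
  qed
  show "vec_continuous (\<lambda>K. \<Sum>b\<in>Basis. g b K *\<^sub>R b)"
    unfolding vec_continuous_def
  proof (intro allI impI)
    fix K :: "'a set" and e :: real assume *: "convex_body K \<and> 0 < e"
    have "\<forall>b\<in>Basis. \<exists>d>0. \<forall>K'. convex_body K' \<and> hausdist K K' < d \<longrightarrow> \<bar>g b K - g b K'\<bar> < e / real DIM('a)"
    proof
      fix b :: 'a assume b: "b \<in> Basis"
      have "e / real DIM('a) > 0" using * by simp
      then show "\<exists>d>0. \<forall>K'. convex_body K' \<and> hausdist K K' < d \<longrightarrow> \<bar>g b K - g b K'\<bar> < e / real DIM('a)"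
        using g[OF b, unfolded real_val_def] * by simp
    qed
    then have "\<exists>d. \<forall>b\<in>Basis. d b > 0 \<and> (\<forall>K'. convex_body K' \<and> hausdist K K' < d b \<longrightarrow> \<bar>g b K - g b K'\<bar> < e / real DIM('a))"
      by (rule bchoice)
    then obtain d where d: "\<And>b. b \<in> Basis \<Longrightarrow> d b > 0"
      "\<And>b K'. b \<in> Basis \<Longrightarrow> convex_body K' \<Longrightarrow> hausdist K K' < d b \<Longrightarrow> \<bar>g b K - g b K'\<bar> < e / real DIM('a)" by blast
    define d0 where "d0 = Min (d ` (Basis :: 'a set))"
    have d0: "d0 > 0" "\<And>b. b \<in> Basis \<Longrightarrow> d0 \<le> d b" unfolding d0_def using d(1) by simp_all
    show "\<exists>d>0. \<forall>K'. convex_body K' \<and> hausdist K K' < d \<longrightarrow> dist (\<Sum>b\<in>Basis. g b K *\<^sub>R b) (\<Sum>b\<in>Basis. g b K' *\<^sub>R b) < e"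
    proof (intro exI[of _ d0] conjI allI impI d0(1))
      fix K' assume K': "convex_body K' \<and> hausdist K K' < d0"
      have lt: "\<bar>g b K - g b K'\<bar> < e / real DIM('a)" if "b \<in> Basis" for b
        using d(2)[OF that, of K'] d0(2)[OF that] K' by simp
      have "dist (\<Sum>b\<in>Basis. g b K *\<^sub>R b) (\<Sum>b\<in>Basis. g b K' *\<^sub>R b) = norm (\<Sum>b\<in>Basis. (g b K - g b K') *\<^sub>R b)"
        by (simp add: dist_norm sum_subtractf[symmetric] scaleR_left_diff_distrib)
      also have "\<dots> \<le> (\<Sum>b\<in>(Basis::'a set). \<bar>g b K - g b K'\<bar>)"
        by (rule order_trans[OF norm_sum]) (auto intro!: sum_mono)
      also have "\<dots> < (\<Sum>b\<in>(Basis::'a set). e / real DIM('a))"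
        by (rule sum_strict_mono) (use lt in auto)
      finally show "dist (\<Sum>b\<in>Basis. g b K *\<^sub>R b) (\<Sum>b\<in>Basis. g b K' *\<^sub>R b) < e" by simp
    qed
  qed
qed

lemma vec_homogeneous_of_homog:
  assumes "\<And>b. b \<in> Basis \<Longrightarrow> homog j (g b)"
  shows "vec_homogeneous j (\<lambda>K. \<Sum>b\<in>Basis. g b K *\<^sub>R (b::'a::euclidean_space))"
  unfolding vec_homogeneous_def
  using assms by (auto simp: homog_def scaleR_sum_right intro!: sum.cong)

text \<open>The vectors p_j are assembled from the homogeneous parts of \<open>q\<close> at the
  basis vectors; linearity of \<open>q\<close> in \<open>u\<close> then gives the inner product of
  their sum with every direction, and the formula follows by comparing support functions.\<close>

lemma (in mink_val_segment) representation:
  obtains p :: "nat \<Rightarrow> 'a set \<Rightarrow> 'a" where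
    "\<And>j. j \<in> {1..DIM('a) - 1} \<Longrightarrow> vec_continuous (p j) \<and> vec_trans_inv (p j) \<and> vec_valuation (p j) \<and> vec_homogeneous j (p j)"
    "\<And>K. convex_body K \<Longrightarrow> \<Phi> K = msum (translate (\<Phi> {0}) (\<Sum>j=1..DIM('a) - 1. p j K)) ((*\<^sub>R) (vol K) ` closed_segment a b)"
proof -
  let ?n = "DIM('a)"
  have "\<forall>u. \<exists>g. (\<forall>j\<in>{1..?n - 1}. real_val (g j) \<and> homog j (g j)) \<and> (\<forall>K. convex_body K \<longrightarrow> q u K = (\<Sum>j=1..?n - 1. g j K))"
    using q_decomposition by blast
  then have "\<exists>g. \<forall>u. (\<forall>j\<in>{1..?n - 1}. real_val (g u j) \<and> homog j (g u j)) \<and> (\<forall>K. convex_body K \<longrightarrow> q u K = (\<Sum>j=1..?n - 1. g u j K))"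
    by (rule choice)
  then obtain g where g: "\<And>u j. j \<in> {1..?n - 1} \<Longrightarrow> real_val (g u j)" "\<And>u j. j \<in> {1..?n - 1} \<Longrightarrow> homog j (g u j)"
    "\<And>u K. convex_body K \<Longrightarrow> q u K = (\<Sum>j=1..?n - 1. g u j K)" by blast
  define p where "p j K = (\<Sum>b\<in>Basis. g b j K *\<^sub>R b)" for j and K :: "'a set"
  show ?thesis
  proof (rule that[of p])
    fix j assume "j \<in> {1..?n - 1}"
    then show "vec_continuous (p j) \<and> vec_trans_inv (p j) \<and> vec_valuation (p j) \<and> vec_homogeneous j (p j)"
      unfolding p_def using vec_of_real_vals[of "\<lambda>b. g b j"] vec_homogeneous_of_homog[of j "\<lambda>b. g b j"] g(1,2) by simp
  next
    fix K :: "'a set" assume K: "convex_body K"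
    let ?p = "\<Sum>j=1..?n - 1. p j K"
    have p: "?p \<bullet> u = q u K" for u
    proof -
      have "?p = (\<Sum>b\<in>Basis. (\<Sum>j=1..?n - 1. g b j K) *\<^sub>R b)"
        unfolding p_def by (subst sum.swap) (simp add: scaleR_sum_left)
      then have "?p = (\<Sum>b\<in>Basis. q b K *\<^sub>R b)" using g(3)[OF K] by simp
      then have "?p \<bullet> u = (\<Sum>b\<in>Basis. (u \<bullet> b) * q b K)"
        by (simp add: inner_sum_left) (intro sum.cong refl, simp add: inner_commute[of u])
      also have "\<dots> = q (\<Sum>b\<in>Basis. (u \<bullet> b) *\<^sub>R b) K"
        using linear_sum[OF q_linear[OF K], of "\<lambda>b. (u \<bullet> b) *\<^sub>R b" Basis] linear_scale[OF q_linear[OF K]] by simp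
      finally show ?thesis by (simp add: euclidean_representation)
    qed
    have b1: "convex_body (translate (\<Phi> {0}) ?p)" by (intro convex_body_translate body convex_body_singleton)
    have b2: "convex_body ((*\<^sub>R) (vol K) ` closed_segment a b)" by (intro convex_body_scale convex_body_segment)
    show "\<Phi> K = msum (translate (\<Phi> {0}) ?p) ((*\<^sub>R) (vol K) ` closed_segment a b)"
    proof (rule body_eq_supp[OF body[OF K] convex_body_msum[OF b1 b2]])
      fix u
      have "supp (msum (translate (\<Phi> {0}) ?p) ((*\<^sub>R) (vol K) ` closed_segment a b)) u
         = (supp (\<Phi> {0}) u + ?p \<bullet> u) + vol K * supp (closed_segment a b) u"
        by (simp only: supp_msum[OF b1 b2] supp_translate[OF body[OF convex_body_singleton]]
            supp_scale_body[OF convex_body_segment vol_nonneg])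
      also have "\<dots> = h u {0} + q u K + vol K * s u" unfolding p supp_segment s_eq h_def ..
      also have "\<dots> = h u K" using h_formula[OF K, of u] V_vol[OF K] by (simp add: mult.commute)
      finally show "supp (\<Phi> K) u = supp (msum (translate (\<Phi> {0}) ?p) ((*\<^sub>R) (vol K) ` closed_segment a b)) u"
        unfolding h_def by (rule sym)
    qed
  qed
qed

section \<open>Volume of the represented bodies and the equivalence\<close>

lemma hyperplane_of_aff_dim:
  fixes L :: "'a::euclidean_space set"
  assumes "aff_dim L = int DIM('a) - 1"
  obtains w \<beta> where "w \<noteq> 0" "\<And>x. x \<in> L \<Longrightarrow> x \<bullet> w = \<beta>"
proof -
  obtain w \<beta> where w: "w \<noteq> 0" "affine hull L = {x. w \<bullet> x = \<beta>}"
    using assms aff_dim_eq_hyperplane[of L] by auto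
  have "x \<bullet> w = \<beta>" if "x \<in> L" for x using hull_inc[OF that, of affine] w(2) by (simp add: inner_commute)
  then show ?thesis using w(1) that by blast
qed

text \<open>Moving the segment to start at 0 reduces the claim to \<open>vol_prism\<close>. In the
  converse direction it makes the volume of \<open>\<Phi> K\<close> an exact multiple of
  \<open>vol K\<close>.\<close>

lemma vol_msum_scaled_segment:
  fixes L :: "'a::euclidean_space set"
  assumes L: "convex_body L" "aff_dim L = int DIM('a) - 1" and l: "l \<ge> 0"
  shows "vol (msum (translate L t) ((*\<^sub>R) l ` closed_segment a b)) = l * vol (msum L (closed_segment a b))"
proof -
  obtain w \<beta> where w: "w \<noteq> 0" "\<And>x. x \<in> L \<Longrightarrow> x \<bullet> w = \<beta>" using hyperplane_of_aff_dim[OF L(2)] by blast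
  have seg: "(*\<^sub>R) r ` closed_segment a b = translate (closed_segment 0 (r *\<^sub>R (b - a))) (r *\<^sub>R a)" for r
  proof (rule body_eq_supp)
    fix u
    have "supp ((*\<^sub>R) r ` closed_segment a b) u = supp (closed_segment (r *\<^sub>R a) (r *\<^sub>R b)) u"
      using closed_segment_linear_image[of "(*\<^sub>R) r" a b] by simp
    then show "supp ((*\<^sub>R) r ` closed_segment a b) u = supp (translate (closed_segment 0 (r *\<^sub>R (b - a))) (r *\<^sub>R a)) u"
      by (simp add: supp_segment supp_translate inner_diff_left max_def algebra_simps)
  qed (auto intro!: convex_body_scale convex_body_translate)
  have tr: "msum (translate A x) (translate B y) = translate (msum A B) (x + y)" for A B :: "'a set" and x y
  proof -
    have "msum (msum A {x}) (msum B {y}) = msum (msum A B) (msum {x} {y})"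
      by (metis msum_assoc msum_commute)
    moreover have "msum {x} {y} = {x + y}" by (auto simp: msum_def)
    ultimately show ?thesis by (simp add: msum_singleton)
  qed
  have "vol (msum (translate L t) ((*\<^sub>R) l ` closed_segment a b)) = vol (msum L (closed_segment 0 (l *\<^sub>R (b - a))))"
    unfolding seg tr by (rule vol_translate)
  also have "\<dots> = l * vol (msum L (closed_segment 0 (b - a)))" by (rule vol_prism[OF L(1) w l])
  also have "vol (msum L (closed_segment 0 (b - a))) = vol (msum L (closed_segment a b))"
  proof -
    have "msum L (closed_segment a b) = msum (translate L 0) ((*\<^sub>R) 1 ` closed_segment a b)" by (simp add: translate_def)
    then show ?thesis unfolding seg tr by (simp add: vol_translate)
  qed
  finally show ?thesis .
qed

theorem theorem5p2:
  fixes \<Phi> :: "'a::euclidean_space set \<Rightarrow> 'a set"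
  assumes "DIM('a) \<ge> 2"
    and "maps_bodies \<Phi>" and "mink_continuous \<Phi>" and "mink_trans_inv \<Phi>" and "mink_valuation \<Phi>"
  shows "(VC \<Phi> \<and> aff_dim (\<Phi> {0}) = int DIM('a) - 1) \<longleftrightarrow>
    (\<exists>L a b (p :: nat \<Rightarrow> 'a set \<Rightarrow> 'a).
       convex_body L \<and> aff_dim L = int DIM('a) - 1 \<and>
       aff_dim (msum L (closed_segment a b)) = int DIM('a) \<and>
       (\<forall>j\<in>{1..DIM('a) - 1}. vec_continuous (p j) \<and> vec_trans_inv (p j) \<and>
           vec_valuation (p j) \<and> vec_homogeneous j (p j)) \<and>
       (\<forall>K. convex_body K \<longrightarrow>
          \<Phi> K = msum (translate L (\<Sum>j=1..DIM('a) - 1. p j K))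
                       ((\<lambda>x. vol K *\<^sub>R x) ` closed_segment a b)))"
    (is "?lhs \<longleftrightarrow> ?rhs")
proof
  assume lhs: ?lhs
  interpret mink_val \<Phi> using assms by unfold_locales
  obtain c C where cC: "c > 0" "C > 0"
    "\<forall>K. convex_body K \<longrightarrow> c * vol K \<le> vol (\<Phi> K) \<and> vol (\<Phi> K) \<le> C * vol K"
    using lhs unfolding VC_def by blast
  have dim: "aff_dim (\<Phi> {0}) = int DIM('a) - 1" using lhs by blast
  obtain w \<beta> where w: "w \<noteq> 0" "\<And>x. x \<in> \<Phi> {0} \<Longrightarrow> x \<bullet> w = \<beta>" using hyperplane_of_aff_dim[OF dim] by blast
  have low: "vol (\<Phi> K) > 0" if "convex_body K" "vol K > 0" for K
  proof -
    have "0 < c * vol K" using cC(1) that(2) by simp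
    also have "\<dots> \<le> vol (\<Phi> K)" using cC(3) that(1) by blast
    finally show ?thesis .
  qed
  interpret mink_val_VC \<Phi> w \<beta> C
    by unfold_locales (use dim w cC low in blast)+
  obtain a b where ab: "\<And>u. s u = max (a \<bullet> u) (b \<bullet> u)" "(b - a) \<bullet> w = \<tau>" by (rule s_segment) blast
  interpret mink_val_segment \<Phi> w \<beta> C a b
    by unfold_locales (use ab in blast)+
  obtain p :: "nat \<Rightarrow> 'a set \<Rightarrow> 'a" where
    p: "\<And>j. j \<in> {1..DIM('a) - 1} \<Longrightarrow> vec_continuous (p j) \<and> vec_trans_inv (p j) \<and> vec_valuation (p j) \<and> vec_homogeneous j (p j)"
    "\<And>K. convex_body K \<Longrightarrow> \<Phi> K = msum (translate (\<Phi> {0}) (\<Sum>j=1..DIM('a) - 1. p j K)) ((*\<^sub>R) (vol K) ` closed_segment a b)"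
    by (rule representation) blast
  \<comment> \<open>The segment has positive width \<open>\<tau>\<close> in direction
    \<open>w\<close>, so it is transverse to the hyperplane of \<open>\<Phi> {0}\<close>.\<close>
  have "a \<bullet> w \<noteq> b \<bullet> w" using ab(2) \<tau>(1) by (simp add: inner_diff_left)
  then have full: "aff_dim (msum (\<Phi> {0}) (closed_segment a b)) = int DIM('a)"
    by (intro aff_dim_msum_transverse[OF dim w(2), of a _ b]) auto
  show ?rhs
  proof (rule exI[of _ "\<Phi> {0}"], rule exI[of _ a], rule exI[of _ b], rule exI[of _ p], intro conjI)
    show "convex_body (\<Phi> {0})" by (rule body[OF convex_body_singleton])
    show "\<forall>j\<in>{1..DIM('a) - 1}. vec_continuous (p j) \<and> vec_trans_inv (p j) \<and> vec_valuation (p j) \<and> vec_homogeneous j (p j)"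
      by (rule ballI) (rule p(1))
    show "\<forall>K. convex_body K \<longrightarrow> \<Phi> K = msum (translate (\<Phi> {0}) (\<Sum>j=1..DIM('a) - 1. p j K))
        ((\<lambda>x. vol K *\<^sub>R x) ` closed_segment a b)"
      by (intro allI impI) (rule p(2))
  qed (rule dim, rule full)
next
  assume ?rhs
  then obtain L a b and p :: "nat \<Rightarrow> 'a set \<Rightarrow> 'a" where L: "convex_body L" "aff_dim L = int DIM('a) - 1"
    and full: "aff_dim (msum L (closed_segment a b)) = int DIM('a)"
    and rep: "\<forall>K. convex_body K \<longrightarrow>
      \<Phi> K = msum (translate L (\<Sum>j=1..DIM('a) - 1. p j K)) ((\<lambda>x. vol K *\<^sub>R x) ` closed_segment a b)"
    by (elim exE conjE)
  let ?c = "vol (msum L (closed_segment a b))"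
  have c: "?c > 0" using vol_pos_iff[OF convex_body_msum[OF L(1) convex_body_segment]] full by blast
  have "vol (\<Phi> K) = ?c * vol K" if K: "convex_body K" for K
    using rep[rule_format, OF K] vol_msum_scaled_segment[OF L vol_nonneg[of K]] by (simp add: mult.commute)
  \<comment> \<open>The same number serves as lower and upper constant.\<close>
  then have "VC \<Phi>" unfolding VC_def using c by (intro exI[of _ ?c]) simp
  moreover have "aff_dim (\<Phi> {0}) = int DIM('a) - 1"
  proof -
    let ?t = "\<Sum>j=1..DIM('a) - 1. p j {0}"
    \<comment> \<open>A point has volume 0, so the segment shrinks to {0} and a translate of
      \<open>L\<close> remains.\<close>
    have "vol {0::'a} = 0" by (simp add: vol_eq_0_iff)
    moreover have "(\<lambda>x. 0) ` closed_segment a b = {0::'a}" using ends_in_segment(1)[of a b] by blast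
    ultimately have "\<Phi> {0} = msum (translate L ?t) {0}" using rep[rule_format, OF convex_body_singleton, of 0] by simp
    also have "\<dots> = (+) ?t ` L" by (simp add: msum_singleton translate_def image_image add.commute)
    finally show ?thesis using L(2) by (simp only: aff_dim_translation_eq)
  qed
  ultimately show ?lhs by blast
qed

end
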